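(* Let $\mathcal{X},\mathcal{Y}$ be Polish spaces, $P_X\in\mathcal{P}(\mathcal{X})$, $P_Y\in\mathcal{P}(\mathcal{Y})$, $c:\mathcal{X}\times\mathcal{Y}\to[0,+\infty]$ lower semi-continuous, and $\alpha\ge 0$ such that $\{(x,y):c(x,y)>\alpha\}$ is nonempty. Then for every $n\ge 1$, \begin{align*} \mathcal{G}_{\alpha}^{(n)}(P_X,P_Y)&=\min_{\pi\in\Pi(\mu_n,\nu_n)}\pi\{(Q_X,Q_Y)\in\mathcal{P}(\mathcal{X})\times\mathcal{P}(\mathcal{Y}):\mathcal{E}(Q_X,Q_Y)>\alpha\}\\ &=\sup_{A,B}\ \mu_n(A)+\nu_n(B)-1\\ &=\sup_{\text{compact }A\subseteq\mathcal{P}(\mathcal{X})}\mu_n(A)-\nu_n(\Gamma_{\mathcal{E}\le\alpha}(A)), \end{align*} where the supremum in the second line is over all closed $A\subseteq\mathcal{P}(\mathcal{X})$ and closed $B\subseteq\mathcal{P}(\mathcal{Y})$ such that $\mathcal{E}(Q_X,Q_Y)>\alpha$ for all $Q_X\in A$, $Q_Y\in B$, and $$\Gamma_{\mathcal{E}\le\alpha}(A):=\bigcup_{Q_X\in A}\{Q_Y\in\mathcal{P}(\mathcal{Y}):\mathcal{E}(Q_X,Q_Y)\le\alpha\}.$$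
   Context: $\mathcal{P}(\mathcal{Z})$ denotes the set of Borel probability measures on a Polish space $\mathcal{Z}$, equipped with the weak topology (topology of weak convergence) and the corresponding Borel $\sigma$-algebra. $\Pi(P,Q)$ denotes the set of couplings of probability measures $P,Q$, i.e. probability measures on the product space with marginals $P$ and $Q$. Optimal transport cost: $\mathcal{E}(Q_X,Q_Y):=\min_{Q_{XY}\in\Pi(Q_X,Q_Y)}\mathbb{E}_{(X,Y)\sim Q_{XY}}[c(X,Y)]\in[0,+\infty]$. $n$-dimensional cost: $c_n(x^n,y^n):=\frac1n\sum_{i=1}^n c(x_i,y_i)$ for $x^n\in\mathcal{X}^n,y^n\in\mathcal{Y}^n$. $n$-dimensional optimal excess-cost probability: $\mathcal{G}_{\alpha}^{(n)}(P_X,P_Y):=\min_{P_{X^nY^n}\in\Pi(P_X^{\otimes n},P_Y^{\otimes n})}\mathbb{P}_{(X^n,Y^n)\sim P_{X^nY^n}}\{c_n(X^n,Y^n)>\alpha\}$, where $P^{\otimes n}$ is the $n$-fold product measure. The empirical measure of $x^n$ is $T_{x^n}:=\frac1n\sum_{i=1}^n\delta_{x_i}$. $\mu_n$ is the law (a probability measure on $\mathcal{P}(\mathcal{X})$) of $T_{X^n}$ for $X^n\sim P_X^{\otimes n}$, and $\nu_n$ is the law (a probability measure on $\mathcal{P}(\mathcal{Y})$) of $T_{Y^n}$ for $Y^n\sim P_Y^{\otimes n}$. *)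

theory Defs
  imports "HOL-Probability.Probability"
begin

text \<open>
  A Polish space is a type of class \<open>polish_space\<close>, and \<open>P(Z)\<close> is the set
  \<open>space (prob_algebra borel)\<close> of all probability measures on its Borel sets.
\<close>

abbreviation prob_measures :: "'a::topological_space measure set" where
  "prob_measures \<equiv> space (prob_algebra borel)"

text \<open>
  The coarsest topology on \<open>P(Z)\<close> that makes \<open>Q \<mapsto> \<integral> f dQ\<close> continuous
  for every bounded continuous \<open>f\<close>. The generating family contains the whole of
  \<open>P(Z)\<close> (take \<open>U = UNIV\<close>), which is therefore the carrier of this topology.
\<close>

definition weak_topology :: "'a::topological_space measure topology" where
  "weak_topology = topology_generated_by
     {{Q \<in> prob_measures. integral\<^sup>L Q f \<in> U} | (f :: 'a \<Rightarrow> real) U.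
        continuous_on UNIV f \<and> bounded (range f) \<and> open U}"

definition borel_of :: "'a topology \<Rightarrow> 'a measure" where
  "borel_of T = sigma (topspace T) {U. openin T U}"

definition lower_semicontinuous :: "('a::topological_space \<Rightarrow> ennreal) \<Rightarrow> bool" where
  "lower_semicontinuous f \<longleftrightarrow> (\<forall>x. f x \<le> Liminf (at x) f)"

definition couplings :: "'a measure \<Rightarrow> 'b measure \<Rightarrow> ('a \<times> 'b) measure set" where
  "couplings M N = {R. sets R = sets (M \<Otimes>\<^sub>M N) \<and> prob_space R \<and>
     distr R M fst = M \<and> distr R N snd = N}"

text \<open>
  The minima of the optimal transport cost and of the excess-cost probability are written
  as infima; that they are attained is a separate claim.
\<close>

definition transport_cost ::
  "('a \<times> 'b \<Rightarrow> ennreal) \<Rightarrow> 'a measure \<Rightarrow> 'b measure \<Rightarrow> ennreal" where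
  "transport_cost c QX QY = (INF R\<in>couplings QX QY. \<integral>\<^sup>+ z. c z \<partial>R)"

text \<open>
  Points of \<open>X\<^sup>n\<close> are functions on \<open>nat\<close> of which only the values at indices
  below \<open>n\<close> are used; \<open>P\<^sup>n\<close> lives on the functions extensional on \<open>{..<n}\<close>.
\<close>

definition cost_n :: "nat \<Rightarrow> ('a \<times> 'b \<Rightarrow> ennreal) \<Rightarrow> (nat \<Rightarrow> 'a) \<Rightarrow> (nat \<Rightarrow> 'b) \<Rightarrow> ennreal" where
  "cost_n n c x y = (\<Sum>i<n. c (x i, y i)) / of_nat n"

abbreviation prod_n :: "nat \<Rightarrow> 'a measure \<Rightarrow> (nat \<Rightarrow> 'a) measure" where
  "prod_n n P \<equiv> Pi\<^sub>M {..<n} (\<lambda>_. P)"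

definition excess_prob ::
  "nat \<Rightarrow> ('a \<times> 'b \<Rightarrow> ennreal) \<Rightarrow> real \<Rightarrow> ((nat \<Rightarrow> 'a) \<times> (nat \<Rightarrow> 'b)) measure \<Rightarrow> real" where
  "excess_prob n c \<alpha> R = measure R {(x, y) \<in> space R. cost_n n c x y > ennreal \<alpha>}"

definition optimal_excess_prob ::
  "nat \<Rightarrow> ('a \<times> 'b \<Rightarrow> ennreal) \<Rightarrow> real \<Rightarrow> 'a measure \<Rightarrow> 'b measure \<Rightarrow> real" where
  "optimal_excess_prob n c \<alpha> PX PY =
     (INF R\<in>couplings (prod_n n PX) (prod_n n PY). excess_prob n c \<alpha> R)"

definition empirical_measure :: "nat \<Rightarrow> (nat \<Rightarrow> 'a::topological_space) \<Rightarrow> 'a measure" where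
  "empirical_measure n x =
     measure_of UNIV (sets borel) (\<lambda>A. (\<Sum>i<n. emeasure (return borel (x i)) A) / of_nat n)"

definition empirical_law :: "nat \<Rightarrow> 'a::topological_space measure \<Rightarrow> 'a measure measure" where
  "empirical_law n P = distr (prod_n n P) (borel_of weak_topology) (empirical_measure n)"

definition transport_excess_prob ::
  "('a \<times> 'b \<Rightarrow> ennreal) \<Rightarrow> real \<Rightarrow> ('a measure \<times> 'b measure) measure \<Rightarrow> real" where
  "transport_excess_prob c \<alpha> \<pi> =
     measure \<pi> {(QX, QY) \<in> space \<pi>. transport_cost c QX QY > ennreal \<alpha>}"

definition transport_nbhd ::
  "('a \<times> 'b::topological_space \<Rightarrow> ennreal) \<Rightarrow> real \<Rightarrow> 'a measure set \<Rightarrow> 'b measure set" where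
  "transport_nbhd c \<alpha> A =
     (\<Union>QX\<in>A. {QY \<in> prob_measures. transport_cost c QX QY \<le> ennreal \<alpha>})"

end

theory Submission
  imports Defs
begin

text \<open>
  Compactness of the set of couplings is replaced by a Hahn-Banach argument. A linear functional on
  all bounded functions on \<open>X \<times> Y\<close> that is dominated by the dual functional defines a finitely
  additive coupling; since its marginals are Radon, it is countably additive on the algebra of
  rectangles. This gives Kantorovich duality together with an optimal coupling. With Lipschitz
  approximations of the cost the potentials can be chosen continuous, so \<open>transport_cost\<close> is lower
  semicontinuous for the weak topology.

  For the excess probability apply this duality to the indicator of \<open>cost_n > \<alpha>\<close> on
  \<open>X\<^sup>n \<times> Y\<^sup>n\<close>. Averaging the potentials over permutations of the coordinates replaces \<open>cost_n x y\<close> by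
  its minimum over all matchings, which by Birkhoff's theorem is the transport cost between the
  empirical measures. Level sets of the averaged potentials contain compact sets whose images
  under the empirical measure are separated by cost \<open>> \<alpha>\<close>. Conversely, pushing a coupling forward
  along the empirical measures does not increase the excess probability, and every coupling of the
  empirical laws charges a separated pair \<open>A \<times> B\<close> with at least \<open>\<mu>\<^sub>n A + \<nu>\<^sub>n B - 1\<close>.
\<close>

section \<open>A Hahn-Banach theorem for spaces of real functions\<close>

text \<open>A functional on bounded functions cannot be evaluated at \<open>c\<close>, which may be
  unbounded or infinite. Duality is therefore proved for an increasing sequence of bounded costs at
  once: a single coupling respects the bound for every member, and monotone convergence passes to
  the limit. A coupling built from a finitely additive charge \<open>\<mu>\<close> is compared with
  it by \<open>measure R U \<le> \<mu> U\<close> for open \<open>U\<close>. This is where lower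
  semicontinuity enters: integrals are compared through superlevel sets, which are then open. The
  strict inequality in \<open>cost_n > \<alpha>\<close> matters for the same reason. Compact sets
  are chosen among samples, before empirical measures are taken. Their images are compact, hence
  closed and measurable, whereas the image of a general Borel set need not be an event.\<close>

definition sublinear_on :: "('z \<Rightarrow> real) set \<Rightarrow> (('z \<Rightarrow> real) \<Rightarrow> real) \<Rightarrow> bool" where
  "sublinear_on V q \<longleftrightarrow>
     (\<forall>f\<in>V. \<forall>g\<in>V. q (\<lambda>z. f z + g z) \<le> q f + q g) \<and>
     (\<forall>f\<in>V. \<forall>a\<ge>0. q (\<lambda>z. a * f z) = a * q f)"

lemma sublinear_on_add:
  "sublinear_on V q \<Longrightarrow> f \<in> V \<Longrightarrow> g \<in> V \<Longrightarrow> q (\<lambda>z. f z + g z) \<le> q f + q g"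
  unfolding sublinear_on_def by simp

lemma sublinear_on_scale:
  "sublinear_on V q \<Longrightarrow> f \<in> V \<Longrightarrow> 0 \<le> a \<Longrightarrow> q (\<lambda>z. a * f z) = a * q f"
  unfolding sublinear_on_def by simp

text \<open>Follows from \<open>q 0 = 0\<close> and subadditivity at \<open>f + (- f)\<close>. For
  functionals dominated by \<open>p\<close> it leads to the common lower bound
  \<open>- p (- f)\<close>, which keeps infima over chains finite.\<close>

lemma sublinear_on_lower_bound:
  assumes V: "\<And>f a. f \<in> V \<Longrightarrow> (\<lambda>z. a * f z) \<in> V"
    and q: "sublinear_on V q" and f: "f \<in> V"
  shows "- q (\<lambda>z. - f z) \<le> q f"
proof -
  have m: "(\<lambda>z. - f z) \<in> V" using V[OF f, of "-1"] by simp
  have "q (\<lambda>z. 0 * f z) = 0 * q f" by (intro sublinear_on_scale[OF q f]) simp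
  moreover have "q (\<lambda>z. f z + - f z) \<le> q f + q (\<lambda>z. - f z)"
    by (intro sublinear_on_add[OF q f m])
  ultimately show ?thesis by simp
qed

text \<open>The common shape of the three infima formed below: over translates along a function,
  over a chain of functionals, and over dual majorants. Scaling is asked for as an inequality with a
  positive factor; applying it to \<open>a\<close> and to \<open>1 / a\<close> gives equality, and
  \<open>zero\<close> takes care of the factor 0.\<close>

lemma sublinear_on_Inf:
  assumes scale_V: "\<And>f a. f \<in> V \<Longrightarrow> (\<lambda>z. a * f z) \<in> V"
    and nonempty: "\<And>f. f \<in> V \<Longrightarrow> W f \<noteq> {}"
    and bdd: "\<And>f. f \<in> V \<Longrightarrow> bdd_below (W f)"
    and add_V: "\<And>f g. f \<in> V \<Longrightarrow> g \<in> V \<Longrightarrow> (\<lambda>z. f z + g z) \<in> V"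
    and add: "\<And>f g a b. f \<in> V \<Longrightarrow> g \<in> V \<Longrightarrow> a \<in> W f \<Longrightarrow> b \<in> W g \<Longrightarrow> \<exists>c\<in>W (\<lambda>z. f z + g z). c \<le> a + b"
    and scale: "\<And>f a w. f \<in> V \<Longrightarrow> 0 < a \<Longrightarrow> w \<in> W f \<Longrightarrow> \<exists>c\<in>W (\<lambda>z. a * f z). c \<le> a * w"
    and zero: "Inf (W (\<lambda>z. 0)) = 0"
  shows "sublinear_on V (\<lambda>f. Inf (W f) :: real)"
  unfolding sublinear_on_def
proof (intro conjI ballI allI impI)
  fix f g assume f: "f \<in> V" and g: "g \<in> V"
  let ?s = "Inf (W (\<lambda>z. f z + g z))"
  have *: "?s \<le> a + b" if "a \<in> W f" "b \<in> W g" for a b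
    using add[OF f g that] cInf_lower[OF _ bdd[OF add_V[OF f g]]] by force
  have "?s - a \<le> Inf (W g)" if "a \<in> W f" for a
    using *[OF that] by (intro cInf_greatest nonempty g) (simp add: algebra_simps)
  then have "?s - Inf (W g) \<le> Inf (W f)"
    by (intro cInf_greatest nonempty f) (simp add: algebra_simps)
  then show "?s \<le> Inf (W f) + Inf (W g)" by simp
next
  fix f and a :: real assume f: "f \<in> V" and a: "0 \<le> a"
  show "Inf (W (\<lambda>z. a * f z)) = a * Inf (W f)"
  proof (cases "a = 0")
    case False
    then have a: "0 < a" using a by simp
    have half: "Inf (W (\<lambda>z. b * u z)) \<le> b * Inf (W u)" if u: "u \<in> V" and b: "0 < b" for u and b :: real
    proof -
      have "Inf (W (\<lambda>z. b * u z)) / b \<le> w" if "w \<in> W u" for w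
        using scale[OF u b that] cInf_lower[OF _ bdd[OF scale_V[OF u]]] b
        by (force simp: field_simps)
      then have "Inf (W (\<lambda>z. b * u z)) / b \<le> Inf (W u)" by (intro cInf_greatest nonempty u)
      then show ?thesis using b by (simp add: field_simps)
    qed
    have "(\<lambda>z. inverse a * (a * f z)) = f" using a by auto
    then have "Inf (W f) \<le> inverse a * Inf (W (\<lambda>z. a * f z))"
      using half[OF scale_V[OF f, of a], of "inverse a"] a by simp
    then show ?thesis using half[OF f a] a by (simp add: field_simps)
  qed (simp add: zero)
qed

text \<open>The infimum \<open>r u\<close> of \<open>q (u + t g) - t q g\<close> over
  \<open>t \<ge> 0\<close> is again sublinear and lies below \<open>q\<close>, so minimality gives
  \<open>r = q\<close>. The choice \<open>t = 1\<close> then yields the missing inequality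
  \<open>q f + q g \<le> q (f + g)\<close>.\<close>

lemma minimal_sublinear_additive:
  assumes add: "\<And>f g. f \<in> V \<Longrightarrow> g \<in> V \<Longrightarrow> (\<lambda>z. f z + g z) \<in> V"
    and scale: "\<And>f a. f \<in> V \<Longrightarrow> (\<lambda>z. a * f z) \<in> V"
    and q: "sublinear_on V q"
    and minimal: "\<And>r. sublinear_on V r \<Longrightarrow> (\<And>f. f \<in> V \<Longrightarrow> r f \<le> q f) \<Longrightarrow> (\<And>f. f \<in> V \<Longrightarrow> r f = q f)"
    and f: "f \<in> V" and g: "g \<in> V"
  shows "q (\<lambda>z. f z + g z) = q f + q g"
proof -
  have sub: "q (\<lambda>z. u z + v z) \<le> q u + q v" if "u \<in> V" "v \<in> V" for u v
    by (intro sublinear_on_add[OF q that])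
  have hom: "q (\<lambda>z. a * u z) = a * q u" if "u \<in> V" "0 \<le> a" for u a
    by (intro sublinear_on_scale[OF q that])
  define S where "S u = (\<lambda>t. q (\<lambda>z. u z + t * g z) - t * q g) ` {0..}" for u
  define r where "r u = Inf (S u)" for u
  have in_S: "q (\<lambda>z. u z + t * g z) - t * q g \<in> S u" if "0 \<le> t" for u t
    using that unfolding S_def by auto
  have lower: "- q (\<lambda>z. - u z) \<le> s" if "u \<in> V" and s: "s \<in> S u" for u s
  proof -
    obtain t where t: "0 \<le> t" "s = q (\<lambda>z. u z + t * g z) - t * q g" using s unfolding S_def by auto
    have m: "(\<lambda>z. - u z) \<in> V" using scale[OF that(1), of "-1"] by simp
    have "q (\<lambda>z. t * g z) = q (\<lambda>z. (u z + t * g z) + - u z)" by (simp add: algebra_simps)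
    also have "\<dots> \<le> q (\<lambda>z. u z + t * g z) + q (\<lambda>z. - u z)"
      by (intro sub add m that scale g)
    finally show ?thesis using hom[OF g t(1)] t(2) by simp
  qed
  have bdd: "bdd_below (S u)" if "u \<in> V" for u using lower[OF that] by (meson bdd_belowI)
  have ne: "S u \<noteq> {}" for u using in_S[of 0] by blast
  have r_le: "r u \<le> q (\<lambda>z. u z + t * g z) - t * q g" if "u \<in> V" "0 \<le> t" for u t
    unfolding r_def by (intro cInf_lower in_S bdd that)
  have "sublinear_on V (\<lambda>u. Inf (S u))"
  proof (rule sublinear_on_Inf)
    fix u v a b assume u: "u \<in> V" and v: "v \<in> V" and "a \<in> S u" and "b \<in> S v"
    obtain s where s: "0 \<le> s" "a = q (\<lambda>z. u z + s * g z) - s * q g"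
      using \<open>a \<in> S u\<close> unfolding S_def by auto
    obtain t where t: "0 \<le> t" "b = q (\<lambda>z. v z + t * g z) - t * q g"
      using \<open>b \<in> S v\<close> unfolding S_def by auto
    have "q (\<lambda>z. (u z + v z) + (s + t) * g z) = q (\<lambda>z. (u z + s * g z) + (v z + t * g z))"
      by (simp add: algebra_simps)
    also have "\<dots> \<le> q (\<lambda>z. u z + s * g z) + q (\<lambda>z. v z + t * g z)"
      by (intro sub add u v scale g)
    finally show "\<exists>c\<in>S (\<lambda>z. u z + v z). c \<le> a + b"
      using s t by (intro bexI[OF _ in_S[of "s + t"]]) (simp_all add: algebra_simps)
  next
    fix u s and b :: real assume u: "u \<in> V" and b: "0 < b" and s: "s \<in> S u"
    obtain t where t: "0 \<le> t" "s = q (\<lambda>z. u z + t * g z) - t * q g" using s unfolding S_def by auto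
    have "q (\<lambda>z. b * u z + (b * t) * g z) = q (\<lambda>z. b * (u z + t * g z))" by (simp add: algebra_simps)
    also have "\<dots> = b * q (\<lambda>z. u z + t * g z)" using b by (intro hom add u scale g) simp
    finally show "\<exists>c\<in>S (\<lambda>z. b * u z). c \<le> b * s"
      unfolding t(2) using t(1) b by (intro bexI[OF _ in_S[of "b * t"]]) (simp_all add: algebra_simps)
  next
    have "s = 0" if "s \<in> S (\<lambda>z. 0)" for s
      using that hom[OF g] unfolding S_def by auto
    then have "S (\<lambda>z. 0) = {0}" using ne by blast
    then show "Inf (S (\<lambda>z. 0)) = 0" by simp
  qed (simp_all add: add scale bdd ne)
  then have "sublinear_on V r" unfolding r_def .
  moreover have "r u \<le> q u" if "u \<in> V" for u using r_le[OF that, of 0] by simp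
  ultimately have "r f = q f" by (rule minimal[OF _ _ f])
  then have "q f \<le> q (\<lambda>z. f z + g z) - q g" using r_le[OF f, of 1] by simp
  then show ?thesis using sub[OF f g] by simp
qed

text \<open>Zorn's lemma gives a minimal sublinear functional below \<open>p\<close>, and minimal
  ones are additive. No functional on a subspace is extended: whatever \<open>L\<close> has to
  satisfy is encoded in \<open>p\<close> and recovered by testing \<open>f\<close> and
  \<open>- f\<close>.\<close>

lemma hahn_banach:
  assumes add: "\<And>f g. f \<in> V \<Longrightarrow> g \<in> V \<Longrightarrow> (\<lambda>z. f z + g z) \<in> V"
    and scale: "\<And>f a. f \<in> V \<Longrightarrow> (\<lambda>z. a * f z) \<in> V"
    and p: "sublinear_on V p"
  obtains L where "\<And>f. f \<in> V \<Longrightarrow> L f \<le> p f"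
    "\<And>f g. f \<in> V \<Longrightarrow> g \<in> V \<Longrightarrow> L (\<lambda>z. f z + g z) = L f + L g"
    "\<And>f a. f \<in> V \<Longrightarrow> 0 \<le> a \<Longrightarrow> L (\<lambda>z. a * f z) = a * L f"
proof -
  \<comment> \<open>Fixing the value 0 off \<open>V\<close> keeps chains bounded below there, so
    pointwise comparison of all functions can serve as the order. That order is reversed in
    \<open>below\<close>, so that a maximal element in the sense of Zorn is a minimal
    functional.\<close>
  define A where "A = {q. sublinear_on V q \<and> (\<forall>f\<in>V. q f \<le> p f) \<and> (\<forall>f. f \<notin> V \<longrightarrow> q f = 0)}"
  define below where "below q r \<longleftrightarrow> (\<forall>f. r f \<le> q f)" for q r :: "('a \<Rightarrow> real) \<Rightarrow> real"
  have below_A: "- p (\<lambda>z. - f z) \<le> q f" if "q \<in> A" "f \<in> V" for q f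
  proof -
    have "(\<lambda>z. - f z) \<in> V" using scale[OF that(2), of "-1"] by simp
    then have "q (\<lambda>z. - f z) \<le> p (\<lambda>z. - f z)" using that unfolding A_def by blast
    moreover have "- q (\<lambda>z. - f z) \<le> q f"
      using that sublinear_on_lower_bound[of V q f] scale unfolding A_def by blast
    ultimately show ?thesis by simp
  qed
  have "\<exists>m\<in>A. \<forall>a\<in>A. below m a \<longrightarrow> a = m"
  proof (rule predicate_Zorn)
    show "partial_order_on A (relation_of below A)"
      by (rule partial_order_on_relation_ofI) (auto simp: below_def fun_eq_iff intro: order_trans antisym)
  next
    fix C assume C: "C \<in> Chains (relation_of below A)"
    show "\<exists>u\<in>A. \<forall>a\<in>C. below a u"
    proof (cases "C = {}")
      case True
      have "(\<lambda>f. if f \<in> V then p f else 0) \<in> A"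
        using p add scale unfolding A_def sublinear_on_def by auto
      then show ?thesis using True by blast
    next
      case False
      have CA: "C \<subseteq> A" using C unfolding Chains_def relation_of_def by blast
      have chain: "below a b \<or> below b a" if "a \<in> C" "b \<in> C" for a b
        using C that unfolding Chains_def relation_of_def by blast
      define u where "u f = (if f \<in> V then INF q\<in>C. q f else 0)" for f
      have bdd: "bdd_below ((\<lambda>q. q f) ` C)" if "f \<in> V" for f
        using below_A that CA by (intro bdd_belowI2[where m = "- p (\<lambda>z. - f z)"]) blast
      have u_le: "u f \<le> q f" if "q \<in> C" "f \<in> V" for q f
        unfolding u_def using that bdd by (auto intro: cINF_lower)
      have hom: "q (\<lambda>z. a * f z) = a * q f" if "q \<in> C" "f \<in> V" "0 \<le> a" for q f a
        using that CA sublinear_on_scale[of V q f a] unfolding A_def by blast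
      have "sublinear_on V (\<lambda>f. INF q\<in>C. q f)"
      proof (rule sublinear_on_Inf)
        fix f g a b assume f: "f \<in> V" and g: "g \<in> V" and "a \<in> (\<lambda>q. q f) ` C" "b \<in> (\<lambda>q. q g) ` C"
        then obtain q r where q: "q \<in> C" "a = q f" and r: "r \<in> C" "b = r g" by blast
        obtain s where s: "s \<in> C" "below q s" "below r s"
          using chain[OF q(1) r(1)] q r unfolding below_def by blast
        have "s (\<lambda>z. f z + g z) \<le> s f + s g" using s CA f g sublinear_on_add[of V s f g] unfolding A_def by blast
        also have "\<dots> \<le> a + b" using s q r unfolding below_def by (intro add_mono) auto
        finally show "\<exists>c\<in>(\<lambda>q. q (\<lambda>z. f z + g z)) ` C. c \<le> a + b" using s(1) by blast
      next
        fix f w and a :: real assume "f \<in> V" "0 < a" "w \<in> (\<lambda>q. q f) ` C"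
        then show "\<exists>c\<in>(\<lambda>q. q (\<lambda>z. a * f z)) ` C. c \<le> a * w" using hom by fastforce
      next
        have "q (\<lambda>z. 0) = 0" if q: "q \<in> C" for q
        proof (cases "\<exists>f. f \<in> V")
          case True
          then show ?thesis using hom[OF q, of _ 0] by auto
        next
          case False
          then show ?thesis using q CA unfolding A_def by blast
        qed
        then have "(INF q\<in>C. q (\<lambda>z. 0)) = (INF q\<in>C. 0)" by (intro INF_cong) simp_all
        then show "(INF q\<in>C. q (\<lambda>z. 0)) = 0" using False by simp
      qed (use False in \<open>simp_all add: add scale bdd\<close>)
      then have "sublinear_on V u" using add scale unfolding sublinear_on_def u_def by simp
      moreover have "u f \<le> p f" if "f \<in> V" for f
      proof -
        obtain q where "q \<in> C" using False by blast
        then show ?thesis using u_le[of q f] that CA unfolding A_def by fastforce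
      qed
      ultimately have "u \<in> A" unfolding A_def u_def by simp
      moreover have "below a u" if "a \<in> C" for a
        using u_le[OF that] that CA unfolding below_def A_def u_def by fastforce
      ultimately show ?thesis by blast
    qed
  qed
  then obtain L where L: "L \<in> A" and min: "\<And>a. a \<in> A \<Longrightarrow> below L a \<Longrightarrow> a = L" by blast
  have sub: "sublinear_on V L" and le: "\<And>f. f \<in> V \<Longrightarrow> L f \<le> p f" using L unfolding A_def by auto
  have minimal: "r f = L f" if r: "sublinear_on V r" "\<And>f. f \<in> V \<Longrightarrow> r f \<le> L f" and f: "f \<in> V" for r f
  proof -
    define r' where "r' f = (if f \<in> V then r f else 0)" for f
    have "sublinear_on V r'" using r(1) add scale unfolding r'_def sublinear_on_def by simp
    then have "r' \<in> A" using r(2) le unfolding A_def r'_def by (auto intro: order_trans)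
    moreover have "below L r'" using r(2) L unfolding below_def r'_def A_def by auto
    ultimately have "r' = L" by (rule min)
    then show ?thesis using f unfolding r'_def by auto
  qed
  show thesis
  proof (rule that[of L])
    show "L (\<lambda>z. f z + g z) = L f + L g" if "f \<in> V" "g \<in> V" for f g
      by (rule minimal_sublinear_additive[where V = V]) (fact add scale sub minimal that)+
    show "L (\<lambda>z. a * f z) = a * L f" if "f \<in> V" "0 \<le> a" for f a
      by (intro sublinear_on_scale[OF sub that])
  qed (use le in auto)
qed

section \<open>Couplings from finitely additive charges\<close>

lemma prob_measuresD:
  assumes "P \<in> prob_measures"
  shows "prob_space P" "sets P = sets borel" "space P = UNIV"
  using assms sets_eq_imp_space_eq[of P borel] by (auto simp: space_prob_algebra)

lemma sets_pair_borel:
  fixes P :: "'a::second_countable_topology measure" and Q :: "'b::second_countable_topology measure"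
  assumes "sets P = sets borel" "sets Q = sets borel"
  shows "sets (P \<Otimes>\<^sub>M Q) = sets borel"
  by (subst sets_pair_measure_cong[OF assms]) (rule arg_cong[OF borel_prod])

lemma couplingsD:
  assumes "R \<in> couplings M N"
  shows "prob_space R" "sets R = sets (M \<Otimes>\<^sub>M N)" "distr R M fst = M" "distr R N snd = N"
    "fst \<in> measurable R M" "snd \<in> measurable R N"
proof -
  show s: "sets R = sets (M \<Otimes>\<^sub>M N)" using assms unfolding couplings_def by simp
  show "fst \<in> measurable R M" "snd \<in> measurable R N"
    unfolding measurable_cong_sets[OF s refl] by measurable
qed (use assms in \<open>auto simp: couplings_def\<close>)

lemma coupling_marginals:
  assumes R: "R \<in> couplings M N"
  shows "A \<in> sets M \<Longrightarrow> measure R (fst -` A \<inter> space R) = measure M A"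
    and "B \<in> sets N \<Longrightarrow> measure R (snd -` B \<inter> space R) = measure N B"
  using measure_distr[OF couplingsD(5)[OF R], of A] measure_distr[OF couplingsD(6)[OF R], of B] couplingsD(3,4)[OF R]
  by simp_all

lemma distr_coupling:
  assumes R: "R \<in> couplings M N" and f: "f \<in> measurable M M'" and g: "g \<in> measurable N N'"
  shows "(\<lambda>z. (f (fst z), g (snd z))) \<in> measurable R (M' \<Otimes>\<^sub>M N')"
    and "distr R (M' \<Otimes>\<^sub>M N') (\<lambda>z. (f (fst z), g (snd z))) \<in> couplings (distr M M' f) (distr N N' g)"
proof -
  note R' = couplingsD[OF R]
  let ?r = "\<lambda>z. (f (fst z), g (snd z))"
  show r: "?r \<in> measurable R (M' \<Otimes>\<^sub>M N')"
    by (intro measurable_Pair measurable_compose[OF R'(5) f] measurable_compose[OF R'(6) g])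
  let ?R = "distr R (M' \<Otimes>\<^sub>M N') ?r"
  have "distr ?R M' fst = distr (distr R M fst) M' f"
    by (subst distr_distr[OF measurable_fst r], subst distr_distr[OF f R'(5)]) (simp add: comp_def)
  moreover have "distr ?R N' snd = distr (distr R N snd) N' g"
    by (subst distr_distr[OF measurable_snd r], subst distr_distr[OF g R'(6)]) (simp add: comp_def)
  moreover have "distr ?R (distr M M' f) fst = distr ?R M' fst" "distr ?R (distr N N' g) snd = distr ?R N' snd"
    by (intro distr_cong refl; simp)+
  ultimately show "?R \<in> couplings (distr M M' f) (distr N N' g)"
    unfolding couplings_def using prob_space.prob_space_distr[OF R'(1) r] R'(3,4)
    by (simp cong: sets_pair_measure_cong)
qed

lemma prob_measure_inner_compact:
  fixes P :: "'a::polish_space measure"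
  assumes P: "P \<in> prob_measures" and A: "A \<in> sets borel" and e: "0 < e"
  obtains K where "compact K" "K \<subseteq> A" "measure P (A - K) < e"
proof -
  interpret prob_space P using P by (rule prob_measuresD)
  have sP: "sets P = sets borel" using P by (rule prob_measuresD)
  have "\<exists>K. K \<subseteq> A \<and> compact K \<and> measure P A - e < measure P K"
  proof (rule ccontr)
    assume "\<not> ?thesis"
    then have le: "measure P K \<le> measure P A - e" if "K \<subseteq> A" "compact K" for K
      using that by force
    have "emeasure P A = (SUP K \<in> {K. K \<subseteq> A \<and> compact K}. emeasure P K)"
      by (rule inner_regular[OF sP _ A]) simp
    also have "\<dots> \<le> ennreal (measure P A - e)"
      by (rule SUP_least) (use le in \<open>auto simp: emeasure_eq_measure intro!: ennreal_leI\<close>)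
    finally have "measure P A \<le> max 0 (measure P A - e)"
      by (auto simp: emeasure_eq_measure ennreal_le_iff2)
    \<comment> \<open>\<open>ennreal\<close> truncates negative numbers to 0; the empty compact set
      shows that nothing is truncated here.\<close>
    moreover have "0 \<le> measure P A - e" using le[of "{}"] by simp
    ultimately show False using e by simp
  qed
  then obtain K where K: "K \<subseteq> A" "compact K" "measure P A - e < measure P K" by blast
  have "K \<in> sets P" using K(2) sP by (simp add: borel_compact)
  then have "measure P (A - K) = measure P A - measure P K"
    using A sP K(1) by (intro finite_measure_Diff) auto
  then show thesis using that[of K] K by auto
qed

text \<open>A charge on a product with Radon marginals is countably additive on the algebra of the sets
  that are, together with their complements, approximable from inside by compact sets
  (Marczewski and Ryll-Nardzewski).\<close>

lemma coupling_of_charge: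
  fixes P :: "'a::polish_space measure" and Q :: "'b::polish_space measure"
    and \<mu> :: "('a \<times> 'b) set \<Rightarrow> real"
  assumes P: "P \<in> prob_measures" and Q: "Q \<in> prob_measures"
    and nonneg: "\<And>S. 0 \<le> \<mu> S"
    and add: "\<And>S T. S \<inter> T = {} \<Longrightarrow> \<mu> (S \<union> T) = \<mu> S + \<mu> T"
    and fst_marginal: "\<And>A. A \<in> sets borel \<Longrightarrow> \<mu> (A \<times> UNIV) = measure P A"
    and snd_marginal: "\<And>B. B \<in> sets borel \<Longrightarrow> \<mu> (UNIV \<times> B) = measure Q B"
  obtains R where "R \<in> couplings P Q" "\<And>U. open U \<Longrightarrow> measure R U \<le> \<mu> U"
proof -
  note P' = prob_measuresD[OF P] and Q' = prob_measuresD[OF Q]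
  interpret P: prob_space P by (rule P')
  interpret Q: prob_space Q by (rule Q')
  have mono: "\<mu> S \<le> \<mu> T" if "S \<subseteq> T" for S T
  proof -
    have "\<mu> T = \<mu> S + \<mu> (T - S)" using add[of S "T - S"] that by (simp add: Un_absorb1)
    then show ?thesis using nonneg[of "T - S"] by simp
  qed
  have subadd: "\<mu> (S \<union> T) \<le> \<mu> S + \<mu> T" for S T
    using add[of S "T - S"] mono[of "T - S" T] by simp
  have empty: "\<mu> {} = 0" using add[of "{}" "{}"] by simp
  have subadd_fin: "\<mu> (\<Union>n\<in>I. S n) \<le> (\<Sum>n\<in>I. \<mu> (S n))" if "finite I" for S and I :: "nat set"
    using that
  proof (induction I)
    case (insert i I)
    then show ?case using subadd[of "S i" "\<Union>n\<in>I. S n"] by simp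
  qed (simp add: empty)
  define approx where "approx S \<longleftrightarrow> (\<forall>e>0. \<exists>K. compact K \<and> K \<subseteq> S \<and> \<mu> (S - K) < e)" for S
  have approxE: "\<exists>K. compact K \<and> K \<subseteq> S \<and> \<mu> (S - K) < e" if "approx S" "0 < e" for S e
    using that unfolding approx_def by blast
  have approx_Un: "approx (S \<union> T)" and approx_Int: "approx (S \<inter> T)" if S: "approx S" and T: "approx T" for S T
  proof -
    have "\<exists>K L. compact K \<and> K \<subseteq> S \<and> compact L \<and> L \<subseteq> T \<and> \<mu> ((S - K) \<union> (T - L)) < e" if "0 < e" for e :: real
    proof -
      obtain K where K: "compact K" "K \<subseteq> S" "\<mu> (S - K) < e / 2" using approxE[OF S, of "e / 2"] \<open>0 < e\<close> by auto
      obtain L where L: "compact L" "L \<subseteq> T" "\<mu> (T - L) < e / 2"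
        using approxE[OF T, of "e / 2"] \<open>0 < e\<close> by auto
      show ?thesis using K L subadd[of "S - K" "T - L"] by (intro exI[of _ K] exI[of _ L]) auto
    qed
    note * = this
    show "approx (S \<union> T)"
      unfolding approx_def
    proof (intro allI impI)
      fix e :: real assume "0 < e"
      from *[OF this] obtain K L
        where KL: "compact K" "K \<subseteq> S" "compact L" "L \<subseteq> T" "\<mu> ((S - K) \<union> (T - L)) < e"
        by blast
      have *: "\<mu> ((S \<union> T) - (K \<union> L)) \<le> \<mu> ((S - K) \<union> (T - L))" by (intro mono) blast
      show "\<exists>K. compact K \<and> K \<subseteq> S \<union> T \<and> \<mu> ((S \<union> T) - K) < e"
        by (intro exI[of _ "K \<union> L"] conjI compact_Un KL order.strict_trans1[OF * KL(5)]) (use KL in blast)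
    qed
    show "approx (S \<inter> T)"
      unfolding approx_def
    proof (intro allI impI)
      fix e :: real assume "0 < e"
      from *[OF this] obtain K L
        where KL: "compact K" "K \<subseteq> S" "compact L" "L \<subseteq> T" "\<mu> ((S - K) \<union> (T - L)) < e"
        by blast
      have *: "\<mu> ((S \<inter> T) - (K \<inter> L)) \<le> \<mu> ((S - K) \<union> (T - L))" by (intro mono) blast
      show "\<exists>K. compact K \<and> K \<subseteq> S \<inter> T \<and> \<mu> ((S \<inter> T) - K) < e"
        by (intro exI[of _ "K \<inter> L"] conjI compact_Int KL order.strict_trans1[OF * KL(5)]) (use KL in blast)
    qed
  qed
  have approx_rect: "approx (A \<times> B)" if A: "A \<in> sets borel" and B: "B \<in> sets borel" for A B
    unfolding approx_def
  proof (intro allI impI)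
    fix e :: real assume e: "0 < e"
    obtain K where K: "compact K" "K \<subseteq> A" "measure P (A - K) < e / 2"
      using prob_measure_inner_compact[OF P A, of "e / 2"] e by auto
    obtain L where L: "compact L" "L \<subseteq> B" "measure Q (B - L) < e / 2"
      using prob_measure_inner_compact[OF Q B, of "e / 2"] e by auto
    have "\<mu> (A \<times> B - K \<times> L) \<le> \<mu> ((A - K) \<times> UNIV \<union> UNIV \<times> (B - L))" by (intro mono) blast
    also have "\<dots> \<le> measure P (A - K) + measure Q (B - L)"
      using subadd[of "(A - K) \<times> UNIV" "UNIV \<times> (B - L)"]
        fst_marginal[OF sets.Diff[OF A borel_compact[OF K(1)]]]
        snd_marginal[OF sets.Diff[OF B borel_compact[OF L(1)]]] by simp
    finally show "\<exists>K. compact K \<and> K \<subseteq> A \<times> B \<and> \<mu> (A \<times> B - K) < e"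
      using K L by (intro exI[of _ "K \<times> L"]) (auto intro: compact_Times)
  qed
  define \<A> where "\<A> = {S. approx S \<and> approx (- S)}"
  have \<A>_Un: "S \<union> T \<in> \<A>" if "S \<in> \<A>" "T \<in> \<A>" for S T
    using that approx_Un approx_Int unfolding \<A>_def by simp
  have \<A>_Compl: "- S \<in> \<A>" if "S \<in> \<A>" for S using that unfolding \<A>_def by simp
  have \<A>_Int: "S \<inter> T \<in> \<A>" if "S \<in> \<A>" "T \<in> \<A>" for S T
    using that approx_Un approx_Int unfolding \<A>_def by simp
  have \<A>_fst: "A \<times> UNIV \<in> \<A>" if "A \<in> sets borel" for A
  proof -
    have "- (A \<times> UNIV) = (- A) \<times> UNIV" by auto
    then show ?thesis using approx_rect[of A UNIV] approx_rect[of "- A" UNIV] that unfolding \<A>_def by simp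
  qed
  have \<A>_snd: "UNIV \<times> B \<in> \<A>" if "B \<in> sets borel" for B
  proof -
    have "- (UNIV \<times> B) = UNIV \<times> (- B)" by auto
    then show ?thesis using approx_rect[of UNIV B] approx_rect[of UNIV "- B"] that unfolding \<A>_def by simp
  qed
  have \<A>_rect: "A \<times> B \<in> \<A>" if "A \<in> sets borel" "B \<in> sets borel" for A B
    using \<A>_Int[OF \<A>_fst[OF that(1)] \<A>_snd[OF that(2)]] by (simp add: Times_Int_Times)
  have \<A>_empty: "{} \<in> \<A>" using \<A>_fst[of "{}"] by simp
  interpret ring_of_sets UNIV \<A>
    unfolding ring_of_sets_iff using \<A>_empty \<A>_Un \<A>_Int \<A>_Compl by (auto simp: Diff_eq)
  have "\<exists>\<nu> :: ('a \<times> 'b) set \<Rightarrow> ennreal. (\<forall>S\<in>\<A>. \<nu> S = ennreal (\<mu> S)) \<and> measure_space UNIV (sigma_sets UNIV \<A>) \<nu>"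
  proof (rule caratheodory_empty_continuous)
    show "positive \<A> (\<lambda>S. ennreal (\<mu> S))" by (simp add: positive_def empty)
    show "additive \<A> (\<lambda>S. ennreal (\<mu> S))" by (simp add: additive_def add nonneg)
    show "ennreal (\<mu> S) \<noteq> \<infinity>" for S by simp
    fix A :: "nat \<Rightarrow> ('a \<times> 'b) set"
    assume A: "range A \<subseteq> \<A>" and dec: "decseq A" and emp: "(\<Inter>i. A i) = {}"
    have "(\<lambda>i. \<mu> (A i)) \<longlonglongrightarrow> 0"
    proof (rule LIMSEQ_I)
      fix e :: real assume e: "0 < e"
      \<comment> \<open>The weights sum to less than \<open>e\<close> over any finite set of
        indices; they bound what is lost when each \<open>A n\<close> is replaced by a compact
        subset.\<close>
      have "\<exists>K. compact K \<and> K \<subseteq> A n \<and> \<mu> (A n - K) < e * (1/2) ^ Suc n" for n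
        using A e by (intro approxE) (auto simp: \<A>_def)
      then obtain K where K: "\<And>n. compact (K n)" "\<And>n. K n \<subseteq> A n" "\<And>n. \<mu> (A n - K n) < e * (1/2) ^ Suc n"
        by metis
      \<comment> \<open>By the finite intersection property, finitely many \<open>K n\<close>
        already have empty intersection. Every late \<open>A m\<close> is then covered by the
        corresponding differences \<open>A n - K n\<close>.\<close>
      have "\<exists>I. finite I \<and> (\<Inter>n\<in>I. K n) = {}"
      proof (rule ccontr)
        assume none: "\<not> ?thesis"
        have "K 0 \<inter> (\<Inter>n\<in>UNIV. K n) \<noteq> {}"
        proof (rule compact_imp_fip_image)
          show "K 0 \<inter> (\<Inter>n\<in>I. K n) \<noteq> {}" if "finite I" for I
            using none that by (metis INT_insert finite_insert)
        qed (auto intro: K compact_imp_closed)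
        then obtain z where z: "\<And>n. z \<in> K n" by auto
        have "z \<in> (\<Inter>n. A n)" by (intro INT_I subsetD[OF K(2)] z)
        then show False using emp by simp
      qed
      then obtain I where I: "finite I" "(\<Inter>n\<in>I. K n) = {}" by blast
      define N where "N = Max (insert 0 I)"
      have le_N: "n \<le> N" if "n \<in> I" for n using I(1) that by (simp add: N_def)
      have small: "\<mu> (A m) < e" if m: "N \<le> m" for m
      proof -
        have "A m \<subseteq> (\<Union>n\<in>I. A n - K n)"
        proof
          fix z assume z: "z \<in> A m"
          obtain n where n: "n \<in> I" "z \<notin> K n" using I(2) by blast
          have "A m \<subseteq> A n" using dec le_N[OF n(1)] m by (auto simp: decseq_def)
          then show "z \<in> (\<Union>n\<in>I. A n - K n)" using z n by blast
        qed
        then have "\<mu> (A m) \<le> (\<Sum>n\<in>I. \<mu> (A n - K n))"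
          using mono subadd_fin[OF I(1), of "\<lambda>n. A n - K n"] by (meson order_trans)
        also have "\<dots> \<le> (\<Sum>n\<in>I. e * (1/2) ^ Suc n)" using K(3) by (intro sum_mono less_imp_le)
        also have "\<dots> \<le> (\<Sum>n<Suc N. e * (1/2) ^ Suc n)"
          using e le_N by (intro sum_mono2) (auto simp: less_Suc_eq_le)
        also have "\<dots> = e * (1 - (1/2) ^ Suc N)"
          using sum_gp_strict[of "1/2::real" "Suc N"] by (simp add: sum_distrib_left[symmetric] flip: sum_divide_distrib)
        also have "\<dots> < e" using e by simp
        finally show ?thesis .
      qed
      show "\<exists>no. \<forall>n\<ge>no. norm (\<mu> (A n) - 0) < e"
        using small nonneg by (intro exI[of _ N]) simp
    qed
    from tendsto_ennrealI[OF this] show "(\<lambda>i. ennreal (\<mu> (A i))) \<longlonglongrightarrow> 0" by simp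
  qed
  then obtain \<nu> :: "('a \<times> 'b) set \<Rightarrow> ennreal" where \<nu>: "\<And>S. S \<in> \<A> \<Longrightarrow> \<nu> S = ennreal (\<mu> S)"
    and ms: "measure_space UNIV (sigma_sets UNIV \<A>) \<nu>" by blast
  have "sets (borel :: ('a \<times> 'b) measure) = sigma_sets UNIV {a \<times> b | a b. a \<in> sets (borel :: 'a measure) \<and> b \<in> sets (borel :: 'b measure)}"
    by (simp add: sets_pair_measure flip: borel_prod)
  also have "\<dots> \<subseteq> sigma_sets UNIV \<A>"
    by (rule sigma_sets_mono) (use \<A>_rect in auto)
  finally have sub: "sets (borel :: ('a \<times> 'b) measure) \<subseteq> sigma_sets UNIV \<A>" .
  define R where "R = measure_of UNIV (sets (borel :: ('a \<times> 'b) measure)) \<nu>"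
  have sR: "sets R = sets borel" using sets.sigma_sets_eq[of "borel :: ('a \<times> 'b) measure"] by (simp add: R_def)
  have spR: "space R = UNIV" by (simp add: R_def)
  have eR: "emeasure R S = \<nu> S" if "S \<in> sets borel" for S
  proof (rule emeasure_measure_of[OF R_def])
    show "positive (sets R) \<nu>" "countably_additive (sets R) \<nu>"
      using ms sub unfolding measure_space_def positive_def countably_additive_def sR by blast+
  qed (use that sR in auto)
  have eR_\<A>: "emeasure R S = ennreal (\<mu> S)" if "S \<in> sets borel" "S \<in> \<A>" for S
    using eR[OF that(1)] \<nu>[OF that(2)] by simp
  have rect_borel: "A \<times> B \<in> sets borel" if "A \<in> sets borel" "B \<in> sets borel" for A :: "'a set" and B :: "'b set"
    using that by (simp flip: borel_prod)
  have R_fst: "emeasure R (A \<times> UNIV) = emeasure P A" if "A \<in> sets borel" for A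
    using eR_\<A>[OF rect_borel \<A>_fst] that by (simp add: fst_marginal P.emeasure_eq_measure)
  have R_snd: "emeasure R (UNIV \<times> B) = emeasure Q B" if "B \<in> sets borel" for B
    using eR_\<A>[OF rect_borel \<A>_snd] that by (simp add: snd_marginal Q.emeasure_eq_measure)
  interpret R: prob_space R
    using R_fst[of UNIV] P.emeasure_space_1 P' by (intro prob_spaceI) (simp add: spR)
  have fst_R: "fst \<in> measurable R P" and snd_R: "snd \<in> measurable R Q"
    unfolding measurable_cong_sets[OF sR P'(2)] measurable_cong_sets[OF sR Q'(2)]
    by (intro borel_measurable_continuous_onI continuous_intros)+
  have "distr R P fst = P"
  proof (rule measure_eqI)
    fix A assume "A \<in> sets (distr R P fst)"
    then have "A \<in> sets P" by simp
    moreover have "fst -` A = (A \<times> UNIV :: ('a \<times> 'b) set)" by auto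
    ultimately show "emeasure (distr R P fst) A = emeasure P A"
      using R_fst P' by (simp add: emeasure_distr[OF fst_R] spR)
  qed simp
  moreover have "distr R Q snd = Q"
  proof (rule measure_eqI)
    fix B assume "B \<in> sets (distr R Q snd)"
    then have "B \<in> sets Q" by simp
    moreover have "snd -` B = (UNIV \<times> B :: ('a \<times> 'b) set)" by auto
    ultimately show "emeasure (distr R Q snd) B = emeasure Q B"
      using R_snd Q' by (simp add: emeasure_distr[OF snd_R] spR)
  qed simp
  ultimately have "R \<in> couplings P Q"
    using R.prob_space_axioms sR sets_pair_borel[OF P'(2) Q'(2)] unfolding couplings_def by simp
  \<comment> \<open>An open set is an increasing union of finite unions of rectangles. On these
    \<open>R\<close> agrees with \<open>\<mu>\<close>, and monotonicity of \<open>\<mu>\<close>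
    bounds them by \<open>\<mu> U\<close>. The limit gives an inequality only, since
    \<open>\<mu>\<close> is merely finitely additive on \<open>U\<close>.\<close>
  moreover have "measure R U \<le> \<mu> U" if U: "open U" for U
  proof -
    obtain \<B>1 :: "'a set set" where B1: "countable \<B>1" "topological_basis \<B>1" using ex_countable_basis by blast
    obtain \<B>2 :: "'b set set" where B2: "countable \<B>2" "topological_basis \<B>2" using ex_countable_basis by blast
    define \<B> where "\<B> = (\<lambda>(A, B). A \<times> B) ` (\<B>1 \<times> \<B>2)"
    have "topological_basis \<B>" unfolding \<B>_def by (rule topological_basis_prod[OF B1(2) B2(2)])
    then obtain \<C> where C: "\<C> \<subseteq> \<B>" "\<Union>\<C> = U" using U by (metis topological_basis_def)
    have "countable \<C>" using C(1) B1(1) B2(1) unfolding \<B>_def by (meson countable_SIGMA countable_image countable_subset)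
    have \<B>_\<A>: "S \<in> \<A> \<and> open S" if "S \<in> \<B>" for S
      using that \<A>_rect topological_basis_open[OF B1(2)] topological_basis_open[OF B2(2)]
      unfolding \<B>_def by (auto intro!: open_Times)
    show ?thesis
    proof (cases "\<C> = {}")
      case True
      then show ?thesis using C nonneg[of U] by auto
    next
      case False
      define F where "F n = (\<Union>i\<le>n. from_nat_into \<C> i)" for n
      have F_\<A>: "F n \<in> \<A>" and F_open: "open (F n)" for n
        using \<B>_\<A> C(1) from_nat_into[OF False] unfolding F_def by auto
      have "(\<Union>n. F n) = (\<Union>i. from_nat_into \<C> i)" unfolding F_def by auto
      then have "(\<Union>n. F n) = \<Union>\<C>"
        using range_from_nat_into[OF False \<open>countable \<C>\<close>] by simp
      moreover have "range F \<subseteq> sets R" using F_open sR by auto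
      moreover have "incseq F" unfolding F_def incseq_def by force
      ultimately have "(\<lambda>n. measure R (F n)) \<longlonglongrightarrow> measure R U"
        using R.finite_Lim_measure_incseq[OF \<open>range F \<subseteq> sets R\<close>] C(2) by simp
      moreover have "measure R (F n) \<le> \<mu> U" for n
      proof -
        have "measure R (F n) = \<mu> (F n)"
          using eR_\<A>[of "F n"] F_\<A> F_open nonneg by (simp add: R.emeasure_eq_measure)
        also have "\<dots> \<le> \<mu> U" using \<open>(\<Union>n. F n) = \<Union>\<C>\<close> C by (intro mono) auto
        finally show ?thesis .
      qed
      ultimately show ?thesis by (meson LIMSEQ_le_const2)
    qed
  qed
  ultimately show thesis by (rule that)
qed

section \<open>Duality for bounded lower semicontinuous costs\<close>

definition bounded_borel :: "('a::topological_space \<Rightarrow> real) set" where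
  "bounded_borel = {f. f \<in> borel_measurable borel \<and> bounded (range f)}"

lemma bounded_borelD:
  assumes "f \<in> bounded_borel"
  shows "f \<in> borel_measurable borel" "\<exists>B\<ge>0. \<forall>x. \<bar>f x\<bar> \<le> B"
proof -
  show "f \<in> borel_measurable borel" using assms unfolding bounded_borel_def by simp
  obtain B where "\<forall>x. \<bar>f x\<bar> \<le> B" using assms unfolding bounded_borel_def bounded_iff by auto
  then show "\<exists>B\<ge>0. \<forall>x. \<bar>f x\<bar> \<le> B" by (meson abs_ge_zero order_trans)
qed

lemma bounded_borelI:
  "f \<in> borel_measurable borel \<Longrightarrow> (\<And>x. \<bar>f x\<bar> \<le> B) \<Longrightarrow> f \<in> bounded_borel"
  unfolding bounded_borel_def bounded_iff by auto

lemma bounded_borel_add: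
  "f \<in> bounded_borel \<Longrightarrow> g \<in> bounded_borel \<Longrightarrow> (\<lambda>x. f x + g x) \<in> bounded_borel"
  unfolding bounded_borel_def by (auto intro: bounded_plus_comp)

lemma bounded_borel_mult_left: "f \<in> bounded_borel \<Longrightarrow> (\<lambda>x. a * f x) \<in> bounded_borel"
  unfolding bounded_borel_def using bounded_scaleR_comp[of f UNIV a] by auto

lemma bounded_borel_const: "(\<lambda>x. a) \<in> bounded_borel"
  by (rule bounded_borelI[of _ "\<bar>a\<bar>"]) auto

lemma bounded_borel_uminus: "f \<in> bounded_borel \<Longrightarrow> (\<lambda>x. - f x) \<in> bounded_borel"
  using bounded_borel_mult_left[of f "- 1"] by simp

lemma bounded_borel_diff:
  "f \<in> bounded_borel \<Longrightarrow> g \<in> bounded_borel \<Longrightarrow> (\<lambda>x. f x - g x) \<in> bounded_borel"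
  using bounded_borel_add[of f "\<lambda>x. - g x"] bounded_borel_uminus[of g] by simp

lemma bounded_borel_indicator: "A \<in> sets borel \<Longrightarrow> indicat_real A \<in> bounded_borel"
  by (rule bounded_borelI[of _ 1]) (auto simp: indicator_def)

lemma integrable_bounded_borel:
  assumes P: "prob_space P" "sets P = sets borel" and f: "f \<in> bounded_borel"
  shows "integrable P f"
proof -
  interpret prob_space P by fact
  obtain B where "\<And>x. \<bar>f x\<bar> \<le> B" using f bounded_borelD(2) by metis
  moreover have "f \<in> borel_measurable P"
    using bounded_borelD(1)[OF f] measurable_cong_sets[OF P(2) refl] by blast
  ultimately show ?thesis by (intro integrable_const_bound[where B = B]) auto
qed

text \<open>The sum counts the levels \<open>i * B / N\<close> below \<open>v\<close>, which are the
  ceiling of \<open>v * N / B\<close> in number; the expression rounds \<open>v\<close> up to a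
  multiple of \<open>B / N\<close>.\<close>

lemma layer_sum_bounds:
  fixes v B :: real and N :: nat
  assumes v: "0 \<le> v" "v \<le> B" and N: "0 < N"
  shows "v \<le> B / N * (\<Sum>i<N. of_bool (i * B / N < v))"
    and "B / N * (\<Sum>i<N. of_bool (i * B / N < v)) \<le> v + B / N"
proof -
  have "v \<le> B / N * (\<Sum>i<N. of_bool (i * B / N < v)) \<and> B / N * (\<Sum>i<N. of_bool (i * B / N < v)) \<le> v + B / N"
  proof (cases "B = 0")
    case False
    then have B: "0 < B" using v by simp
    define w where "w = v * N / B"
    have w: "0 \<le> w" "w \<le> N" using v B N by (auto simp: w_def field_simps)
    have less: "real i * B / N < v \<longleftrightarrow> real i < w" for i using B N by (simp add: w_def field_simps)
    have "{i\<in>{..<N}. real i < w} = {..<nat \<lceil>w\<rceil>}"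
    proof (intro set_eqI)
      fix i
      have "real i < w \<longleftrightarrow> int i < \<lceil>w\<rceil>" by (simp add: less_ceiling_iff)
      then show "i \<in> {i\<in>{..<N}. real i < w} \<longleftrightarrow> i \<in> {..<nat \<lceil>w\<rceil>}" using w by auto
    qed
    then have "(\<Sum>i<N. of_bool (i * B / N < v)) = real (nat \<lceil>w\<rceil>)"
      by (simp add: less sum.If_cases of_bool_def Int_def)
    moreover have "B / N * w \<le> B / N * real (nat \<lceil>w\<rceil>)" "B / N * real (nat \<lceil>w\<rceil>) \<le> B / N * (w + 1)"
      using w B N by (intro mult_left_mono; simp; linarith)+
    moreover have "v = B / N * w" using B N by (simp add: w_def)
    ultimately show ?thesis by (simp add: distrib_left)
  qed (use v in simp)
  then show "v \<le> B / N * (\<Sum>i<N. of_bool (i * B / N < v))"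
    and "B / N * (\<Sum>i<N. of_bool (i * B / N < v)) \<le> v + B / N" by auto
qed

text \<open>A discretized layer-cake formula with error at most \<open>B / N\<close>. It reduces a
  comparison of integrals to finitely many superlevel sets, which suits both a bound known for open
  sets only and the later search for a single good level.\<close>

lemma integral_le_layer_sum:
  fixes N :: nat and B :: real
  assumes M: "prob_space M" and f: "f \<in> borel_measurable M" and bound: "\<And>x. 0 \<le> f x" "\<And>x. f x \<le> B" and N: "0 < N"
  shows "integral\<^sup>L M f \<le> B / N * (\<Sum>i<N. measure M {x\<in>space M. i * B / N < f x})"
    and "B / N * (\<Sum>i<N. measure M {x\<in>space M. i * B / N < f x}) \<le> integral\<^sup>L M f + B / N"
proof -
  interpret prob_space M by fact
  define g where "g x = B / N * (\<Sum>i<N. indicat_real {x\<in>space M. i * B / N < f x} x)" for x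
  have int: "integrable M f" using f bound by (intro integrable_const_bound[where B = B]) auto
  have [measurable]: "f \<in> borel_measurable M" by (rule f)
  have g_int: "integrable M g" unfolding g_def
    by (intro integrable_mult_right Bochner_Integration.integrable_sum integrable_real_indicator) (auto simp: less_top[symmetric])
  have g: "integral\<^sup>L M g = B / N * (\<Sum>i<N. measure M {x\<in>space M. i * B / N < f x})"
    unfolding g_def by (subst integral_mult_right_zero, subst Bochner_Integration.integral_sum)
      (auto simp: less_top[symmetric] Int_absorb1)
  have gx: "g x = B / N * (\<Sum>i<N. of_bool (i * B / N < f x))" if "x \<in> space M" for x
    using that unfolding g_def indicator_def by simp
  show "integral\<^sup>L M f \<le> B / N * (\<Sum>i<N. measure M {x\<in>space M. i * B / N < f x})"
    unfolding g[symmetric]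
    by (rule integral_mono[OF int g_int]) (simp only: gx layer_sum_bounds(1)[OF bound N])
  have "integral\<^sup>L M g \<le> (\<integral>x. f x + B / N \<partial>M)"
    using int by (intro integral_mono[OF g_int]) (simp, simp only: gx layer_sum_bounds(2)[OF bound N])
  then show "B / N * (\<Sum>i<N. measure M {x\<in>space M. i * B / N < f x}) \<le> integral\<^sup>L M f + B / N"
    using int by (simp add: g prob_space)
qed

text \<open>Hahn-Banach is applied to the functional that sends \<open>f\<close> to the infimum of
  \<open>\<integral>\<phi> dP + \<integral>\<psi> dQ + t D\<close> over all \<open>\<phi>, \<psi>, t \<ge> 0, k\<close> with
  \<open>f \<le> \<phi> \<oplus> \<psi> + t h\<^sub>k\<close>: a dominated linear functional has the marginals \<open>P\<close>, \<open>Q\<close> and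
  maps every \<open>h\<^sub>k\<close> below \<open>D\<close>.\<close>

lemma coupling_of_dual_bound:
  fixes P :: "'a::polish_space measure" and Q :: "'b::polish_space measure"
    and h :: "nat \<Rightarrow> 'a \<times> 'b \<Rightarrow> real"
  assumes P: "P \<in> prob_measures" and Q: "Q \<in> prob_measures"
    and h_nonneg: "\<And>k z. 0 \<le> h k z" and h_bounded: "\<And>k. \<exists>B. \<forall>z. h k z \<le> B"
    and h_mono: "\<And>k l z. k \<le> l \<Longrightarrow> h k z \<le> h l z"
    and h_lsc: "\<And>k t. open {z. t < h k z}"
    and dual: "\<And>k \<phi> \<psi>. \<phi> \<in> bounded_borel \<Longrightarrow> \<psi> \<in> bounded_borel \<Longrightarrow>
      (\<And>x y. \<phi> x + \<psi> y \<le> h k (x, y)) \<Longrightarrow> integral\<^sup>L P \<phi> + integral\<^sup>L Q \<psi> \<le> D"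
  obtains R where "R \<in> couplings P Q" "\<And>k. (\<integral>\<^sup>+ z. ennreal (h k z) \<partial>R) \<le> ennreal D"
proof -
  note P' = prob_measuresD[OF P] and Q' = prob_measuresD[OF Q]
  interpret P: prob_space P by (rule P')
  interpret Q: prob_space Q by (rule Q')
  note int_P = integrable_bounded_borel[OF P'(1,2)] and int_Q = integrable_bounded_borel[OF Q'(1,2)]
  define V where "V = {f :: 'a \<times> 'b \<Rightarrow> real. \<exists>B. \<forall>z. \<bar>f z\<bar> \<le> B}"
  have V_eq: "V = {f. bounded (range f)}" by (auto simp: V_def bounded_iff)
  have V_add: "(\<lambda>z. f z + g z) \<in> V" if "f \<in> V" "g \<in> V" for f g
    using that bounded_plus_comp[of f UNIV g] by (simp add: V_eq)
  have V_scale: "(\<lambda>z. a * f z) \<in> V" if "f \<in> V" for f a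
    using that bounded_scaleR_comp[of f UNIV a] by (simp add: V_eq)
  define dominates where "dominates f \<phi> \<psi> t k \<longleftrightarrow> \<phi> \<in> bounded_borel \<and> \<psi> \<in> bounded_borel \<and> 0 \<le> t \<and>
    (\<forall>x y. f (x, y) \<le> \<phi> x + \<psi> y + t * h k (x, y))" for f \<phi> \<psi> t k
  define W where "W f = {integral\<^sup>L P \<phi> + integral\<^sup>L Q \<psi> + t * D | \<phi> \<psi> t k. dominates f \<phi> \<psi> t k}" for f
  have W_I: "integral\<^sup>L P \<phi> + integral\<^sup>L Q \<psi> + t * D \<in> W f" if "dominates f \<phi> \<psi> t k" for f \<phi> \<psi> t k
    unfolding W_def using that by blast
  have W_E: "\<exists>\<phi> \<psi> t k. w = integral\<^sup>L P \<phi> + integral\<^sup>L Q \<psi> + t * D \<and> dominates f \<phi> \<psi> t k" if "w \<in> W f" for w f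
    using that unfolding W_def by blast
  have W_lower: "- m \<le> w" if w: "w \<in> W f" and m: "\<And>z. - m \<le> f z" for w f m
  proof -
    obtain \<phi> \<psi> t k where w: "w = integral\<^sup>L P \<phi> + integral\<^sup>L Q \<psi> + t * D" and d: "dominates f \<phi> \<psi> t k"
      using W_E[OF w] by blast
    have \<phi>: "\<phi> \<in> bounded_borel" and \<psi>: "\<psi> \<in> bounded_borel" and t: "0 \<le> t"
      and ge: "- m \<le> \<phi> x + \<psi> y + t * h k (x, y)" for x y
      using d m unfolding dominates_def by (blast intro: order_trans)+
    \<comment> \<open>Division by the coefficient of \<open>h k\<close> produces potentials of the
      form that \<open>dual\<close> accepts. The coefficient \<open>t\<close> may be 0, so a
      positive \<open>s \<ge> t\<close> replaces it, and \<open>s\<close> then decreases to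
      \<open>t\<close>.\<close>
    have *: "- integral\<^sup>L P \<phi> - integral\<^sup>L Q \<psi> - m \<le> s * D" if s: "t \<le> s" "0 < s" for s
    proof -
      have "integral\<^sup>L P (\<lambda>x. inverse s * (- \<phi> x + - m)) + integral\<^sup>L Q (\<lambda>y. inverse s * - \<psi> y) \<le> D"
      proof (rule dual)
        fix x y
        have "- \<phi> x + - m + - \<psi> y \<le> s * h k (x, y)"
          using ge[of x y] mult_right_mono[OF s(1) h_nonneg[of k "(x, y)"]] by simp
        then have "inverse s * (- \<phi> x + - m + - \<psi> y) \<le> h k (x, y)" using s by (simp add: field_simps)
        then show "inverse s * (- \<phi> x + - m) + inverse s * - \<psi> y \<le> h k (x, y)"
          by (simp add: algebra_simps)
      qed (intro bounded_borel_mult_left bounded_borel_add bounded_borel_uminus bounded_borel_const \<phi> \<psi>)+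
      moreover have "integral\<^sup>L P (\<lambda>x. - \<phi> x + - m) = - integral\<^sup>L P \<phi> - m"
        using int_P[OF \<phi>] by (simp add: P.prob_space)
      ultimately have "inverse s * (- integral\<^sup>L P \<phi> - m) + inverse s * - integral\<^sup>L Q \<psi> \<le> D" by simp
      then have "inverse s * (- integral\<^sup>L P \<phi> - integral\<^sup>L Q \<psi> - m) \<le> D" by (simp add: algebra_simps)
      then show ?thesis using s by (simp add: inverse_eq_divide pos_divide_le_eq mult.commute)
    qed
    have "\<exists>s>t. s * D < t * D + e" if "0 < e" for e
    proof -
      have "(\<lambda>s. s * D) \<midarrow>t\<rightarrow> t * D" by (intro tendsto_intros)
      then have "eventually (\<lambda>s. s * D < t * D + e) (at_right t)"
        using that by (intro order_tendstoD(2)[of _ "t * D"]) (auto intro: tendsto_within_subset)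
      then show ?thesis using eventually_happens'[OF trivial_limit_at_right_real, of "\<lambda>s. s * D < t * D + e \<and> t < s" t]
        by (auto simp: eventually_conj_iff eventually_at_right_less)
    qed
    note close = this
    have "- integral\<^sup>L P \<phi> - integral\<^sup>L Q \<psi> - m \<le> t * D"
    proof (rule field_le_epsilon)
      fix e :: real assume "0 < e"
      from close[OF this] obtain s where "t < s" "s * D < t * D + e" by blast
      then show "- integral\<^sup>L P \<phi> - integral\<^sup>L Q \<psi> - m \<le> t * D + e" using *[of s] t by simp
    qed
    then show ?thesis using w by simp
  qed
  have W_ne: "W f \<noteq> {}" if f: "f \<in> V" for f
  proof -
    obtain B where "\<And>z. \<bar>f z\<bar> \<le> B" using f unfolding V_def by auto
    then have "dominates f (\<lambda>x. B) (\<lambda>y. 0) 0 0" unfolding dominates_def by (auto simp: bounded_borel_const abs_le_iff)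
    then show ?thesis using W_I by blast
  qed
  have W_bdd: "bdd_below (W f)" if f: "f \<in> V" for f
  proof -
    obtain B where "\<And>z. \<bar>f z\<bar> \<le> B" using f unfolding V_def by auto
    then have "- B \<le> f z" for z using abs_le_D2 minus_le_iff by blast
    from W_lower[OF _ this] show ?thesis by (rule bdd_belowI)
  qed
  have zero_in_W: "0 \<in> W f" if "\<And>z. f z \<le> 0" for f
    using W_I[of f "\<lambda>x. 0" "\<lambda>y. 0" 0 0] that unfolding dominates_def by (simp add: bounded_borel_const)
  define p where "p f = Inf (W f)" for f
  have p_le: "p f \<le> w" if "f \<in> V" "w \<in> W f" for f w
    unfolding p_def using that by (intro cInf_lower W_bdd)
  have "sublinear_on V (\<lambda>f. Inf (W f))"
  proof (rule sublinear_on_Inf[OF V_scale W_ne W_bdd V_add])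
    fix f g a b assume "a \<in> W f" "b \<in> W g"
    obtain \<phi> \<psi> t k where a: "a = integral\<^sup>L P \<phi> + integral\<^sup>L Q \<psi> + t * D" and d1: "dominates f \<phi> \<psi> t k"
      using W_E[OF \<open>a \<in> W f\<close>] by blast
    obtain \<phi>' \<psi>' s l where b: "b = integral\<^sup>L P \<phi>' + integral\<^sup>L Q \<psi>' + s * D" and d2: "dominates g \<phi>' \<psi>' s l"
      using W_E[OF \<open>b \<in> W g\<close>] by blast
    \<comment> \<open>The two majorants may involve different members of the sequence; by
      monotonicity the later one serves both.\<close>
    have "dominates (\<lambda>z. f z + g z) (\<lambda>x. \<phi> x + \<phi>' x) (\<lambda>y. \<psi> y + \<psi>' y) (t + s) (max k l)"
      unfolding dominates_def
    proof (intro conjI allI)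
      fix x y
      have "t * h k (x, y) \<le> t * h (max k l) (x, y)" "s * h l (x, y) \<le> s * h (max k l) (x, y)"
        using d1 d2 unfolding dominates_def by (intro mult_left_mono h_mono; simp)+
      moreover have "f (x, y) \<le> \<phi> x + \<psi> y + t * h k (x, y)" "g (x, y) \<le> \<phi>' x + \<psi>' y + s * h l (x, y)"
        using d1 d2 unfolding dominates_def by blast+
      ultimately show "f (x, y) + g (x, y) \<le> \<phi> x + \<phi>' x + (\<psi> y + \<psi>' y) + (t + s) * h (max k l) (x, y)"
        by (simp add: algebra_simps)
    qed (use d1 d2 in \<open>auto simp: dominates_def intro: bounded_borel_add\<close>)
    from W_I[OF this] show "\<exists>c\<in>W (\<lambda>z. f z + g z). c \<le> a + b"
      using d1 d2 int_P int_Q unfolding a b dominates_def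
      by (intro bexI) (auto simp: algebra_simps)
  next
    fix f w and a :: real assume a: "0 < a" and "w \<in> W f"
    obtain \<phi> \<psi> t k where w: "w = integral\<^sup>L P \<phi> + integral\<^sup>L Q \<psi> + t * D" and d: "dominates f \<phi> \<psi> t k"
      using W_E[OF \<open>w \<in> W f\<close>] by blast
    have "dominates (\<lambda>z. a * f z) (\<lambda>x. a * \<phi> x) (\<lambda>y. a * \<psi> y) (a * t) k"
      unfolding dominates_def
    proof (intro conjI allI)
      fix x y
      have "a * f (x, y) \<le> a * (\<phi> x + \<psi> y + t * h k (x, y))"
        using d a unfolding dominates_def by (intro mult_left_mono) auto
      then show "a * f (x, y) \<le> a * \<phi> x + a * \<psi> y + a * t * h k (x, y)" by (simp add: algebra_simps)
    qed (use d a in \<open>auto simp: dominates_def intro: bounded_borel_mult_left\<close>)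
    from W_I[OF this] show "\<exists>c\<in>W (\<lambda>z. a * f z). c \<le> a * w"
      unfolding w by (intro bexI) (auto simp: algebra_simps)
  next
    have "0 \<le> w" if "w \<in> W (\<lambda>z. 0)" for w using W_lower[OF that, of 0] by simp
    then show "Inf (W (\<lambda>z. 0)) = 0" using zero_in_W[of "\<lambda>z. 0"] by (intro cInf_eq_minimum) auto
  qed
  then have "sublinear_on V p" unfolding p_def .
  then obtain L where L_le: "\<And>f. f \<in> V \<Longrightarrow> L f \<le> p f"
    and L_add: "\<And>f g. f \<in> V \<Longrightarrow> g \<in> V \<Longrightarrow> L (\<lambda>z. f z + g z) = L f + L g"
    and L_scale: "\<And>f a. f \<in> V \<Longrightarrow> 0 \<le> a \<Longrightarrow> L (\<lambda>z. a * f z) = a * L f"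
    using hahn_banach[of V p] V_add V_scale by blast
  have const_V: "(\<lambda>z. a) \<in> V" for a unfolding V_def by auto
  have L_zero: "L (\<lambda>z. 0) = 0" using L_scale[of "\<lambda>z. 0" 0] const_V by simp
  have L_uminus: "L (\<lambda>z. - f z) = - L f" if f: "f \<in> V" for f
  proof -
    have "(\<lambda>z. - f z) \<in> V" using V_scale[OF f, of "- 1"] by simp
    then show ?thesis using L_add[OF f, of "\<lambda>z. - f z"] L_zero by simp
  qed
  have L_le_dom: "L f \<le> integral\<^sup>L P \<phi> + integral\<^sup>L Q \<psi> + t * D" if "f \<in> V" "dominates f \<phi> \<psi> t k" for f \<phi> \<psi> t k
    using L_le[OF that(1)] p_le[OF that(1) W_I[OF that(2)]] by simp
  have L_mono: "L f \<le> L g" if f: "f \<in> V" and g: "g \<in> V" and le: "\<And>z. f z \<le> g z" for f g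
  proof -
    have m: "(\<lambda>z. f z + - 1 * g z) \<in> V" by (intro V_add V_scale f g)
    have "L (\<lambda>z. f z + - 1 * g z) \<le> 0"
      using L_le[OF m] p_le[OF m zero_in_W] le by force
    moreover have "L f = L (\<lambda>z. (f z + - 1 * g z) + g z)" by simp
    ultimately show ?thesis using L_add[OF m g] by simp
  qed
  have ind_V: "indicat_real S \<in> V" for S :: "('a \<times> 'b) set"
    unfolding V_def by (auto intro!: exI[of _ 1] simp: indicator_def)
  have h_V: "h k \<in> V" for k using h_bounded[of k] h_nonneg[of k] unfolding V_def by auto
  define \<mu> where "\<mu> S = L (indicat_real S)" for S
  have \<mu>_add: "\<mu> (S \<union> T) = \<mu> S + \<mu> T" if "S \<inter> T = {}" for S T
  proof -
    have "indicat_real (S \<union> T) = (\<lambda>z. indicat_real S z + indicat_real T z)"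
      using that by (auto simp: fun_eq_iff indicator_def)
    then show ?thesis unfolding \<mu>_def using L_add[OF ind_V ind_V] by simp
  qed
  \<comment> \<open>A function that splits as \<open>\<phi> x + \<psi> y\<close> dominates itself
    with \<open>t = 0\<close>, and so does its negative. The two resulting bounds force equality,
    which yields both marginals.\<close>
  have L_sum: "L f = integral\<^sup>L P \<phi> + integral\<^sup>L Q \<psi>"
    if f: "f \<in> V" and bb: "\<phi> \<in> bounded_borel" "\<psi> \<in> bounded_borel" and eq: "\<And>x y. f (x, y) = \<phi> x + \<psi> y" for f \<phi> \<psi>
  proof (rule antisym)
    show "L f \<le> integral\<^sup>L P \<phi> + integral\<^sup>L Q \<psi>"
      using L_le_dom[OF f, of \<phi> \<psi> 0 0] bb eq by (simp add: dominates_def)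
    have "(\<lambda>z. - f z) \<in> V" using V_scale[OF f, of "- 1"] by simp
    from L_le_dom[OF this, of "\<lambda>x. - \<phi> x" "\<lambda>y. - \<psi> y" 0 0]
    show "integral\<^sup>L P \<phi> + integral\<^sup>L Q \<psi> \<le> L f"
      using bb eq L_uminus[OF f] by (simp add: dominates_def bounded_borel_uminus)
  qed
  have fst_marginal: "\<mu> (A \<times> UNIV) = measure P A" if "A \<in> sets borel" for A
    using that P' L_sum[OF ind_V, of "indicat_real A" "\<lambda>y. 0" "A \<times> UNIV"] unfolding \<mu>_def
    by (simp add: bounded_borel_indicator bounded_borel_const indicator_times)
  have snd_marginal: "\<mu> (UNIV \<times> B) = measure Q B" if "B \<in> sets borel" for B
    using that Q' L_sum[OF ind_V, of "\<lambda>x. 0" "indicat_real B" "UNIV \<times> B"] unfolding \<mu>_def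
    by (simp add: bounded_borel_indicator bounded_borel_const indicator_times)
  have \<mu>_nonneg: "0 \<le> \<mu> S" for S
    using L_mono[of "\<lambda>z. 0" "indicat_real S"] ind_V const_V L_zero unfolding \<mu>_def by simp
  obtain R where R: "R \<in> couplings P Q" and R_le: "\<And>U. open U \<Longrightarrow> measure R U \<le> \<mu> U"
    using coupling_of_charge[OF P Q \<mu>_nonneg \<mu>_add fst_marginal snd_marginal] by blast
  have sR: "sets R = sets borel" using couplingsD(2)[OF R] sets_pair_borel[OF P'(2) Q'(2)] by simp
  interpret R: prob_space R by (rule couplingsD[OF R])
  have spR: "space R = UNIV" using sets_eq_imp_space_eq[OF sR] by simp
  have "(\<integral>\<^sup>+ z. ennreal (h k z) \<partial>R) \<le> ennreal D" for k
  proof -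
    obtain B where hB: "\<And>z. h k z \<le> B" using h_bounded by blast
    have h_meas: "h k \<in> borel_measurable R"
      unfolding measurable_cong_sets[OF sR refl] by (rule borel_measurableI_greater) (simp add: h_lsc)
    \<comment> \<open>Each layer of \<open>h k\<close> is an open set, where \<open>R\<close> is
      bounded by the charge. Summing the layers returns to \<open>L (h k)\<close>, which is at most
      \<open>D\<close>, up to an error that vanishes as \<open>N\<close> grows.\<close>
    have "integral\<^sup>L R (h k) \<le> D + B / Suc N" for N
    proof -
      define S where "S i = {z. i * B / Suc N < h k z}" for i :: nat
      have sum_V: "(\<lambda>z. \<Sum>i<m. indicat_real (S i) z) \<in> V
        \<and> L (\<lambda>z. \<Sum>i<m. indicat_real (S i) z) = (\<Sum>i<m. \<mu> (S i))" for m
      proof (induction m)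
        case 0
        show ?case by (simp add: const_V L_zero)
      next
        case (Suc m)
        then show ?case using V_add[OF _ ind_V] L_add[OF _ ind_V] by (simp add: \<mu>_def)
      qed
      have B: "0 \<le> B" using h_nonneg hB order_trans by blast
      have "integral\<^sup>L R (h k) \<le> B / Suc N * (\<Sum>i<Suc N. measure R (S i))"
        using integral_le_layer_sum(1)[OF R.prob_space_axioms h_meas h_nonneg hB, of "Suc N"] by (simp add: S_def spR)
      also have "\<dots> \<le> B / Suc N * (\<Sum>i<Suc N. \<mu> (S i))"
        using B unfolding S_def by (intro mult_left_mono sum_mono R_le h_lsc) simp
      also have "\<dots> = L (\<lambda>z. B / Suc N * (\<Sum>i<Suc N. indicat_real (S i) z))"
        using sum_V[of "Suc N"] L_scale[of "\<lambda>z. \<Sum>i<Suc N. indicat_real (S i) z" "B / Suc N"] B by simp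
      also have "\<dots> \<le> L (\<lambda>z. h k z + B / Suc N)"
      proof (rule L_mono)
        show "(\<lambda>z. B / Suc N * (\<Sum>i<Suc N. indicat_real (S i) z)) \<in> V" using sum_V V_scale by blast
        show "(\<lambda>z. h k z + B / Suc N) \<in> V" by (intro V_add h_V const_V)
        show "B / Suc N * (\<Sum>i<Suc N. indicat_real (S i) z) \<le> h k z + B / Suc N" for z
          using layer_sum_bounds(2)[OF h_nonneg[of k z] hB[of z], of "Suc N"] by (simp add: S_def indicator_def)
      qed
      also have "\<dots> = L (h k) + L (\<lambda>z. B / Suc N)" by (intro L_add h_V const_V)
      also have "L (h k) \<le> D"
        using L_le_dom[OF h_V, of k "\<lambda>x. 0" "\<lambda>y. 0" 1 k] by (simp add: dominates_def bounded_borel_const)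
      also have "L (\<lambda>z. B / Suc N) \<le> B / Suc N"
        using L_le_dom[of "\<lambda>z. B / Suc N" "\<lambda>x. B / Suc N" "\<lambda>y. 0" 0 0]
        by (simp add: dominates_def bounded_borel_const const_V P.prob_space)
      finally show ?thesis by simp
    qed
    moreover have "(\<lambda>N. D + B / Suc N) \<longlonglongrightarrow> D + 0"
      by (intro tendsto_add tendsto_const LIMSEQ_Suc[OF lim_const_over_n])
    ultimately have "integral\<^sup>L R (h k) \<le> D + 0" by (meson LIMSEQ_le_const)
    moreover have "integrable R (h k)"
      using h_meas hB h_nonneg by (intro R.integrable_const_bound[where B = B]) auto
    ultimately show ?thesis
      by (subst nn_integral_eq_integral) (auto simp: h_nonneg intro: ennreal_leI)
  qed
  with R show thesis by (rule that)
qed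

section \<open>Kantorovich duality\<close>

lemma open_superlevel_lower_semicontinuous:
  fixes f :: "'a::topological_space \<Rightarrow> ennreal"
  assumes "lower_semicontinuous f"
  shows "open {z. t < f z}"
proof (subst open_subopen, safe)
  fix z assume "t < f z"
  moreover have "f z \<le> Liminf (at z) f" using assms unfolding lower_semicontinuous_def by blast
  ultimately have "eventually (\<lambda>w. t < f w) (at z)" by (simp add: le_Liminf_iff)
  then obtain S where "open S" "z \<in> S" "\<And>w. w \<in> S \<Longrightarrow> w \<noteq> z \<Longrightarrow> t < f w"
    unfolding eventually_at_topological by blast
  with \<open>t < f z\<close> show "\<exists>T. open T \<and> z \<in> T \<and> T \<subseteq> {z. t < f z}" by (intro exI[of _ S]) auto
qed

lemma borel_measurable_lower_semicontinuous:
  "lower_semicontinuous f \<Longrightarrow> f \<in> borel_measurable borel"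
  by (rule borel_measurableI_greater) (simp add: open_superlevel_lower_semicontinuous)

text \<open>The Moreau-Yosida regularization of \<open>min f k\<close>.\<close>

definition lipschitz_minorant :: "('z::metric_space \<Rightarrow> ennreal) \<Rightarrow> nat \<Rightarrow> 'z \<Rightarrow> real" where
  "lipschitz_minorant f k z = (INF w. enn2real (min (f w) (of_nat k)) + real k * dist z w)"

context
  fixes f :: "'z::metric_space \<Rightarrow> ennreal"
begin

lemma ennreal_truncation: "ennreal (enn2real (min (f w) (of_nat k))) = min (f w) (of_nat k)"
proof -
  have "min (f w) (of_nat k) < top" by (simp add: min_less_iff_disj of_nat_less_top)
  then show ?thesis by (rule ennreal_enn2real)
qed

lemma truncation_le: "enn2real (min (f w) (of_nat k)) \<le> real k"
  using enn2real_mono[of "min (f w) (of_nat k)" "of_nat k"] by (simp add: of_nat_less_top)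

lemma lipschitz_minorant_le:
  "lipschitz_minorant f k z \<le> enn2real (min (f w) (of_nat k)) + real k * dist z w"
  unfolding lipschitz_minorant_def by (intro cINF_lower bdd_belowI2[where m = 0]) auto

lemma le_lipschitz_minorant:
  "(\<And>w. a \<le> enn2real (min (f w) (of_nat k)) + real k * dist z w) \<Longrightarrow> a \<le> lipschitz_minorant f k z"
  unfolding lipschitz_minorant_def by (intro cINF_greatest) auto

lemma lipschitz_minorant_nonneg: "0 \<le> lipschitz_minorant f k z"
  by (rule le_lipschitz_minorant) simp

lemma lipschitz_minorant_bounded: "lipschitz_minorant f k z \<le> real k"
  using lipschitz_minorant_le[of k z z] truncation_le[of z k] by simp

lemma lipschitz_minorant_le_self: "ennreal (lipschitz_minorant f k z) \<le> f z"
proof -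
  have "ennreal (lipschitz_minorant f k z) \<le> ennreal (enn2real (min (f z) (of_nat k)))"
    using lipschitz_minorant_le[of k z z] by (intro ennreal_leI) simp
  then show ?thesis by (simp add: ennreal_truncation)
qed

lemma lipschitz_minorant_mono: "k \<le> l \<Longrightarrow> lipschitz_minorant f k z \<le> lipschitz_minorant f l z"
proof (rule le_lipschitz_minorant)
  fix w assume kl: "k \<le> l"
  have "ennreal (enn2real (min (f w) (of_nat k))) \<le> ennreal (enn2real (min (f w) (of_nat l)))"
    unfolding ennreal_truncation using kl by (intro min.mono) auto
  then have "enn2real (min (f w) (of_nat k)) \<le> enn2real (min (f w) (of_nat l))"
    by simp
  moreover have "real k * dist z w \<le> real l * dist z w" using kl by (intro mult_right_mono) auto
  ultimately show "lipschitz_minorant f k z \<le> enn2real (min (f w) (of_nat l)) + real l * dist z w"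
    using lipschitz_minorant_le[of k z w] by simp
qed

lemma lipschitz_minorant_lipschitz:
  "lipschitz_minorant f k z \<le> lipschitz_minorant f k z' + real k * dist z z'"
proof -
  have "lipschitz_minorant f k z - real k * dist z z' \<le> lipschitz_minorant f k z'"
  proof (rule le_lipschitz_minorant)
    fix w
    have "real k * dist z w \<le> real k * (dist z z' + dist z' w)"
      by (intro mult_left_mono dist_triangle) simp
    then show "lipschitz_minorant f k z - real k * dist z z' \<le> enn2real (min (f w) (of_nat k)) + real k * dist z' w"
      using lipschitz_minorant_le[of k z w] by (simp add: distrib_left)
  qed
  then show ?thesis by simp
qed

lemma SUP_lipschitz_minorant:
  assumes "lower_semicontinuous f"
  shows "(SUP k. ennreal (lipschitz_minorant f k z)) = f z"
proof (rule antisym)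
  show "(SUP k. ennreal (lipschitz_minorant f k z)) \<le> f z"
    by (intro SUP_least lipschitz_minorant_le_self)
  show "f z \<le> (SUP k. ennreal (lipschitz_minorant f k z))"
  proof (rule dense_le)
    fix t assume t: "t < f z"
    then have "t < top" using order_less_le_trans top_greatest by blast
    then obtain r where r: "t = ennreal r" "0 \<le> r" by (cases t) auto
    obtain e where e: "0 < e" "\<And>w. dist w z < e \<Longrightarrow> t < f w"
      using open_superlevel_lower_semicontinuous[OF assms, of t] t unfolding open_dist by auto
    \<comment> \<open>\<open>k \<ge> r\<close> keeps the truncated values near \<open>z\<close>
      above \<open>r\<close>; \<open>k \<ge> r / e\<close> makes the penalty at distance at least
      \<open>e\<close> exceed or equal \<open>r\<close>.\<close>
    obtain k :: nat where k: "max r (r / e) \<le> real k" using real_arch_simple by blast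
    then have kr: "r \<le> real k" "r \<le> real k * e" using e by (auto simp: field_simps)
    have "r \<le> lipschitz_minorant f k z"
    proof (rule le_lipschitz_minorant)
      fix w
      show "r \<le> enn2real (min (f w) (of_nat k)) + real k * dist z w"
      proof (cases "dist w z < e")
        case True
        have "ennreal r \<le> of_nat k" using kr(1) by (simp add: ennreal_leI flip: ennreal_of_nat_eq_real_of_nat)
        then have "ennreal r \<le> ennreal (enn2real (min (f w) (of_nat k)))"
          unfolding ennreal_truncation using e(2)[OF True] r by simp
        then have "r \<le> enn2real (min (f w) (of_nat k))" by simp
        then show ?thesis by (simp add: add_increasing2)
      next
        case False
        then have "real k * e \<le> real k * dist z w" by (intro mult_left_mono) (auto simp: dist_commute)
        then show ?thesis using kr(2) by (simp add: add_increasing)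
      qed
    qed
    then have "t \<le> ennreal (lipschitz_minorant f k z)" unfolding r by (rule ennreal_leI)
    then show "t \<le> (SUP k. ennreal (lipschitz_minorant f k z))" by (rule SUP_upper2[OF UNIV_I])
  qed
qed

end

section \<open>Duality with continuous potentials\<close>

lemma continuous_of_lipschitz:
  fixes g :: "'a::metric_space \<Rightarrow> real"
  assumes "\<And>x x'. g x \<le> g x' + K * dist x x'"
  shows "continuous_on UNIV g"
proof (rule continuous_on_iff[THEN iffD2, rule_format])
  fix x and e :: real assume e: "0 < e"
  have "dist (g x') (g x) < e" if d: "dist x' x < e / (\<bar>K\<bar> + 1)" for x'
  proof -
    have "dist (g x') (g x) \<le> \<bar>K\<bar> * dist x' x"
      using assms[of x x'] assms[of x' x] abs_ge_self[of "K"] mult_right_mono[OF abs_ge_self[of K], of "dist x x'"]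
      by (simp add: dist_real_def dist_commute abs_le_iff)
    also have "\<dots> \<le> (\<bar>K\<bar> + 1) * dist x' x" by (intro mult_right_mono) auto
    also have "\<dots> < e" using d by (simp add: field_simps)
    finally show ?thesis .
  qed
  then show "\<exists>d>0. \<forall>x'\<in>UNIV. dist x' x < d \<longrightarrow> dist (g x') (g x) < e"
    using e by (intro exI[of _ "e / (\<bar>K\<bar> + 1)"]) auto
qed

lemma continuous_bounded_borel:
  "continuous_on UNIV f \<Longrightarrow> bounded (range f) \<Longrightarrow> f \<in> bounded_borel"
  unfolding bounded_borel_def by (simp add: borel_measurable_continuous_onI)

text \<open>\<open>\<phi>'\<close> is the c-transform of \<open>\<psi>\<close>, the largest function
  compatible with it. As an infimum of functions of \<open>x\<close> that share one Lipschitz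
  constant it is Lipschitz itself, so potentials are regularized without losing dual value.\<close>

lemma cost_transform:
  fixes h :: "'a::metric_space \<Rightarrow> 'b \<Rightarrow> real"
  assumes lip: "\<And>x x' y. h x y \<le> h x' y + K * dist x x'"
    and h: "\<And>x y. 0 \<le> h x y" "\<And>x y. h x y \<le> B"
    and \<psi>: "\<And>y. \<bar>\<psi> y\<bar> \<le> C"
    and le: "\<And>x y. \<phi> x + \<psi> y \<le> h x y"
  obtains \<phi>' where "continuous_on UNIV \<phi>'" "bounded (range \<phi>')" "\<And>x. \<phi> x \<le> \<phi>' x"
    "\<And>x y. \<phi>' x + \<psi> y \<le> h x y"
proof -
  define \<phi>' where "\<phi>' x = (INF y. h x y - \<psi> y)" for x
  have lower: "- C \<le> h x y - \<psi> y" for x y using h(1)[of x y] \<psi>[of y] by (simp add: abs_le_iff)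
  have \<phi>'_le: "\<phi>' x \<le> h x y - \<psi> y" for x y
    unfolding \<phi>'_def by (intro cINF_lower bdd_belowI2[where m = "- C"] lower) simp
  have le_\<phi>': "a \<le> \<phi>' x" if "\<And>y. a \<le> h x y - \<psi> y" for a x
    unfolding \<phi>'_def using that by (intro cINF_greatest) auto
  have "\<phi>' x - K * dist x x' \<le> \<phi>' x'" for x x'
  proof (rule le_\<phi>')
    show "\<phi>' x - K * dist x x' \<le> h x' y - \<psi> y" for y using \<phi>'_le[of x y] lip[of x y x'] by simp
  qed
  then have "continuous_on UNIV \<phi>'" by (intro continuous_of_lipschitz[of _ K]) (simp add: algebra_simps)
  moreover have "bounded (range \<phi>')"
  proof -
    have "\<bar>\<phi>' x\<bar> \<le> B + C" for x
    proof -
      have "\<phi>' x \<le> B + C" for x using \<phi>'_le[of x undefined] h(2)[of x undefined] \<psi>[of undefined] by (simp add: abs_le_iff)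
      moreover have "- C \<le> \<phi>' x" by (intro le_\<phi>' lower)
      moreover have "0 \<le> B" using h order_trans by blast
      ultimately show ?thesis by (simp add: abs_le_iff algebra_simps add_increasing)
    qed
    then show ?thesis unfolding bounded_iff by auto
  qed
  moreover have "\<phi> x \<le> \<phi>' x" for x by (intro le_\<phi>') (use le in \<open>simp add: algebra_simps\<close>)
  moreover have "\<phi>' x + \<psi> y \<le> h x y" for x y using \<phi>'_le[of x y] by simp
  ultimately show thesis by (rule that)
qed

lemma coupling_integral_sum:
  fixes P :: "'a::polish_space measure" and Q :: "'b::polish_space measure"
  assumes P: "P \<in> prob_measures" and Q: "Q \<in> prob_measures" and R: "R \<in> couplings P Q"
    and \<phi>: "\<phi> \<in> bounded_borel" and \<psi>: "\<psi> \<in> bounded_borel"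
  shows "integrable R (\<lambda>z. \<phi> (fst z) + \<psi> (snd z))"
    and "integral\<^sup>L R (\<lambda>z. \<phi> (fst z) + \<psi> (snd z)) = integral\<^sup>L P \<phi> + integral\<^sup>L Q \<psi>"
proof -
  note P' = prob_measuresD[OF P] and Q' = prob_measuresD[OF Q]
  note d = couplingsD(3,4)[OF R] and [measurable] = couplingsD(5,6)[OF R]
  have m: "\<phi> \<in> borel_measurable P" "\<psi> \<in> borel_measurable Q"
    using bounded_borelD(1)[OF \<phi>] bounded_borelD(1)[OF \<psi>] P' Q' by (simp_all cong: measurable_cong_sets)
  have i: "integrable P \<phi>" "integrable Q \<psi>"
    using integrable_bounded_borel P' Q' \<phi> \<psi> by blast+
  have "integrable (distr R P fst) \<phi>" "integrable (distr R Q snd) \<psi>" using i d by simp_all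
  then have i': "integrable R (\<lambda>z. \<phi> (fst z))" "integrable R (\<lambda>z. \<psi> (snd z))"
    using m by (simp_all add: integrable_distr_eq)
  then show "integrable R (\<lambda>z. \<phi> (fst z) + \<psi> (snd z))" by simp
  have "integral\<^sup>L P \<phi> = integral\<^sup>L R (\<lambda>z. \<phi> (fst z))" "integral\<^sup>L Q \<psi> = integral\<^sup>L R (\<lambda>z. \<psi> (snd z))"
    using integral_distr[of fst R P \<phi>] integral_distr[of snd R Q \<psi>] m d by simp_all
  then show "integral\<^sup>L R (\<lambda>z. \<phi> (fst z) + \<psi> (snd z)) = integral\<^sup>L P \<phi> + integral\<^sup>L Q \<psi>"
    using i' by simp
qed

text \<open>Weak duality. Since \<open>ennreal\<close> truncates at 0, the constraint bounds only
  the positive part of \<open>\<phi> x + \<psi> y\<close>; this positive part is what gets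
  integrated against the coupling.\<close>

lemma dual_le_coupling_cost:
  fixes P :: "'a::polish_space measure" and Q :: "'b::polish_space measure"
  assumes P: "P \<in> prob_measures" and Q: "Q \<in> prob_measures" and R: "R \<in> couplings P Q"
    and \<phi>: "\<phi> \<in> bounded_borel" and \<psi>: "\<psi> \<in> bounded_borel"
    and le: "\<And>x y. ennreal (\<phi> x + \<psi> y) \<le> c (x, y)"
  shows "ennreal (integral\<^sup>L P \<phi> + integral\<^sup>L Q \<psi>) \<le> (\<integral>\<^sup>+ z. c z \<partial>R)"
proof -
  define g where "g z = \<phi> (fst z) + \<psi> (snd z)" for z
  have g: "integrable R g" and eq: "integral\<^sup>L R g = integral\<^sup>L P \<phi> + integral\<^sup>L Q \<psi>"
    using coupling_integral_sum[OF P Q R \<phi> \<psi>] unfolding g_def by auto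
  have gm: "integrable R (\<lambda>z. max 0 (g z))" using g by simp
  have "ennreal (integral\<^sup>L R g) \<le> ennreal (\<integral>z. max 0 (g z) \<partial>R)"
    by (intro ennreal_leI integral_mono g gm) simp
  also have "\<dots> = (\<integral>\<^sup>+ z. ennreal (max 0 (g z)) \<partial>R)" by (rule nn_integral_eq_integral[OF gm, symmetric]) simp
  also have "\<dots> \<le> (\<integral>\<^sup>+ z. c z \<partial>R)"
  proof (rule nn_integral_mono)
    fix z
    have "ennreal (max 0 (g z)) = ennreal (g z)" by (simp add: max_def ennreal_neg)
    then show "ennreal (max 0 (g z)) \<le> c z" using le[of "fst z" "snd z"] by (simp add: g_def)
  qed
  finally show ?thesis using eq by simp
qed

text \<open>Borel potentials were needed to pin down the marginals, continuous ones are needed for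
  the weak topology. Two successive c-transforms with respect to a Lipschitz minorant of
  \<open>c\<close> turn the former into the latter and raise both integrals.\<close>

lemma coupling_of_continuous_dual_bound:
  fixes P :: "'a::polish_space measure" and Q :: "'b::polish_space measure"
  assumes P: "P \<in> prob_measures" and Q: "Q \<in> prob_measures" and c: "lower_semicontinuous c"
    and dual: "\<And>\<phi> \<psi>. continuous_on UNIV \<phi> \<Longrightarrow> bounded (range \<phi>) \<Longrightarrow>
      continuous_on UNIV \<psi> \<Longrightarrow> bounded (range \<psi>) \<Longrightarrow>
      (\<And>x y. ennreal (\<phi> x + \<psi> y) \<le> c (x, y)) \<Longrightarrow> integral\<^sup>L P \<phi> + integral\<^sup>L Q \<psi> \<le> D"
  obtains R where "R \<in> couplings P Q" "(\<integral>\<^sup>+ z. c z \<partial>R) \<le> ennreal D"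
proof -
  note P' = prob_measuresD[OF P] and Q' = prob_measuresD[OF Q]
  define h where "h = lipschitz_minorant c"
  have h_cont: "continuous_on UNIV (h k)" for k
    unfolding h_def by (rule continuous_of_lipschitz) (rule lipschitz_minorant_lipschitz)
  obtain R where R: "R \<in> couplings P Q" "\<And>k. (\<integral>\<^sup>+ z. ennreal (h k z) \<partial>R) \<le> ennreal D"
  proof (rule coupling_of_dual_bound[OF P Q, of h D])
    show "0 \<le> h k z" for k z unfolding h_def by (rule lipschitz_minorant_nonneg)
    show "\<exists>B. \<forall>z. h k z \<le> B" for k unfolding h_def using lipschitz_minorant_bounded by blast
    show "h k z \<le> h l z" if "k \<le> l" for k l z unfolding h_def using that by (rule lipschitz_minorant_mono)
    show "open {z. t < h k z}" for k t
      using h_cont[of k] by (intro open_Collect_less continuous_intros)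
  next
    fix k \<phi> \<psi> assume \<phi>: "\<phi> \<in> bounded_borel" and \<psi>: "\<psi> \<in> bounded_borel" and le: "\<And>x y. \<phi> x + \<psi> y \<le> h k (x, y)"
    have h: "0 \<le> h k z" "h k z \<le> real k" for z
      unfolding h_def by (rule lipschitz_minorant_nonneg lipschitz_minorant_bounded)+
    have lip1: "h k (x, y) \<le> h k (x', y) + real k * dist x x'" for x x' y
      using lipschitz_minorant_lipschitz[of c k "(x, y)" "(x', y)"] by (simp add: h_def dist_Pair_Pair)
    have lip2: "h k (x, y) \<le> h k (x, y') + real k * dist y y'" for x y y'
      using lipschitz_minorant_lipschitz[of c k "(x, y)" "(x, y')"] by (simp add: h_def dist_Pair_Pair)
    obtain C where "\<And>y. \<bar>\<psi> y\<bar> \<le> C" using bounded_borelD(2)[OF \<psi>] by blast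
    then obtain \<phi>' where \<phi>': "continuous_on UNIV \<phi>'" "bounded (range \<phi>')" "\<And>x. \<phi> x \<le> \<phi>' x"
      "\<And>x y. \<phi>' x + \<psi> y \<le> h k (x, y)"
      using cost_transform[of "\<lambda>x y. h k (x, y)" "real k" "real k" \<psi> C \<phi>] lip1 h le by blast
    note \<phi>'_bb = continuous_bounded_borel[OF \<phi>'(1,2)]
    obtain C' where "\<And>x. \<bar>\<phi>' x\<bar> \<le> C'" using bounded_borelD(2)[OF \<phi>'_bb] by blast
    then obtain \<psi>' where \<psi>': "continuous_on UNIV \<psi>'" "bounded (range \<psi>')" "\<And>y. \<psi> y \<le> \<psi>' y"
      "\<And>y x. \<psi>' y + \<phi>' x \<le> h k (x, y)"
      using cost_transform[of "\<lambda>y x. h k (x, y)" "real k" "real k" \<phi>' C' \<psi>] lip2 h \<phi>'(4)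
      by (metis add.commute)
    note \<psi>'_bb = continuous_bounded_borel[OF \<psi>'(1,2)]
    have "ennreal (\<phi>' x + \<psi>' y) \<le> c (x, y)" for x y
    proof -
      have "ennreal (\<phi>' x + \<psi>' y) \<le> ennreal (h k (x, y))" using \<psi>'(4)[of y x] by (intro ennreal_leI) simp
      also have "\<dots> \<le> c (x, y)" unfolding h_def by (rule lipschitz_minorant_le_self)
      finally show ?thesis .
    qed
    then have "integral\<^sup>L P \<phi>' + integral\<^sup>L Q \<psi>' \<le> D" by (rule dual[OF \<phi>'(1,2) \<psi>'(1,2)])
    moreover have "integral\<^sup>L P \<phi> \<le> integral\<^sup>L P \<phi>'"
      by (intro integral_mono integrable_bounded_borel[OF P'(1,2)] \<phi> \<phi>'_bb \<phi>'(3))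
    moreover have "integral\<^sup>L Q \<psi> \<le> integral\<^sup>L Q \<psi>'"
      by (intro integral_mono integrable_bounded_borel[OF Q'(1,2)] \<psi> \<psi>'_bb \<psi>'(3))
    ultimately show "integral\<^sup>L P \<phi> + integral\<^sup>L Q \<psi> \<le> D" by simp
  qed blast
  have sR: "sets R = sets borel" using R(1) sets_pair_borel[OF P'(2) Q'(2)] unfolding couplings_def by simp
  have "(\<integral>\<^sup>+ z. c z \<partial>R) = (\<integral>\<^sup>+ z. (SUP k. ennreal (h k z)) \<partial>R)"
    unfolding h_def by (simp add: SUP_lipschitz_minorant[OF c])
  also have "\<dots> = (SUP k. \<integral>\<^sup>+ z. ennreal (h k z) \<partial>R)"
  proof (rule nn_integral_monotone_convergence_SUP)
    show "incseq (\<lambda>k z. ennreal (h k z))"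
      unfolding h_def by (auto simp: incseq_def le_fun_def intro!: ennreal_leI lipschitz_minorant_mono)
    show "(\<lambda>z. ennreal (h k z)) \<in> borel_measurable R" for k
      using borel_measurable_continuous_onI[OF h_cont] measurable_cong_sets[OF sR refl]
      by (intro measurable_compose[OF _ measurable_ennreal]) blast
  qed
  also have "\<dots> \<le> ennreal D" by (intro SUP_least R(2))
  finally show thesis using that R(1) by blast
qed

lemma couplings_nonempty:
  fixes P :: "'a::polish_space measure" and Q :: "'b::polish_space measure"
  assumes P: "P \<in> prob_measures" and Q: "Q \<in> prob_measures"
  shows "couplings P Q \<noteq> {}"
proof -
  note P' = prob_measuresD[OF P] and Q' = prob_measuresD[OF Q]
  interpret P: prob_space P by (rule P')
  interpret Q: prob_space Q by (rule Q')
  have "distr (P \<Otimes>\<^sub>M Q) Q snd = Q"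
  proof (rule measure_eqI)
    fix B assume "B \<in> sets (distr (P \<Otimes>\<^sub>M Q) Q snd)"
    then have B: "B \<in> sets Q" by simp
    have "snd -` B \<inter> space (P \<Otimes>\<^sub>M Q) = space P \<times> B"
      using sets.sets_into_space[OF B] by (auto simp: space_pair_measure)
    then show "emeasure (distr (P \<Otimes>\<^sub>M Q) Q snd) B = emeasure Q B"
      using B by (simp add: emeasure_distr Q.emeasure_pair_measure_Times P.emeasure_space_1)
  qed simp
  then have "P \<Otimes>\<^sub>M Q \<in> couplings P Q"
    unfolding couplings_def using Q.distr_pair_fst[of P] prob_space_pair[OF P'(1) Q'(1)] by simp
  then show ?thesis by blast
qed

text \<open>Weak duality bounds every dual value by the infimum \<open>D\<close>, so the preceding
  construction returns a coupling of cost at most \<open>D\<close>. An infinite infimum is attained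
  by any coupling.\<close>

lemma transport_cost_attained:
  fixes P :: "'a::polish_space measure" and Q :: "'b::polish_space measure"
  assumes P: "P \<in> prob_measures" and Q: "Q \<in> prob_measures" and c: "lower_semicontinuous c"
  shows "\<exists>R\<in>couplings P Q. (\<integral>\<^sup>+ z. c z \<partial>R) = transport_cost c P Q"
proof (cases "transport_cost c P Q = top")
  case True
  obtain R where R: "R \<in> couplings P Q" using couplings_nonempty[OF P Q] by blast
  then have "transport_cost c P Q \<le> (\<integral>\<^sup>+ z. c z \<partial>R)" unfolding transport_cost_def by (rule INF_lower)
  then show ?thesis using True R by (auto simp: top_unique)
next
  case False
  then obtain D where D: "transport_cost c P Q = ennreal D" "0 \<le> D" by (cases "transport_cost c P Q") auto
  obtain R where R: "R \<in> couplings P Q" "(\<integral>\<^sup>+ z. c z \<partial>R) \<le> ennreal D"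
  proof (rule coupling_of_continuous_dual_bound[OF P Q c, of D])
    fix \<phi> \<psi> assume cont: "continuous_on UNIV \<phi>" "bounded (range \<phi>)" "continuous_on UNIV \<psi>" "bounded (range \<psi>)"
      and le: "\<And>x y. ennreal (\<phi> x + \<psi> y) \<le> c (x, y)"
    have "ennreal (integral\<^sup>L P \<phi> + integral\<^sup>L Q \<psi>) \<le> ennreal D"
      unfolding D(1)[symmetric] transport_cost_def
      by (intro INF_greatest dual_le_coupling_cost[OF P Q] continuous_bounded_borel cont le)
    then show "integral\<^sup>L P \<phi> + integral\<^sup>L Q \<psi> \<le> D" using D(2) by simp
  qed blast
  moreover have "transport_cost c P Q \<le> (\<integral>\<^sup>+ z. c z \<partial>R)"
    unfolding transport_cost_def by (intro INF_lower R)
  ultimately show ?thesis using D by (intro bexI[of _ R]) auto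
qed

text \<open>Strong duality at a fixed level. Each admissible pair of potentials imposes a weakly
  open condition on \<open>P\<close> and \<open>Q\<close>, so this form exhibits the superlevel sets
  of the transport cost as unions of open sets.\<close>

lemma transport_cost_greater_iff:
  fixes P :: "'a::polish_space measure" and Q :: "'b::polish_space measure"
  assumes P: "P \<in> prob_measures" and Q: "Q \<in> prob_measures" and c: "lower_semicontinuous c" and \<alpha>: "0 \<le> \<alpha>"
  shows "ennreal \<alpha> < transport_cost c P Q \<longleftrightarrow> (\<exists>\<phi> \<psi>. continuous_on UNIV \<phi> \<and> bounded (range \<phi>) \<and>
    continuous_on UNIV \<psi> \<and> bounded (range \<psi>) \<and> (\<forall>x y. ennreal (\<phi> x + \<psi> y) \<le> c (x, y)) \<and>
    \<alpha> < integral\<^sup>L P \<phi> + integral\<^sup>L Q \<psi>)" (is "_ \<longleftrightarrow> ?dual")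
proof
  assume gt: "ennreal \<alpha> < transport_cost c P Q"
  show ?dual
  proof (rule ccontr)
    assume "\<not> ?dual"
    then obtain R where "R \<in> couplings P Q" "(\<integral>\<^sup>+ z. c z \<partial>R) \<le> ennreal \<alpha>"
      using coupling_of_continuous_dual_bound[OF P Q c, of \<alpha>] by (metis not_le)
    then have "transport_cost c P Q \<le> ennreal \<alpha>" unfolding transport_cost_def by (rule INF_lower2)
    then show False using gt by simp
  qed
next
  assume ?dual
  then obtain \<phi> \<psi> where cont: "continuous_on UNIV \<phi>" "bounded (range \<phi>)" "continuous_on UNIV \<psi>" "bounded (range \<psi>)"
    and le: "\<And>x y. ennreal (\<phi> x + \<psi> y) \<le> c (x, y)" and gt: "\<alpha> < integral\<^sup>L P \<phi> + integral\<^sup>L Q \<psi>" by blast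
  have "ennreal \<alpha> < ennreal (integral\<^sup>L P \<phi> + integral\<^sup>L Q \<psi>)" using gt \<alpha> by (simp add: ennreal_less_iff)
  also have "\<dots> \<le> transport_cost c P Q"
    unfolding transport_cost_def
    by (intro INF_greatest dual_le_coupling_cost[OF P Q] continuous_bounded_borel cont le)
  finally show "ennreal \<alpha> < transport_cost c P Q" .
qed

section \<open>The weak topology\<close>

lemma topspace_weak_topology: "topspace weak_topology = prob_measures"
proof -
  have "prob_measures \<in> {{Q \<in> prob_measures. integral\<^sup>L Q f \<in> U} | (f :: 'a \<Rightarrow> real) U.
      continuous_on UNIV f \<and> bounded (range f) \<and> open U}"
    by (rule CollectI, rule exI[of _ "\<lambda>_. 0"], rule exI[of _ UNIV]) auto
  then show ?thesis unfolding weak_topology_def topology_generated_by_topspace by blast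
qed

lemma continuous_map_weak_integral:
  fixes f :: "'a::topological_space \<Rightarrow> real"
  assumes "continuous_on UNIV f" "bounded (range f)"
  shows "continuous_map weak_topology euclideanreal (\<lambda>Q. integral\<^sup>L Q f)"
  unfolding continuous_map_def topspace_weak_topology
proof (intro conjI allI impI)
  fix U :: "real set" assume "openin euclideanreal U"
  then show "openin weak_topology {Q \<in> prob_measures. integral\<^sup>L Q f \<in> U}"
    unfolding weak_topology_def using assms by (intro topology_generated_by_Basis) auto
qed simp

lemma continuous_map_weak_topology:
  fixes T :: "'x \<Rightarrow> 'a::topological_space measure"
  assumes T: "\<And>x. x \<in> topspace X \<Longrightarrow> T x \<in> prob_measures"
    and cont: "\<And>f :: 'a \<Rightarrow> real. continuous_on UNIV f \<Longrightarrow> bounded (range f) \<Longrightarrow>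
      continuous_map X euclideanreal (\<lambda>x. integral\<^sup>L (T x) f)"
  shows "continuous_map X weak_topology T"
  unfolding weak_topology_def
proof (rule continuous_on_generated_topo)
  fix S assume "S \<in> {{Q \<in> prob_measures. integral\<^sup>L Q f \<in> U} | (f :: 'a \<Rightarrow> real) U.
      continuous_on UNIV f \<and> bounded (range f) \<and> open U}"
  then obtain f :: "'a \<Rightarrow> real" and U where f: "continuous_on UNIV f" "bounded (range f)" and U: "open U"
    and S: "S = {Q \<in> prob_measures. integral\<^sup>L Q f \<in> U}" by blast
  have "openin X {x \<in> topspace X. integral\<^sup>L (T x) f \<in> U}"
    by (intro openin_continuous_map_preimage[OF cont[OF f]]) (simp add: U)
  moreover have "T -` S \<inter> topspace X = {x \<in> topspace X. integral\<^sup>L (T x) f \<in> U}" using T S by auto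
  ultimately show "openin X (T -` S \<inter> topspace X)" by simp
next
  show "T ` topspace X \<subseteq> \<Union>{{Q \<in> prob_measures. integral\<^sup>L Q f \<in> U} | (f :: 'a \<Rightarrow> real) U.
      continuous_on UNIV f \<and> bounded (range f) \<and> open U}"
    using T topspace_weak_topology unfolding weak_topology_def topology_generated_by_topspace by blast
qed

section \<open>The Borel sigma-algebra of a topology\<close>

lemma space_borel_of: "space (borel_of T) = topspace T"
  unfolding borel_of_def by (simp add: space_measure_of_conv)

lemma sets_borel_of: "sets (borel_of T) = sigma_sets (topspace T) {U. openin T U}"
  unfolding borel_of_def using openin_subset by (intro sets_measure_of) auto

lemma openin_in_borel_of: "openin T U \<Longrightarrow> U \<in> sets (borel_of T)"
  unfolding sets_borel_of by (rule sigma_sets.Basic) simp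

lemma closedin_in_borel_of: "closedin T U \<Longrightarrow> U \<in> sets (borel_of T)"
proof -
  assume U: "closedin T U"
  then have "topspace T - (topspace T - U) \<in> sets (borel_of T)"
    unfolding sets_borel_of by (intro sigma_sets.Compl sigma_sets.Basic) (simp add: openin_diff)
  then show ?thesis using closedin_subset[OF U] by (simp add: double_diff)
qed

lemma measurable_borel_of:
  assumes M: "sets M = sets borel" and f: "continuous_map euclidean T f"
  shows "f \<in> measurable M (borel_of T)"
proof -
  have sp: "space M = UNIV" using sets_eq_imp_space_eq[OF M] by simp
  show ?thesis
    unfolding borel_of_def
  proof (rule measurable_measure_of)
    show "{U. openin T U} \<subseteq> Pow (topspace T)" using openin_subset by blast
    show "f \<in> space M \<rightarrow> topspace T" using f by (auto simp: continuous_map_def)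
    fix U assume "U \<in> {U. openin T U}"
    then have "openin euclidean {x \<in> topspace euclidean. f x \<in> U}"
      using openin_continuous_map_preimage[OF f] by blast
    then show "f -` U \<inter> space M \<in> sets M" by (simp add: M sp vimage_def)
  qed
qed

lemma measurable_borel_of_real:
  assumes "continuous_map T euclideanreal f"
  shows "f \<in> borel_measurable (borel_of T)"
proof (rule borel_measurableI)
  fix U :: "real set" assume "open U"
  then have "openin T {x \<in> topspace T. f x \<in> U}" using assms by (intro openin_continuous_map_preimage) auto
  then have "{x \<in> topspace T. f x \<in> U} \<in> sets (borel_of T)" by (rule openin_in_borel_of)
  then show "f -` U \<inter> space (borel_of T) \<in> sets (borel_of T)"
    by (simp add: space_borel_of vimage_def Int_def conj_commute)
qed

section \<open>Recovering a law from integrals of continuous functions\<close>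

lemma lower_semicontinuous_indicator:
  assumes "open U"
  shows "lower_semicontinuous (indicator U)"
  unfolding lower_semicontinuous_def le_Liminf_iff
proof (intro allI impI)
  fix x and y :: ennreal assume y: "y < indicator U x"
  then have "x \<in> U" by (cases "x \<in> U") auto
  then have "eventually (\<lambda>z. z \<in> U) (at x)" using assms eventually_at_topological by blast
  then show "eventually (\<lambda>z. y < indicator U z) (at x)"
    by eventually_elim (use y \<open>x \<in> U\<close> in simp)
qed

lemma continuous_lipschitz_minorant: "continuous_on UNIV (lipschitz_minorant f k)"
  by (rule continuous_of_lipschitz) (rule lipschitz_minorant_lipschitz)

lemma bounded_lipschitz_minorant: "bounded (range (lipschitz_minorant f k))"
  using lipschitz_minorant_nonneg[of f k] lipschitz_minorant_bounded[of f k]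
  by (auto simp: bounded_iff intro!: exI[of _ "real k"])

text \<open>The mass of an open set becomes a countable supremum of weakly continuous functionals.
  Both the separation of distinct laws and the measurability of evaluations rest on this.\<close>

lemma emeasure_open_eq_SUP:
  fixes P :: "'a::polish_space measure"
  assumes P: "P \<in> prob_measures" and U: "open U"
  shows "emeasure P U = (SUP k. ennreal (integral\<^sup>L P (lipschitz_minorant (indicator U) k)))"
proof -
  note P' = prob_measuresD[OF P]
  let ?h = "lipschitz_minorant (indicator U)"
  have bb: "?h k \<in> bounded_borel" for k
    by (intro continuous_bounded_borel continuous_lipschitz_minorant bounded_lipschitz_minorant)
  have "emeasure P U = (\<integral>\<^sup>+ x. indicator U x \<partial>P)" using U P' by simp
  also have "\<dots> = (\<integral>\<^sup>+ x. (SUP k. ennreal (?h k x)) \<partial>P)"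
    by (simp add: SUP_lipschitz_minorant[OF lower_semicontinuous_indicator[OF U]])
  also have "\<dots> = (SUP k. \<integral>\<^sup>+ x. ennreal (?h k x) \<partial>P)"
  proof (rule nn_integral_monotone_convergence_SUP)
    show "incseq (\<lambda>k x. ennreal (?h k x))"
      by (auto simp: incseq_def le_fun_def intro!: ennreal_leI lipschitz_minorant_mono)
    show "(\<lambda>x. ennreal (?h k x)) \<in> borel_measurable P" for k
      using bounded_borelD(1)[OF bb] measurable_cong_sets[OF P'(2) refl]
      by (intro measurable_compose[OF _ measurable_ennreal]) blast
  qed
  also have "\<dots> = (SUP k. ennreal (integral\<^sup>L P (?h k)))"
    by (intro SUP_cong refl nn_integral_eq_integral integrable_bounded_borel P' bb)
      (simp add: lipschitz_minorant_nonneg)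
  finally show ?thesis .
qed

text \<open>Makes compact sets of laws closed, and thereby measurable for the empirical laws.
  Distinct laws differ on an open set, hence on one Lipschitz minorant of its indicator.\<close>

lemma Hausdorff_weak_topology: "Hausdorff_space (weak_topology :: 'a::polish_space measure topology)"
  unfolding Hausdorff_space_def topspace_weak_topology
proof (intro allI impI, elim conjE)
  fix P Q :: "'a measure" assume P: "P \<in> prob_measures" and Q: "Q \<in> prob_measures" and "P \<noteq> Q"
  note P' = prob_measuresD[OF P] and Q' = prob_measuresD[OF Q]
  interpret P: prob_space P by (rule P')
  have "\<exists>U. open U \<and> emeasure P U \<noteq> emeasure Q U"
  proof (rule ccontr)
    assume "\<not> ?thesis"
    then have eq: "emeasure P U = emeasure Q U" if "open U" for U using that by blast
    have "P = Q"
    proof (rule measure_eqI_generator_eq[where E = "Collect open" and \<Omega> = UNIV and A = "\<lambda>_. UNIV"])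
      show "Int_stable (Collect open)" by (auto simp: Int_stable_def)
      show "emeasure P UNIV \<noteq> \<infinity>" by simp
    qed (use eq P' Q' in \<open>simp_all add: borel_def\<close>)
    then show False using \<open>P \<noteq> Q\<close> by simp
  qed
  then obtain U where U: "open U" "emeasure P U \<noteq> emeasure Q U" by blast
  then obtain k where k: "integral\<^sup>L P (lipschitz_minorant (indicator U) k) \<noteq> integral\<^sup>L Q (lipschitz_minorant (indicator U) k)"
    using emeasure_open_eq_SUP[OF P U(1)] emeasure_open_eq_SUP[OF Q U(1)] by fastforce
  define f where "f = lipschitz_minorant (indicator U :: 'a \<Rightarrow> ennreal) k"
  have "continuous_map weak_topology euclideanreal (\<lambda>Q. integral\<^sup>L Q f)"
    unfolding f_def by (intro continuous_map_weak_integral continuous_lipschitz_minorant bounded_lipschitz_minorant)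
  note pre = openin_continuous_map_preimage[OF this, unfolded topspace_weak_topology]
  have "integral\<^sup>L P f \<noteq> integral\<^sup>L Q f" using k unfolding f_def .
  then obtain V W where VW: "open V" "open W" "integral\<^sup>L P f \<in> V" "integral\<^sup>L Q f \<in> W" "V \<inter> W = {}"
    using hausdorff by metis
  show "\<exists>U V. openin weak_topology U \<and> openin weak_topology V \<and> P \<in> U \<and> Q \<in> V \<and> disjnt U V"
  proof (intro exI conjI)
    show "openin weak_topology {Q \<in> prob_measures. integral\<^sup>L Q f \<in> V}" using pre VW by simp
    show "openin weak_topology {Q \<in> prob_measures. integral\<^sup>L Q f \<in> W}" using pre VW by simp
  qed (use P Q VW in \<open>auto simp: disjnt_def\<close>)
qed

text \<open>The weak Borel sigma-algebra contains the one generated by the evaluations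
  \<open>Q \<mapsto> Q U\<close>. Through it, integrals of nonnegative Borel functions become
  measurable in the law.\<close>

lemma measurable_weak_topology_prob_algebra:
  "(\<lambda>Q. Q) \<in> measurable (borel_of (weak_topology :: 'a::polish_space measure topology)) (prob_algebra borel)"
proof (rule measurable_prob_algebra_generated[where \<Omega> = UNIV and G = "Collect open"])
  show "sets borel = sigma_sets UNIV (Collect open :: 'a set set)" by (simp add: borel_def)
  show "Int_stable (Collect open :: 'a set set)" by (auto simp: Int_stable_def)
  fix Q :: "'a measure" assume "Q \<in> space (borel_of weak_topology)"
  then have "Q \<in> prob_measures" by (simp add: space_borel_of topspace_weak_topology)
  then show "prob_space Q" "sets Q = sets borel" by (rule prob_measuresD)+
next
  fix U :: "'a set" assume "U \<in> Collect open"
  then have U: "open U" by simp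
  have [measurable]: "(\<lambda>Q. integral\<^sup>L Q (lipschitz_minorant (indicator U) k)) \<in> borel_measurable (borel_of weak_topology)" for k
    by (intro measurable_borel_of_real continuous_map_weak_integral continuous_lipschitz_minorant bounded_lipschitz_minorant)
  have "(\<lambda>Q. SUP k. ennreal (integral\<^sup>L Q (lipschitz_minorant (indicator U) k))) \<in> borel_measurable (borel_of weak_topology)"
    by measurable
  moreover have "emeasure Q U = (SUP k. ennreal (integral\<^sup>L Q (lipschitz_minorant (indicator U) k)))"
    if "Q \<in> space (borel_of weak_topology)" for Q
    using that emeasure_open_eq_SUP[OF _ U, of Q] by (simp add: space_borel_of topspace_weak_topology)
  ultimately show "(\<lambda>Q. emeasure Q U) \<in> borel_measurable (borel_of weak_topology)"
    by (simp cong: measurable_cong)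
qed simp

lemma measurable_nn_integral_weak_topology:
  fixes f :: "'a::polish_space \<Rightarrow> ennreal"
  assumes "f \<in> borel_measurable borel"
  shows "(\<lambda>Q. integral\<^sup>N Q f) \<in> borel_measurable (borel_of weak_topology)"
  using measurable_compose[OF measurable_prob_algebraD[OF measurable_weak_topology_prob_algebra]
      nn_integral_measurable_subprob_algebra[OF assms]] .

text \<open>Testing the transport cost with a countable family of step functions makes its superlevel sets
  countable unions of measurable sets. Openness in the product topology alone would not put them into
  the product of the two Borel \<open>\<sigma>\<close>-algebras.\<close>

definition step_fun :: "(rat \<times> 'a set) set \<Rightarrow> 'a \<Rightarrow> ennreal" where
  "step_fun F x = (SUP (q, B)\<in>F. ennreal (real_of_rat q) * indicator B x)"

text \<open>Rational heights over one fixed countable basis keep the family countable, independently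
  of the laws to be tested. The empty set belongs to it and stands for the zero function.\<close>

definition step_index :: "(rat \<times> 'a::second_countable_topology set) set set" where
  "step_index = {F. finite F \<and> F \<subseteq> UNIV \<times> (SOME \<B>. countable \<B> \<and> topological_basis \<B>)}"

lemma countable_basis_SOME:
  "countable (SOME \<B> :: 'a::second_countable_topology set set. countable \<B> \<and> topological_basis \<B>) \<and>
   topological_basis (SOME \<B> :: 'a set set. countable \<B> \<and> topological_basis \<B>)"
  using ex_countable_basis by (rule someI_ex)

lemma countable_step_index: "countable step_index"
  unfolding step_index_def using countable_basis_SOME
  by (intro countable_Collect_finite_subset countable_SIGMA) auto

lemma measurable_step_fun: "F \<in> step_index \<Longrightarrow> step_fun F \<in> borel_measurable borel"
proof -
  assume F: "F \<in> step_index"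
  then have "open B" if "(q, B) \<in> F" for q B
    using that countable_basis_SOME topological_basis_open unfolding step_index_def by blast
  then have "(\<lambda>x. SUP i\<in>F. ennreal (real_of_rat (fst i)) * indicator (snd i) x) \<in> borel_measurable borel"
    using F by (intro borel_measurable_SUP) (auto simp: step_index_def countable_finite)
  then show ?thesis unfolding step_fun_def[abs_def] by (simp add: case_prod_beta)
qed

text \<open>Openness of the superlevel sets makes \<open>f\<close> the supremum of all rational
  steps over basic open sets that lie below it. Finite initial segments of an enumeration of these
  steps increase to \<open>f\<close>, and monotone convergence selects one of them.\<close>

lemma step_fun_approx:
  fixes f :: "'a::second_countable_topology \<Rightarrow> ennreal"
  assumes f: "\<And>t. open {x. t < f x}" and Q: "sets Q = sets borel" and t: "t < integral\<^sup>N Q f"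
  obtains F where "F \<in> step_index" "\<And>x. step_fun F x \<le> f x" "t < integral\<^sup>N Q (step_fun F)"
proof -
  define \<B> :: "'a set set" where "\<B> = (SOME \<B>. countable \<B> \<and> topological_basis \<B>)"
  have \<B>: "countable \<B>" "topological_basis \<B>" using countable_basis_SOME unfolding \<B>_def by blast+
  define I where "I = {(q, B). B \<in> \<B> \<and> (\<forall>x\<in>B. ennreal (real_of_rat q) \<le> f x)}"
  have "I \<subseteq> UNIV \<times> \<B>" unfolding I_def by blast
  then have cI: "countable I" by (rule countable_subset) (use \<B>(1) in auto)
  have SUP_I: "step_fun I x = f x" for x
  proof (rule antisym)
    show "step_fun I x \<le> f x"
      unfolding step_fun_def I_def by (rule SUP_least) (auto simp: indicator_def)
    show "f x \<le> step_fun I x"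
    proof (rule dense_le)
      fix s assume "s < f x"
      then obtain s' where s': "s < s'" "s' < f x" using dense by blast
      then have "s' < top" by (meson order_less_le_trans top_greatest)
      then have "s < top" using s' by order
      obtain a b where ab: "s = ennreal a" "0 \<le> a" "s' = ennreal b" "0 \<le> b"
        using \<open>s < top\<close> \<open>s' < top\<close> by (cases s; cases s') auto
      have "a < b" using s'(1) ab by (simp add: ennreal_less_iff)
      then obtain q where q: "a < real_of_rat q" "real_of_rat q < b" using of_rat_dense by blast
      have "ennreal (real_of_rat q) < s'" unfolding ab(3) using q ab(2) by (intro ennreal_lessI) auto
      then have "x \<in> {x. ennreal (real_of_rat q) < f x}" using s'(2) by auto
      then obtain B where B: "B \<in> \<B>" "x \<in> B" "B \<subseteq> {x. ennreal (real_of_rat q) < f x}"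
        using topological_basisE[OF \<B>(2) f] by metis
      have "(q, B) \<in> I" using B unfolding I_def by (auto intro: less_imp_le)
      then have "ennreal (real_of_rat q) * indicator B x \<le> step_fun I x"
        unfolding step_fun_def by (rule SUP_upper2) simp
      then show "s \<le> step_fun I x" using B(2) order_trans[OF ennreal_leI[OF less_imp_le[OF q(1)]]] ab(1) by simp
    qed
  qed
  have "I \<noteq> {}"
  proof
    assume "I = {}"
    then have "f x = 0" for x using SUP_I[of x] by (simp add: step_fun_def bot_ennreal)
    then have "f = (\<lambda>_. 0)" by auto
    then show False using t by simp
  qed
  define F where "F j = from_nat_into I ` {..<j}" for j
  have F_I: "F j \<subseteq> I" for j unfolding F_def using from_nat_into[OF \<open>I \<noteq> {}\<close>] by blast
  have F: "F j \<in> step_index" for j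
    using F_I[of j] \<open>I \<subseteq> UNIV \<times> \<B>\<close> unfolding step_index_def \<B>_def[symmetric] by (auto simp: F_def)
  have I_F: "I = (\<Union>j. F j)"
  proof -
    have "(\<Union>j. F j) = range (from_nat_into I)" unfolding F_def by auto
    then show ?thesis using range_from_nat_into[OF \<open>I \<noteq> {}\<close> cI] by simp
  qed
  have mono: "step_fun G x \<le> step_fun G' x" if "G \<subseteq> G'" for G G' and x :: 'a
    unfolding step_fun_def using that by (intro SUP_subset_mono) auto
  have "f x = (SUP j. step_fun (F j) x)" for x
    unfolding SUP_I[symmetric] by (subst I_F) (simp add: step_fun_def SUP_UNION)
  then have "integral\<^sup>N Q f = (\<integral>\<^sup>+ x. (SUP j. step_fun (F j) x) \<partial>Q)" by (rule nn_integral_cong)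
  also have "\<dots> = (SUP j. integral\<^sup>N Q (step_fun (F j)))"
  proof (rule nn_integral_monotone_convergence_SUP)
    show "incseq (\<lambda>j. step_fun (F j))"
      by (auto simp: incseq_def le_fun_def F_def intro!: mono)
    show "step_fun (F j) \<in> borel_measurable Q" for j
      using measurable_step_fun[OF F] measurable_cong_sets[OF Q refl] by blast
  qed
  finally obtain j where "t < integral\<^sup>N Q (step_fun (F j))" using t by (auto simp: less_SUP_iff)
  moreover have "step_fun (F j) x \<le> f x" for x using mono[OF F_I[of j]] SUP_I by metis
  ultimately show thesis using that F by blast
qed

lemma step_fun_approx_real:
  fixes f :: "'a::second_countable_topology \<Rightarrow> ennreal" and Q :: "'a measure"
  assumes f: "\<And>t. open {x. t < f x}" and Q: "sets Q = sets borel"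
    and v: "integral\<^sup>N Q f = ennreal v" and d: "0 < d"
  shows "\<exists>F\<in>step_index. (\<forall>x. step_fun F x \<le> f x) \<and> ennreal (v - d) \<le> integral\<^sup>N Q (step_fun F)"
proof (cases "0 \<le> v - d")
  case True
  have "ennreal (v - d) < integral\<^sup>N Q f" unfolding v using d True by (simp add: ennreal_less_iff)
  from step_fun_approx[OF f Q this] show ?thesis by (metis less_imp_le)
next
  case False
  \<comment> \<open>For negative \<open>v - d\<close> the required bound is truncated to 0, which
    the zero function meets.\<close>
  have "{} \<in> step_index" unfolding step_index_def by simp
  then show ?thesis using False by (intro bexI[of _ "{}"]) (auto simp: step_fun_def bot_ennreal ennreal_neg)
qed

lemma open_superlevel_ennreal:
  assumes "continuous_on UNIV f"
  shows "open {x. t < ennreal (f x + a)}"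
proof (cases t)
  case (real r)
  then have "{x. t < ennreal (f x + a)} = {x. r < f x + a}" by (auto simp: ennreal_less_iff)
  then show ?thesis using assms by (auto intro!: open_Collect_less continuous_intros)
qed simp

text \<open>Step functions are nonnegative while potentials need not be; \<open>m\<close> pays for
  shifting them. Each of the two potentials is shifted by half of it, which is the origin of
  \<open>2 * m\<close> in the proof.\<close>

lemma transport_cost_greater_iff_step_fun:
  fixes P :: "'a::polish_space measure" and Q :: "'b::polish_space measure"
  assumes P: "P \<in> prob_measures" and Q: "Q \<in> prob_measures" and c: "lower_semicontinuous c" and \<alpha>: "0 \<le> \<alpha>"
  shows "ennreal \<alpha> < transport_cost c P Q \<longleftrightarrow> (\<exists>m. \<exists>F\<in>step_index. \<exists>G\<in>step_index.
    (\<forall>x y. step_fun F x + step_fun G y \<le> c (x, y) + of_nat m) \<and>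
    ennreal \<alpha> + of_nat m < integral\<^sup>N P (step_fun F) + integral\<^sup>N Q (step_fun G))" (is "_ \<longleftrightarrow> ?step")
proof
  note P' = prob_measuresD[OF P] and Q' = prob_measuresD[OF Q]
  interpret P: prob_space P by (rule P')
  interpret Q: prob_space Q by (rule Q')
  assume "ennreal \<alpha> < transport_cost c P Q"
  then obtain \<phi> \<psi> where cont: "continuous_on UNIV \<phi>" "bounded (range \<phi>)" "continuous_on UNIV \<psi>" "bounded (range \<psi>)"
    and le: "\<And>x y. ennreal (\<phi> x + \<psi> y) \<le> c (x, y)" and gt: "\<alpha> < integral\<^sup>L P \<phi> + integral\<^sup>L Q \<psi>"
    using transport_cost_greater_iff[OF P Q c \<alpha>] by blast
  note bb = continuous_bounded_borel[OF cont(1,2)] continuous_bounded_borel[OF cont(3,4)]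
  obtain B C where BC: "\<And>x. \<bar>\<phi> x\<bar> \<le> B" "\<And>y. \<bar>\<psi> y\<bar> \<le> C" using bb[THEN bounded_borelD(2)] by blast
  obtain m :: nat where "max B C \<le> real m" using real_arch_simple by blast
  then have nonneg: "0 \<le> \<phi> x + real m" "0 \<le> \<psi> y + real m" for x y using BC(1)[of x] BC(2)[of y] by auto
  define f where "f x = ennreal (\<phi> x + real m)" for x
  define g where "g y = ennreal (\<psi> y + real m)" for y
  have int_f: "integral\<^sup>N P f = ennreal (integral\<^sup>L P \<phi> + real m)"
    unfolding f_def using integrable_bounded_borel[OF P'(1,2) bb(1)] nonneg(1)
    by (subst nn_integral_eq_integral) (auto simp: P.prob_space)
  have int_g: "integral\<^sup>N Q g = ennreal (integral\<^sup>L Q \<psi> + real m)"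
    unfolding g_def using integrable_bounded_borel[OF Q'(1,2) bb(2)] nonneg(2)
    by (subst nn_integral_eq_integral) (auto simp: Q.prob_space)
  \<comment> \<open>The two approximations lose at most \<open>d\<close> each, so a third of the gap
    survives as strict inequality.\<close>
  define d where "d = (integral\<^sup>L P \<phi> + integral\<^sup>L Q \<psi> - \<alpha>) / 3"
  have d: "0 < d" using gt by (simp add: d_def)
  obtain F G where F: "F \<in> step_index" "\<And>x. step_fun F x \<le> f x" "ennreal (integral\<^sup>L P \<phi> + real m - d) \<le> integral\<^sup>N P (step_fun F)"
    and G: "G \<in> step_index" "\<And>y. step_fun G y \<le> g y" "ennreal (integral\<^sup>L Q \<psi> + real m - d) \<le> integral\<^sup>N Q (step_fun G)"
    using step_fun_approx_real[OF _ P'(2) int_f d] step_fun_approx_real[OF _ Q'(2) int_g d]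
    open_superlevel_ennreal[OF cont(1), of _ "real m"] open_superlevel_ennreal[OF cont(3), of _ "real m"]
    unfolding f_def g_def by blast
  have subadd: "ennreal (a + b) \<le> ennreal a + ennreal b" for a b :: real
  proof -
    have "ennreal (a + b) \<le> ennreal (max 0 a + max 0 b)" by (intro ennreal_leI) auto
    also have "\<dots> = ennreal a + ennreal b" by (simp add: max_def ennreal_neg)
    finally show ?thesis .
  qed
  have "step_fun F x + step_fun G y \<le> c (x, y) + of_nat (2 * m)" for x y
  proof -
    have "step_fun F x + step_fun G y \<le> f x + g y" by (intro add_mono F G)
    also have "\<dots> = ennreal ((\<phi> x + \<psi> y) + real (2 * m))"
      unfolding f_def g_def using nonneg by (subst ennreal_plus[symmetric]) (auto simp: algebra_simps)
    also have "\<dots> \<le> ennreal (\<phi> x + \<psi> y) + ennreal (real (2 * m))" by (rule subadd)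
    also have "\<dots> \<le> c (x, y) + of_nat (2 * m)"
      by (intro add_mono le) (simp add: ennreal_of_nat_eq_real_of_nat)
    finally show ?thesis .
  qed
  moreover have "ennreal \<alpha> + of_nat (2 * m) < integral\<^sup>N P (step_fun F) + integral\<^sup>N Q (step_fun G)"
  proof -
    have "ennreal \<alpha> + of_nat (2 * m) = ennreal (\<alpha> + real (2 * m))"
      using \<alpha> by (simp add: ennreal_of_nat_eq_real_of_nat)
    also have "\<dots> < ennreal ((integral\<^sup>L P \<phi> + real m - d) + (integral\<^sup>L Q \<psi> + real m - d))"
      using \<alpha> d unfolding d_def by (intro ennreal_lessI) (auto simp: field_simps)
    also have "\<dots> \<le> integral\<^sup>N P (step_fun F) + integral\<^sup>N Q (step_fun G)"
      by (rule order_trans[OF subadd]) (intro add_mono F G)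
    finally show ?thesis .
  qed
  ultimately show ?step using F(1) G(1) by blast
next
  assume ?step
  then obtain m F G where F: "F \<in> step_index" and G: "G \<in> step_index"
    and le: "\<And>x y. step_fun F x + step_fun G y \<le> c (x, y) + of_nat m"
    and gt: "ennreal \<alpha> + of_nat m < integral\<^sup>N P (step_fun F) + integral\<^sup>N Q (step_fun G)" by blast
  \<comment> \<open>Integrating against a coupling that attains the infimum carries the strict
    inequality over to \<open>transport_cost\<close>.\<close>
  obtain R where R: "R \<in> couplings P Q" and opt: "(\<integral>\<^sup>+ z. c z \<partial>R) = transport_cost c P Q"
    using transport_cost_attained[OF P Q c] by blast
  note P' = prob_measuresD[OF P] and Q' = prob_measuresD[OF Q]
  note sR = couplingsD(2)[OF R] and dR = couplingsD(3,4)[OF R] and [measurable] = couplingsD(5,6)[OF R]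
  interpret R: prob_space R by (rule couplingsD[OF R])
  have m[measurable]: "step_fun F \<in> borel_measurable P" "step_fun G \<in> borel_measurable Q"
    using measurable_step_fun[OF F] measurable_step_fun[OF G] P' Q' by (simp_all cong: measurable_cong_sets)
  have cm: "c \<in> borel_measurable R"
    using borel_measurable_lower_semicontinuous[OF c] measurable_cong_sets[OF sR[unfolded sets_pair_borel[OF P'(2) Q'(2)]] refl] by blast
  have "integral\<^sup>N P (step_fun F) = (\<integral>\<^sup>+ z. step_fun F (fst z) \<partial>R)"
    by (subst dR(1)[symmetric], subst nn_integral_distr) auto
  moreover have "integral\<^sup>N Q (step_fun G) = (\<integral>\<^sup>+ z. step_fun G (snd z) \<partial>R)"
    by (subst dR(2)[symmetric], subst nn_integral_distr) auto
  ultimately have "integral\<^sup>N P (step_fun F) + integral\<^sup>N Q (step_fun G) = (\<integral>\<^sup>+ z. step_fun F (fst z) + step_fun G (snd z) \<partial>R)"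
    by (subst nn_integral_add) auto
  also have "\<dots> \<le> (\<integral>\<^sup>+ z. c z + of_nat m \<partial>R)" using le by (intro nn_integral_mono) (metis prod.collapse)
  also have "\<dots> = (\<integral>\<^sup>+ z. c z \<partial>R) + of_nat m"
    using cm by (subst nn_integral_add) (auto simp: R.emeasure_space_1)
  finally have "ennreal \<alpha> + of_nat m < transport_cost c P Q + of_nat m"
    unfolding opt using gt by (rule order.strict_trans2[rotated])
  then show "ennreal \<alpha> < transport_cost c P Q" by (meson add_right_mono not_le)
qed

lemma measurable_transport_cost_greater:
  fixes c :: "'a::polish_space \<times> 'b::polish_space \<Rightarrow> ennreal"
  assumes c: "lower_semicontinuous c" and \<alpha>: "0 \<le> \<alpha>"
  shows "{(P, Q) \<in> space (borel_of weak_topology \<Otimes>\<^sub>M borel_of weak_topology). ennreal \<alpha> < transport_cost c P Q}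
    \<in> sets (borel_of weak_topology \<Otimes>\<^sub>M borel_of weak_topology)"
proof -
  let ?M = "borel_of weak_topology \<Otimes>\<^sub>M borel_of weak_topology :: ('a measure \<times> 'b measure) measure"
  define ok where "ok m F G \<longleftrightarrow> (\<forall>x y. step_fun F x + step_fun G y \<le> c (x, y) + of_nat m)" for m :: nat and F G
  have eq: "{(P, Q) \<in> space ?M. ennreal \<alpha> < transport_cost c P Q} =
    (\<Union>m. \<Union>F\<in>step_index. \<Union>G\<in>{G\<in>step_index. ok m F G}.
      {z \<in> space ?M. ennreal \<alpha> + of_nat m < integral\<^sup>N (fst z) (step_fun F) + integral\<^sup>N (snd z) (step_fun G)})"
    (is "?L = ?R")
  proof (rule set_eqI)
    fix z show "z \<in> ?L \<longleftrightarrow> z \<in> ?R"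
    proof (cases "z \<in> space ?M")
      case True
      obtain P Q where z: "z = (P, Q)" by (cases z)
      have PQ: "P \<in> prob_measures" "Q \<in> prob_measures"
        using True unfolding z by (simp_all add: space_pair_measure space_borel_of topspace_weak_topology)
      show ?thesis
        using True transport_cost_greater_iff_step_fun[OF PQ c \<alpha>] unfolding z ok_def by simp blast
    qed auto
  qed
  have meas: "{z \<in> space ?M. ennreal \<alpha> + of_nat m < integral\<^sup>N (fst z) (step_fun F) + integral\<^sup>N (snd z) (step_fun G)} \<in> sets ?M"
    if "F \<in> step_index" "G \<in> step_index" for m :: nat and F G
  proof -
    have [measurable]: "(\<lambda>P. integral\<^sup>N P (step_fun F)) \<in> borel_measurable (borel_of weak_topology)"
      "(\<lambda>Q. integral\<^sup>N Q (step_fun G)) \<in> borel_measurable (borel_of weak_topology)"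
      by (intro measurable_nn_integral_weak_topology measurable_step_fun that)+
    show ?thesis by measurable
  qed
  show ?thesis
    unfolding eq
  proof (intro sets.countable_UN'')
    show "countable {G \<in> step_index. ok m F G}" for m F
      by (rule countable_subset[OF _ countable_step_index]) blast
  qed (simp_all add: countable_step_index meas)
qed

section \<open>Semicontinuity of the transport cost in the weak topology\<close>

lemma openin_transport_cost_greater:
  fixes c :: "'a::polish_space \<times> 'b::polish_space \<Rightarrow> ennreal"
  assumes c: "lower_semicontinuous c" and \<alpha>: "0 \<le> \<alpha>"
  shows "openin (prod_topology weak_topology weak_topology)
    {(P, Q) \<in> prob_measures \<times> prob_measures. ennreal \<alpha> < transport_cost c P Q}"
proof -
  let ?X = "prod_topology weak_topology weak_topology :: ('a measure \<times> 'b measure) topology"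
  have sp: "topspace ?X = prob_measures \<times> prob_measures" by (simp add: topspace_weak_topology)
  define \<D> where "\<D> = {(\<phi> :: 'a \<Rightarrow> real, \<psi> :: 'b \<Rightarrow> real). continuous_on UNIV \<phi> \<and> bounded (range \<phi>) \<and>
    continuous_on UNIV \<psi> \<and> bounded (range \<psi>) \<and> (\<forall>x y. ennreal (\<phi> x + \<psi> y) \<le> c (x, y))}"
  have eq: "{(P, Q) \<in> prob_measures \<times> prob_measures. ennreal \<alpha> < transport_cost c P Q} =
    (\<Union>d\<in>\<D>. {z \<in> topspace ?X. integral\<^sup>L (fst z) (fst d) + integral\<^sup>L (snd z) (snd d) \<in> {\<alpha><..}})"
    (is "?L = ?R")
  proof (rule set_eqI)
    fix z show "z \<in> ?L \<longleftrightarrow> z \<in> ?R"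
    proof (cases "z \<in> topspace ?X")
      case True
      obtain P Q where z: "z = (P, Q)" by (cases z)
      have PQ: "P \<in> prob_measures" "Q \<in> prob_measures" using True unfolding z sp by auto
      have "z \<in> ?R \<longleftrightarrow> (\<exists>d\<in>\<D>. \<alpha> < integral\<^sup>L P (fst d) + integral\<^sup>L Q (snd d))"
        using True unfolding z by simp
      also have "\<dots> \<longleftrightarrow> ennreal \<alpha> < transport_cost c P Q"
        unfolding transport_cost_greater_iff[OF PQ c \<alpha>] \<D>_def by auto
      finally show ?thesis using PQ unfolding z by simp
    qed (auto simp: topspace_weak_topology)
  qed
  show ?thesis
    unfolding eq
  proof (rule openin_Union, elim imageE, hypsubst)
    fix d assume "d \<in> \<D>"
    define \<phi> \<psi> where "\<phi> = fst d" and "\<psi> = snd d"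
    have cont: "continuous_on UNIV \<phi>" "bounded (range \<phi>)" "continuous_on UNIV \<psi>" "bounded (range \<psi>)"
      using \<open>d \<in> \<D>\<close> unfolding \<D>_def \<phi>_def \<psi>_def by auto
    have "continuous_map ?X euclideanreal ((\<lambda>P. integral\<^sup>L P \<phi>) \<circ> fst)"
      "continuous_map ?X euclideanreal ((\<lambda>Q. integral\<^sup>L Q \<psi>) \<circ> snd)"
      using cont by (auto intro!: continuous_map_compose[OF continuous_map_fst]
        continuous_map_compose[OF continuous_map_snd] continuous_map_weak_integral)
    then have "continuous_map ?X euclideanreal (\<lambda>z. integral\<^sup>L (fst z) \<phi> + integral\<^sup>L (snd z) \<psi>)"
      by (intro continuous_map_add) (simp_all add: comp_def)
    then show "openin ?X {z \<in> topspace ?X. integral\<^sup>L (fst z) (fst d) + integral\<^sup>L (snd z) (snd d) \<in> {\<alpha><..}}"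
      unfolding \<phi>_def \<psi>_def by (rule openin_continuous_map_preimage) simp
  qed
qed

text \<open>The neighbourhood is the projection of a closed subset of the product of
  \<open>A\<close> with the space of laws, and projection along a compact factor is a closed map.
  Hence it is an event for the empirical law.\<close>

lemma closedin_transport_nbhd:
  fixes c :: "'a::polish_space \<times> 'b::polish_space \<Rightarrow> ennreal"
  assumes c: "lower_semicontinuous c" and \<alpha>: "0 \<le> \<alpha>" and A: "compactin weak_topology A"
  shows "closedin weak_topology (transport_nbhd c \<alpha> A)"
proof -
  let ?X = "prod_topology weak_topology weak_topology :: ('a measure \<times> 'b measure) topology"
  let ?gt = "{(P, Q) \<in> prob_measures \<times> prob_measures. ennreal \<alpha> < transport_cost c P Q}"
  have A_sub: "A \<subseteq> prob_measures" using compactin_subset_topspace[OF A] by (simp add: topspace_weak_topology)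
  have "closedin ?X (topspace ?X - ?gt)"
    by (intro closedin_diff closedin_topspace openin_transport_cost_greater c \<alpha>)
  then have "closedin (subtopology ?X (A \<times> topspace weak_topology)) ((A \<times> topspace weak_topology) \<inter> (topspace ?X - ?gt))"
    by (rule closedin_subtopology_Int_closed)
  then have "closedin (prod_topology (subtopology weak_topology A) weak_topology)
      ((A \<times> topspace weak_topology) \<inter> (topspace ?X - ?gt))"
    by (simp only: prod_topology_subtopology)
  then have "closedin weak_topology (snd ` ((A \<times> topspace weak_topology) \<inter> (topspace ?X - ?gt)))"
    using Abstract_Topological_Spaces.closed_map_snd[OF compact_space_subtopology[OF A], of weak_topology]
    unfolding closed_map_def by blast
  moreover have "snd ` ((A \<times> topspace weak_topology) \<inter> (topspace ?X - ?gt)) = transport_nbhd c \<alpha> A"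
  proof (intro set_eqI iffI)
    fix Q assume "Q \<in> snd ` ((A \<times> topspace weak_topology) \<inter> (topspace ?X - ?gt))"
    then obtain z where z: "z \<in> (A \<times> topspace weak_topology) \<inter> (topspace ?X - ?gt)" "Q = snd z" by blast
    define P where "P = fst z"
    have "z = (P, Q)" using z(2) by (simp add: P_def)
    then have "P \<in> A" "Q \<in> prob_measures" "(P, Q) \<notin> ?gt" using z(1) by (simp_all add: topspace_weak_topology)
    moreover have "P \<in> prob_measures" using \<open>P \<in> A\<close> A_sub by blast
    ultimately show "Q \<in> transport_nbhd c \<alpha> A" unfolding transport_nbhd_def by (auto simp: not_less)
  next
    fix Q assume "Q \<in> transport_nbhd c \<alpha> A"
    then obtain P where P: "P \<in> A" "Q \<in> prob_measures" "transport_cost c P Q \<le> ennreal \<alpha>"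
      unfolding transport_nbhd_def by blast
    then have "(P, Q) \<in> (A \<times> topspace weak_topology) \<inter> (topspace ?X - ?gt)"
      using A_sub by (auto simp: topspace_weak_topology)
    then show "Q \<in> snd ` ((A \<times> topspace weak_topology) \<inter> (topspace ?X - ?gt))" by (rule image_eqI[rotated]) simp
  qed
  ultimately show ?thesis by simp
qed

section \<open>Birkhoff's theorem and empirical measures\<close>

text \<open>Rado's proof of Hall's theorem: if some \<open>N i\<close> has two elements, one of them can be removed.\<close>

lemma hall_marriage:
  assumes "finite I" "\<And>i. i \<in> I \<Longrightarrow> finite (N i)"
    and "\<And>J. J \<subseteq> I \<Longrightarrow> card J \<le> card (\<Union>(N ` J))"
  shows "\<exists>f. inj_on f I \<and> (\<forall>i\<in>I. f i \<in> N i)"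
  using assms
proof (induction "\<Sum>i\<in>I. card (N i)" arbitrary: N rule: less_induct)
  case less
  note I = less.prems(1) and fin = less.prems(2) and hall = less.prems(3)
  show ?case
  proof (cases "\<exists>i\<in>I. \<exists>a\<in>N i. \<exists>b\<in>N i. a \<noteq> b")
    case False
    have "\<exists>a. N i = {a}" if i: "i \<in> I" for i
    proof -
      have "N i \<noteq> {}" using hall[of "{i}"] i by auto
      then show ?thesis using False i by blast
    qed
    then obtain f where f: "\<And>i. i \<in> I \<Longrightarrow> N i = {f i}" by metis
    have "inj_on f I"
    proof (rule inj_onI, rule ccontr)
      fix i j assume ij: "i \<in> I" "j \<in> I" "f i = f j" "i \<noteq> j"
      then show False using hall[of "{i, j}"] f by simp
    qed
    then show ?thesis using f by blast
  next
    case True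
    then obtain i a b where i: "i \<in> I" and ab: "a \<in> N i" "b \<in> N i" "a \<noteq> b" by blast
    have removable: "\<exists>f. inj_on f I \<and> (\<forall>i\<in>I. f i \<in> N i)"
      if a: "a \<in> N i" and h: "\<And>J. J \<subseteq> I \<Longrightarrow> card J \<le> card (\<Union>((N(i := N i - {a})) ` J))" for a
    proof -
      have "(\<Sum>k\<in>I. card ((N(i := N i - {a})) k)) < (\<Sum>k\<in>I. card (N k))"
      proof (rule sum_strict_mono_ex1[OF I])
        show "\<forall>k\<in>I. card ((N(i := N i - {a})) k) \<le> card (N k)"
          using fin i by (auto intro!: card_mono)
        have "card (N i - {a}) < card (N i)" by (rule card_Diff1_less[OF fin[OF i] a])
        then show "\<exists>k\<in>I. card ((N(i := N i - {a})) k) < card (N k)"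
          using i by (metis fun_upd_same)
      qed
      then have "\<exists>f. inj_on f I \<and> (\<forall>k\<in>I. f k \<in> (N(i := N i - {a})) k)"
        using fin by (intro less.hyps I h) auto
      then obtain f where f: "inj_on f I" "\<And>k. k \<in> I \<Longrightarrow> f k \<in> (N(i := N i - {a})) k" by blast
      have "f k \<in> N k" if "k \<in> I" for k using f(2)[OF that] by (cases "k = i") auto
      then show ?thesis using f(1) by blast
    qed
    \<comment> \<open>After the removal, Hall's condition can fail only for index sets that contain
      \<open>i\<close>; \<open>K\<close> is such a set without \<open>i\<close>, which turns the
      strict inequality into a weak one.\<close>
    have violating: "\<exists>K. K \<subseteq> I \<and> i \<notin> K \<and> card (\<Union>(N ` K) \<union> (N i - {a})) \<le> card K"
      if "\<not> (\<forall>J. J \<subseteq> I \<longrightarrow> card J \<le> card (\<Union>((N(i := N i - {a})) ` J)))" for a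
    proof -
      from that obtain J where J: "J \<subseteq> I" "card (\<Union>((N(i := N i - {a})) ` J)) < card J"
        by (auto simp: not_le)
      have "i \<in> J"
      proof (rule ccontr)
        assume "i \<notin> J"
        then have "(N(i := N i - {a})) ` J = N ` J" by (auto simp: image_iff)
        then show False using J hall[OF J(1)] by simp
      qed
      then have "\<Union>((N(i := N i - {a})) ` J) = \<Union>(N ` (J - {i})) \<union> (N i - {a})"
        by (auto split: if_splits)
      moreover have "card J = Suc (card (J - {i}))"
        using \<open>i \<in> J\<close> J(1) I by (meson card.remove finite_subset)
      ultimately show ?thesis using J by (intro exI[of _ "J - {i}"]) auto
    qed
    show ?thesis
    proof (rule ccontr)
      assume none: "\<not> ?thesis"
      obtain K where K: "K \<subseteq> I" "i \<notin> K" "card (\<Union>(N ` K) \<union> (N i - {a})) \<le> card K"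
        using violating[of a] removable[OF ab(1)] none by blast
      obtain L where L: "L \<subseteq> I" "i \<notin> L" "card (\<Union>(N ` L) \<union> (N i - {b})) \<le> card L"
        using violating[of b] removable[OF ab(2)] none by blast
      \<comment> \<open>Since \<open>a \<noteq> b\<close>, the union of \<open>X\<close> and
        \<open>Y\<close> is the neighbourhood of \<open>K\<close>, \<open>L\<close> and
        \<open>i\<close> together, while their intersection contains that of
        \<open>K \<inter> L\<close>. Hall's condition for both gives
        \<open>card X + card Y > card K + card L\<close>, contrary to the choice of \<open>K\<close>
        and \<open>L\<close>.\<close>
      define X where "X = \<Union>(N ` K) \<union> (N i - {a})"
      define Y where "Y = \<Union>(N ` L) \<union> (N i - {b})"
      have finKL: "finite K" "finite L" using K L I finite_subset by blast+
      have finXY: "finite X" "finite Y" using K L I fin i finKL unfolding X_def Y_def by auto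
      have "X \<union> Y = \<Union>(N ` insert i (K \<union> L))" unfolding X_def Y_def using ab by auto
      then have "card (insert i (K \<union> L)) \<le> card (X \<union> Y)" using hall[of "insert i (K \<union> L)"] K L i by simp
      moreover have "card (K \<inter> L) \<le> card (X \<inter> Y)"
      proof -
        have "card (K \<inter> L) \<le> card (\<Union>(N ` (K \<inter> L)))" using K by (intro hall) blast
        also have "\<dots> \<le> card (X \<inter> Y)" using finXY unfolding X_def Y_def by (intro card_mono) auto
        finally show ?thesis .
      qed
      moreover have "card (insert i (K \<union> L)) = Suc (card (K \<union> L))" using K L finKL by simp
      moreover have "card K + card L = card (K \<union> L) + card (K \<inter> L)" by (rule card_Un_Int[OF finKL])
      moreover have "card X + card Y = card (X \<union> Y) + card (X \<inter> Y)" by (rule card_Un_Int[OF finXY])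
      ultimately show False using K(3) L(3) unfolding X_def[symmetric] Y_def[symmetric] by linarith
    qed
  qed
qed

text \<open>Hall's condition by double counting: the rows in \<open>J\<close> carry mass
  \<open>card J * s\<close>, all of it in the columns that they meet, and these columns have mass
  \<open>s\<close> each. The common sum \<open>s\<close> is left general for the remainders that
  arise when permutations are peeled off.\<close>

lemma permutation_in_support:
  fixes M :: "nat \<Rightarrow> nat \<Rightarrow> real"
  assumes nonneg: "\<And>i j. i < n \<Longrightarrow> j < n \<Longrightarrow> 0 \<le> M i j"
    and row: "\<And>i. i < n \<Longrightarrow> (\<Sum>j<n. M i j) = s" and col: "\<And>j. j < n \<Longrightarrow> (\<Sum>i<n. M i j) = s" and s: "0 < s"
  obtains \<sigma> where "\<sigma> permutes {..<n}" "\<And>i. i < n \<Longrightarrow> 0 < M i (\<sigma> i)"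
proof -
  define N where "N i = {j. j < n \<and> 0 < M i j}" for i
  have "card J \<le> card (\<Union>(N ` J))" if J: "J \<subseteq> {..<n}" for J
  proof -
    have "real (card J) * s = (\<Sum>i\<in>J. \<Sum>j<n. M i j)" using J row by (simp add: subset_iff)
    also have "\<dots> = (\<Sum>i\<in>J. \<Sum>j\<in>\<Union>(N ` J). M i j)"
    proof (rule sum.cong[OF refl])
      fix i assume i: "i \<in> J"
      show "(\<Sum>j<n. M i j) = (\<Sum>j\<in>\<Union>(N ` J). M i j)"
        using i J nonneg unfolding N_def by (intro sum.mono_neutral_right) (auto simp: order_le_less)
    qed
    also have "\<dots> = (\<Sum>j\<in>\<Union>(N ` J). \<Sum>i\<in>J. M i j)" by (rule sum.swap)
    also have "\<dots> \<le> (\<Sum>j\<in>\<Union>(N ` J). \<Sum>i<n. M i j)"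
      using J nonneg unfolding N_def by (intro sum_mono sum_mono2) auto
    also have "\<dots> = real (card (\<Union>(N ` J))) * s" using col unfolding N_def by simp
    finally show ?thesis using s by simp
  qed
  then obtain f where f: "inj_on f {..<n}" "\<forall>i\<in>{..<n}. f i \<in> N i"
    using hall_marriage[of "{..<n}" N] unfolding N_def by auto
  define \<sigma> where "\<sigma> i = (if i < n then f i else i)" for i
  have "f ` {..<n} = {..<n}" using f by (intro endo_inj_surj) (auto simp: N_def)
  then have "bij_betw f {..<n} {..<n}" using f(1) by (simp add: bij_betw_def)
  then have "bij_betw \<sigma> {..<n} {..<n}" by (subst bij_betw_cong[of _ \<sigma> f]) (auto simp: \<sigma>_def)
  then have "\<sigma> permutes {..<n}" by (intro bij_imp_permutes) (auto simp: \<sigma>_def)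
  moreover have "0 < M i (\<sigma> i)" if "i < n" for i using f(2) that by (auto simp: \<sigma>_def N_def)
  ultimately show thesis by (rule that)
qed

text \<open>Birkhoff's theorem in the form of a greedy decomposition: peel off permutations from the
  support, keeping the cheapest one.\<close>

lemma cheap_permutation:
  fixes M :: "nat \<Rightarrow> nat \<Rightarrow> real" and C :: "nat \<Rightarrow> nat \<Rightarrow> ennreal"
  assumes "\<And>i j. i < n \<Longrightarrow> j < n \<Longrightarrow> 0 \<le> M i j"
    and "\<And>i. i < n \<Longrightarrow> (\<Sum>j<n. M i j) = s" and "\<And>j. j < n \<Longrightarrow> (\<Sum>i<n. M i j) = s" and "0 \<le> s"
  shows "\<exists>\<sigma>. \<sigma> permutes {..<n} \<and> ennreal s * (\<Sum>i<n. C i (\<sigma> i)) \<le> (\<Sum>i<n. \<Sum>j<n. ennreal (M i j) * C i j)"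
  using assms
proof (induction "card {(i, j). i < n \<and> j < n \<and> M i j \<noteq> 0}" arbitrary: M s rule: less_induct)
  case less
  note nonneg = less.prems(1) and row = less.prems(2) and col = less.prems(3)
  show ?case
  proof (cases "s = 0 \<or> n = 0")
    case True
    then show ?thesis by (auto intro!: exI[of _ id] permutes_id)
  next
    case False
    then have s: "0 < s" and n: "0 < n" using less.prems(4) by auto
    obtain \<sigma> where \<sigma>: "\<sigma> permutes {..<n}" "\<And>i. i < n \<Longrightarrow> 0 < M i (\<sigma> i)"
      using permutation_in_support[OF nonneg row col s] by blast
    have \<sigma>_lt: "\<sigma> i < n" if "i < n" for i using permutes_in_image[OF \<sigma>(1), of i] that by simp
    \<comment> \<open>The smallest entry along \<open>\<sigma>\<close> is the largest amount that
      can be subtracted with nonnegative remainder; it annihilates at least one entry, so the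
      support shrinks.\<close>
    define e where "e = Min ((\<lambda>i. M i (\<sigma> i)) ` {..<n})"
    have "e \<in> (\<lambda>i. M i (\<sigma> i)) ` {..<n}" unfolding e_def using n by (intro Min_in) auto
    then obtain k where k: "k < n" "e = M k (\<sigma> k)" by auto
    have e: "0 < e" using k \<sigma>(2) by simp
    have e_le: "e \<le> M i (\<sigma> i)" if "i < n" for i unfolding e_def using that by (intro Min_le) auto
    have "e \<le> s"
      unfolding row[OF k(1), symmetric] k(2) using nonneg k \<sigma>_lt by (intro member_le_sum) auto
    define M' where "M' i j = M i j - (if j = \<sigma> i then e else 0)" for i j
    have "\<exists>\<tau>. \<tau> permutes {..<n} \<and> ennreal (s - e) * (\<Sum>i<n. C i (\<tau> i)) \<le> (\<Sum>i<n. \<Sum>j<n. ennreal (M' i j) * C i j)"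
    proof (rule less.hyps)
      show "0 \<le> M' i j" if "i < n" "j < n" for i j using nonneg[OF that] e_le[OF that(1)] by (auto simp: M'_def)
      show "(\<Sum>j<n. M' i j) = s - e" if "i < n" for i
        using that row \<sigma>_lt by (simp add: M'_def sum_subtractf)
      show "(\<Sum>i<n. M' i j) = s - e" if j: "j < n" for j
      proof -
        have "(\<Sum>i<n. if j = \<sigma> i then e else 0) = (\<Sum>i<n. if inv \<sigma> j = i then e else 0)"
          using permutes_inverses[OF \<sigma>(1)] by (intro sum.cong refl) (auto; metis)
        also have "\<dots> = e" using permutes_in_image[OF permutes_inv[OF \<sigma>(1)], of j] j by simp
        finally show ?thesis using col[OF j] by (simp add: M'_def sum_subtractf)
      qed
      show "0 \<le> s - e" using \<open>e \<le> s\<close> by simp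
      show "card {(i, j). i < n \<and> j < n \<and> M' i j \<noteq> 0} < card {(i, j). i < n \<and> j < n \<and> M i j \<noteq> 0}"
      proof (rule psubset_card_mono)
        show "finite {(i, j). i < n \<and> j < n \<and> M i j \<noteq> 0}"
          by (rule finite_subset[of _ "{..<n} \<times> {..<n}"]) auto
        have "(k, \<sigma> k) \<in> {(i, j). i < n \<and> j < n \<and> M i j \<noteq> 0}" "(k, \<sigma> k) \<notin> {(i, j). i < n \<and> j < n \<and> M' i j \<noteq> 0}"
          using k e \<sigma>_lt by (auto simp: M'_def)
        moreover have "{(i, j). i < n \<and> j < n \<and> M' i j \<noteq> 0} \<subseteq> {(i, j). i < n \<and> j < n \<and> M i j \<noteq> 0}"
          using \<sigma>(2) by (force simp: M'_def split: if_splits)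
        ultimately show "{(i, j). i < n \<and> j < n \<and> M' i j \<noteq> 0} \<subset> {(i, j). i < n \<and> j < n \<and> M i j \<noteq> 0}" by blast
      qed
    qed
    then obtain \<tau> where \<tau>: "\<tau> permutes {..<n}"
      "ennreal (s - e) * (\<Sum>i<n. C i (\<tau> i)) \<le> (\<Sum>i<n. \<Sum>j<n. ennreal (M' i j) * C i j)" by blast
    let ?A = "\<Sum>i<n. C i (\<sigma> i)" and ?B = "\<Sum>i<n. C i (\<tau> i)"
    have "(\<Sum>j<n. ennreal (M i j) * C i j) = (\<Sum>j<n. ennreal (M' i j) * C i j) + ennreal e * C i (\<sigma> i)" if i: "i < n" for i
    proof -
      have "ennreal (M i j) * C i j = ennreal (M' i j) * C i j + (if \<sigma> i = j then ennreal e * C i j else 0)" if j: "j < n" for j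
      proof (cases "j = \<sigma> i")
        case True
        then have "M i j = M' i j + e" "0 \<le> M' i j" using e_le[OF i] by (auto simp: M'_def)
        then show ?thesis using True e by (simp add: ennreal_plus distrib_right)
      qed (auto simp: M'_def)
      then have "(\<Sum>j<n. ennreal (M i j) * C i j) = (\<Sum>j<n. ennreal (M' i j) * C i j + (if \<sigma> i = j then ennreal e * C i j else 0))"
        by (intro sum.cong) auto
      then show ?thesis using \<sigma>_lt[OF i] by (simp add: sum.distrib)
    qed
    then have total: "(\<Sum>i<n. \<Sum>j<n. ennreal (M i j) * C i j) = (\<Sum>i<n. \<Sum>j<n. ennreal (M' i j) * C i j) + ennreal e * ?A"
      by (simp add: sum.distrib sum_distrib_left)
    have split: "ennreal s * D = ennreal (s - e) * D + ennreal e * D" for D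
      using \<open>e \<le> s\<close> e by (subst distrib_right[symmetric], subst ennreal_plus[symmetric]) auto
    show ?thesis
    \<comment> \<open>The total cost is at least \<open>(s - e) * ?B + e * ?A\<close>, hence at
      least \<open>s\<close> times the smaller of the two.\<close>
    proof (cases "?A \<le> ?B")
      case True
      have "ennreal s * ?A \<le> ennreal (s - e) * ?B + ennreal e * ?A"
        unfolding split using True by (intro add_right_mono mult_left_mono) auto
      also have "\<dots> \<le> (\<Sum>i<n. \<Sum>j<n. ennreal (M i j) * C i j)"
        unfolding total by (intro add_right_mono \<tau>(2))
      finally show ?thesis using \<sigma>(1) by blast
    next
      case False
      have "ennreal s * ?B \<le> ennreal (s - e) * ?B + ennreal e * ?A"
        unfolding split using False by (intro add_left_mono mult_left_mono) auto
      also have "\<dots> \<le> (\<Sum>i<n. \<Sum>j<n. ennreal (M i j) * C i j)"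
        unfolding total by (intro add_right_mono \<tau>(2))
      finally show ?thesis using \<tau>(1) by blast
    qed
  qed
qed

text \<open>Weights reciprocal to multiplicities convert a sum over indices into a sum over distinct
  values. The semiring setting serves both the real marginals and the \<open>ennreal\<close>
  costs.\<close>

lemma sum_over_fibres:
  fixes g w :: "'b \<Rightarrow> 'c::comm_semiring_1"
  assumes "finite I" and w: "\<And>a. a \<in> x ` I \<Longrightarrow> of_nat (card {i\<in>I. x i = a}) * w a = 1"
  shows "(\<Sum>i\<in>I. w (x i) * g (x i)) = (\<Sum>a\<in>x ` I. g a)"
proof -
  have "(\<Sum>i\<in>I. w (x i) * g (x i)) = (\<Sum>a\<in>x ` I. \<Sum>i\<in>{i\<in>I. x i = a}. w (x i) * g (x i))"
    by (rule sum.image_gen[OF assms(1)])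
  also have "\<dots> = (\<Sum>a\<in>x ` I. of_nat (card {i\<in>I. x i = a}) * w a * g a)"
    by (intro sum.cong refl) (simp add: mult.assoc)
  also have "\<dots> = (\<Sum>a\<in>x ` I. g a)" by (intro sum.cong refl) (simp add: w)
  finally show ?thesis .
qed

section \<open>Empirical measures and optimal matchings\<close>

lemma empirical_measure_eq_distr:
  fixes x :: "nat \<Rightarrow> 'a::topological_space"
  assumes n: "1 \<le> n"
  shows "empirical_measure n x = distr (measure_pmf (pmf_of_set {..<n})) borel x"
proof -
  let ?D = "distr (measure_pmf (pmf_of_set {..<n})) borel x"
  have ne: "{..<n} \<noteq> {}" using n by (simp add: lessThan_empty_iff)
  have "empirical_measure n x = measure_of UNIV (sets borel) (emeasure ?D)"
    unfolding empirical_measure_def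
  proof (rule measure_of_eq)
    fix A :: "'a set" assume "A \<in> sigma_sets UNIV (sets borel)"
    then have A: "A \<in> sets borel" using sets.sigma_sets_eq[of "borel :: 'a measure"] by simp
    have "emeasure ?D A = (\<integral>\<^sup>+ a. indicator A a \<partial>?D)" using A by simp
    also have "\<dots> = (\<integral>\<^sup>+ i. indicator A (x i) \<partial>measure_pmf (pmf_of_set {..<n}))"
      using A by (subst nn_integral_distr) auto
    also have "\<dots> = (\<Sum>i<n. indicator A (x i)) / of_nat n"
      using ne by (simp add: nn_integral_pmf_of_set ennreal_of_nat_eq_real_of_nat)
    finally show "(\<Sum>i<n. emeasure (return borel (x i)) A) / of_nat n = emeasure ?D A" using A by simp
  qed simp
  also have "\<dots> = ?D" using measure_of_of_measure[of ?D] by simp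
  finally show ?thesis .
qed

context
  fixes n :: nat
  assumes n: "1 \<le> n"
begin

lemma empirical_measure_prob: "empirical_measure n x \<in> prob_measures"
  unfolding empirical_measure_eq_distr[OF n] space_prob_algebra
  by (simp add: measure_pmf.prob_space_distr)

lemma integral_empirical_measure:
  fixes f :: "'a::topological_space \<Rightarrow> real"
  assumes "f \<in> borel_measurable borel"
  shows "integral\<^sup>L (empirical_measure n x) f = (\<Sum>i<n. f (x i)) / n"
proof -
  have "{..<n} \<noteq> {}" using n by (simp add: lessThan_empty_iff)
  then show ?thesis unfolding empirical_measure_eq_distr[OF n]
    using assms by (simp add: integral_distr integral_pmf_of_set)
qed

lemma measure_empirical_measure:
  assumes A: "A \<in> sets borel"
  shows "measure (empirical_measure n x) A = card {i. i < n \<and> x i \<in> A} / n"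
proof -
  have ne: "{..<n} \<noteq> {}" using n by (simp add: lessThan_empty_iff)
  have "{..<n} \<inter> x -` A = {i. i < n \<and> x i \<in> A}" by auto
  then show ?thesis unfolding empirical_measure_eq_distr[OF n]
    using A ne by (simp add: measure_distr measure_pmf_of_set)
qed

text \<open>The uniform law on the pairs \<open>(x i, y i)\<close> is a coupling with cost
  \<open>cost_n n c x y\<close>.\<close>

lemma transport_cost_empirical_le:
  fixes c :: "'a::second_countable_topology \<times> 'b::second_countable_topology \<Rightarrow> ennreal"
  assumes c: "lower_semicontinuous c"
  shows "transport_cost c (empirical_measure n x) (empirical_measure n y) \<le> cost_n n c x y"
proof -
  let ?U = "measure_pmf (pmf_of_set {..<n})"
  let ?R = "distr ?U borel (\<lambda>i. (x i, y i))"
  have ne: "{..<n} \<noteq> {}" using n by (simp add: lessThan_empty_iff)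
  have sT: "sets (empirical_measure n x) = sets borel" "sets (empirical_measure n y) = sets borel"
    using prob_measuresD(2)[OF empirical_measure_prob] by blast+
  have fst_m: "fst \<in> measurable (borel :: ('a \<times> 'b) measure) borel"
    and snd_m: "snd \<in> measurable (borel :: ('a \<times> 'b) measure) borel"
    by (intro borel_measurable_continuous_onI continuous_intros)+
  have "distr ?R (empirical_measure n x) fst = empirical_measure n x"
    by (subst distr_cong[OF refl sT(1) refl]) (simp add: distr_distr fst_m comp_def empirical_measure_eq_distr[OF n])
  moreover have "distr ?R (empirical_measure n y) snd = empirical_measure n y"
    by (subst distr_cong[OF refl sT(2) refl]) (simp add: distr_distr snd_m comp_def empirical_measure_eq_distr[OF n])
  ultimately have "?R \<in> couplings (empirical_measure n x) (empirical_measure n y)"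
    unfolding couplings_def using sets_pair_borel[OF sT] by (simp add: measure_pmf.prob_space_distr)
  then have "transport_cost c (empirical_measure n x) (empirical_measure n y) \<le> (\<integral>\<^sup>+ z. c z \<partial>?R)"
    unfolding transport_cost_def by (rule INF_lower)
  also have "\<dots> = (\<integral>\<^sup>+ i. c (x i, y i) \<partial>?U)"
    by (subst nn_integral_distr) (auto simp: borel_measurable_lower_semicontinuous[OF c])
  also have "\<dots> = cost_n n c x y"
    unfolding cost_n_def using ne by (simp add: nn_integral_pmf_of_set ennreal_of_nat_eq_real_of_nat)
  finally show ?thesis .
qed

text \<open>A coupling of empirical measures lives on finitely many points, but sample points may
  repeat. The mass of a point \<open>(a, b)\<close> is split evenly among the index pairs
  \<open>i\<close>, \<open>j\<close> with \<open>x i = a\<close> and \<open>y j = b\<close>. The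
  resulting matrix has all row and column sums \<open>1 / n\<close>, and the Birkhoff argument
  extracts a permutation no more expensive than the coupling.\<close>

lemma cheap_matching:
  fixes c :: "'a::polish_space \<times> 'b::polish_space \<Rightarrow> ennreal"
  assumes R: "R \<in> couplings (empirical_measure n x) (empirical_measure n y)"
  shows "\<exists>\<sigma>. \<sigma> permutes {..<n} \<and> cost_n n c x (y \<circ> \<sigma>) \<le> (\<integral>\<^sup>+ z. c z \<partial>R)"
proof -
  let ?P = "empirical_measure n x" and ?Q = "empirical_measure n y"
  have sP: "sets ?P = sets borel" "space ?P = UNIV" and sQ: "sets ?Q = sets borel" "space ?Q = UNIV"
    using prob_measuresD(2,3)[OF empirical_measure_prob] by blast+
  have sR: "sets R = sets borel" using couplingsD(2)[OF R] sets_pair_borel[OF sP(1) sQ(1)] by simp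
  interpret R: prob_space R by (rule couplingsD[OF R])
  have spR: "space R = UNIV" using sets_eq_imp_space_eq[OF sR] by simp
  have R_fst: "measure R (A \<times> UNIV) = measure ?P A" if "A \<in> sets borel" for A
    using coupling_marginals(1)[OF R, of A] that sP spR by (simp add: vimage_fst)
  have R_snd: "measure R (UNIV \<times> B) = measure ?Q B" if "B \<in> sets borel" for B
    using coupling_marginals(2)[OF R, of B] that sQ spR by (simp add: vimage_snd)
  define X where "X = x ` {..<n}"
  define Y where "Y = y ` {..<n}"
  have fin: "finite X" "finite Y" unfolding X_def Y_def by auto
  have rect: "A \<times> B \<in> sets R" if "A \<in> sets borel" "B \<in> sets borel" for A B
    using that unfolding sR by (simp flip: borel_prod)
  have point: "{z} \<in> sets R" for z :: "'a \<times> 'b" unfolding sR by simp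
  have null_snd: "measure R (UNIV \<times> (- Y)) = 0"
    using R_snd[of "- Y"] measure_empirical_measure[of "- Y" y] fin by (simp add: Y_def finite_imp_closed)
  have null_fst: "measure R ((- X) \<times> UNIV) = 0"
    using R_fst[of "- X"] measure_empirical_measure[of "- X" x] fin by (simp add: X_def finite_imp_closed)
  \<comment> \<open>\<open>E\<close> is a row or column strip, \<open>S\<close> its finite part in
    \<open>X \<times> Y\<close>, and \<open>N\<close> a null set containing the rest.\<close>
  have slice: "measure R E = (\<Sum>z\<in>S. measure R {z})"
    if E: "E \<in> sets R" "S \<subseteq> E" "E \<subseteq> S \<union> N" and N: "N \<in> sets R" "measure R N = 0" and S: "finite S" for E S N
  proof -
    have "S \<in> sets R" using S unfolding sR by (simp add: finite_imp_closed)
    then have "measure R E \<le> measure R S" "measure R S \<le> measure R E"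
      using R.finite_measure_mono[OF E(3)] measure_Un_le[of S R N] R.finite_measure_mono[OF E(2,1)] N by auto
    then show ?thesis using R.finite_measure_eq_sum_singleton[OF S] point by simp
  qed
  have row_sum: "(\<Sum>b\<in>Y. measure R {(a, b)}) = measure ?P {a}" for a
  proof -
    have "(\<Sum>b\<in>Y. measure R {(a, b)}) = (\<Sum>z\<in>{a} \<times> Y. measure R {z})"
      using sum.cartesian_product[of "\<lambda>a b. measure R {(a, b)}" Y "{a}"] by (simp add: case_prod_beta)
    also have "\<dots> = measure R ({a} \<times> UNIV)"
      using null_snd fin by (intro slice[symmetric, where N = "UNIV \<times> (- Y)"] rect) (auto simp: finite_imp_closed)
    finally show ?thesis using R_fst[of "{a}"] by simp
  qed
  have col_sum: "(\<Sum>a\<in>X. measure R {(a, b)}) = measure ?Q {b}" for b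
  proof -
    have "(\<Sum>a\<in>X. measure R {(a, b)}) = (\<Sum>z\<in>X \<times> {b}. measure R {z})"
      using sum.cartesian_product[of "\<lambda>a b. measure R {(a, b)}" "{b}" X] by (simp add: case_prod_beta)
    also have "\<dots> = measure R (UNIV \<times> {b})"
      using null_fst fin by (intro slice[symmetric, where N = "(- X) \<times> UNIV"] rect) (auto simp: finite_imp_closed)
    finally show ?thesis using R_snd[of "{b}"] by simp
  qed
  define mx where "mx a = real (card {k\<in>{..<n}. x k = a})" for a
  define my where "my b = real (card {k\<in>{..<n}. y k = b})" for b
  define wx where "wx a = 1 / mx a" for a
  define wy where "wy b = 1 / my b" for b
  have pos: "a \<in> X \<Longrightarrow> 0 < mx a" "b \<in> Y \<Longrightarrow> 0 < my b" for a b
    unfolding mx_def my_def X_def Y_def by (auto simp: card_gt_0_iff)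
  have wx: "real (card {k\<in>{..<n}. x k = a}) * wx a = 1" if "a \<in> X" for a
    using pos(1)[OF that] unfolding mx_def[symmetric] wx_def by simp
  have wy: "real (card {k\<in>{..<n}. y k = b}) * wy b = 1" if "b \<in> Y" for b
    using pos(2)[OF that] unfolding my_def[symmetric] wy_def by simp
  have ennreal_w: "of_nat m * ennreal w = 1" if "real m * w = 1" for m w
    using that by (metis ennreal_1 ennreal_mult' ennreal_of_nat_eq_real_of_nat of_nat_0_le_iff)
  define M where "M i j = wx (x i) * (wy (y j) * measure R {(x i, y j)})" for i j
  have "\<exists>\<sigma>. \<sigma> permutes {..<n} \<and> ennreal (1 / n) * (\<Sum>i<n. c (x i, y (\<sigma> i))) \<le> (\<Sum>i<n. \<Sum>j<n. ennreal (M i j) * c (x i, y j))"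
  proof (rule cheap_permutation)
    show "0 \<le> M i j" for i j by (simp add: M_def wx_def wy_def mx_def my_def)
    show "(\<Sum>j<n. M i j) = 1 / n" if i: "i < n" for i
    proof -
      have "(\<Sum>j<n. M i j) = wx (x i) * (\<Sum>j<n. wy (y j) * measure R {(x i, y j)})"
        by (simp add: M_def sum_distrib_left)
      also have "(\<Sum>j<n. wy (y j) * measure R {(x i, y j)}) = measure ?P {x i}"
        unfolding row_sum[symmetric] Y_def
        using wy by (intro sum_over_fibres[where g = "\<lambda>b. measure R {(x i, b)}"]) (simp_all add: Y_def)
      also have "measure ?P {x i} = mx (x i) / n"
        using measure_empirical_measure[of "{x i}" x] by (simp add: mx_def)
      also have "wx (x i) * (mx (x i) / n) = 1 / n" using pos(1)[of "x i"] i by (simp add: wx_def X_def)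
      finally show ?thesis .
    qed
    show "(\<Sum>i<n. M i j) = 1 / n" if j: "j < n" for j
    proof -
      have "(\<Sum>i<n. M i j) = wy (y j) * (\<Sum>i<n. wx (x i) * measure R {(x i, y j)})"
        by (simp add: M_def sum_distrib_left mult.left_commute)
      also have "(\<Sum>i<n. wx (x i) * measure R {(x i, y j)}) = measure ?Q {y j}"
        unfolding col_sum[symmetric] X_def
        using wx by (intro sum_over_fibres[where g = "\<lambda>a. measure R {(a, y j)}"]) (simp_all add: X_def)
      also have "measure ?Q {y j} = my (y j) / n"
        using measure_empirical_measure[of "{y j}" y] by (simp add: my_def)
      also have "wy (y j) * (my (y j) / n) = 1 / n" using pos(2)[of "y j"] j by (simp add: wy_def Y_def)
      finally show ?thesis .
    qed
  qed simp
  then obtain \<sigma> where \<sigma>: "\<sigma> permutes {..<n}"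
    and le: "ennreal (1 / n) * (\<Sum>i<n. c (x i, y (\<sigma> i))) \<le> (\<Sum>i<n. \<Sum>j<n. ennreal (M i j) * c (x i, y j))" by blast
  have "(\<Sum>i<n. \<Sum>j<n. ennreal (M i j) * c (x i, y j))
      = (\<Sum>i<n. ennreal (wx (x i)) * (\<Sum>j<n. ennreal (wy (y j)) * (emeasure R {(x i, y j)} * c (x i, y j))))"
  proof -
    have "ennreal (M i j) = ennreal (wx (x i)) * (ennreal (wy (y j)) * emeasure R {(x i, y j)})" for i j
      by (simp add: M_def R.emeasure_eq_measure wx_def wy_def mx_def my_def flip: ennreal_mult)
    then show ?thesis by (simp add: sum_distrib_left mult.assoc)
  qed
  also have "\<dots> = (\<Sum>i<n. ennreal (wx (x i)) * (\<Sum>b\<in>Y. emeasure R {(x i, b)} * c (x i, b)))"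
    unfolding Y_def using ennreal_w[OF wy]
    by (subst sum_over_fibres[where g = "\<lambda>b. emeasure R {(x _, b)} * c (x _, b)"]) (simp_all add: Y_def)
  also have "\<dots> = (\<Sum>a\<in>X. \<Sum>b\<in>Y. emeasure R {(a, b)} * c (a, b))"
    unfolding X_def using ennreal_w[OF wx]
    by (subst sum_over_fibres[where g = "\<lambda>a. \<Sum>b\<in>Y. emeasure R {(a, b)} * c (a, b)"]) (simp_all add: X_def)
  also have "\<dots> = (\<Sum>z\<in>X \<times> Y. c z * emeasure R {z})" by (simp add: sum.cartesian_product mult.commute case_prod_beta)
  also have "\<dots> = (\<integral>\<^sup>+ w. (\<Sum>z\<in>X \<times> Y. c z * indicator {z} w) \<partial>R)"
    using point by (subst nn_integral_sum) (auto simp: nn_integral_cmult_indicator)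
  also have "\<dots> \<le> (\<integral>\<^sup>+ w. c w \<partial>R)"
  proof (rule nn_integral_mono)
    fix w
    have "(\<Sum>z\<in>X \<times> Y. c z * indicator {z} w) = (\<Sum>z\<in>X \<times> Y. if w = z then c z else 0)"
      by (intro sum.cong) (auto simp: indicator_def)
    also have "\<dots> \<le> c w" using fin by (simp add: sum.delta)
    finally show "(\<Sum>z\<in>X \<times> Y. c z * indicator {z} w) \<le> c w" .
  qed
  finally have "ennreal (1 / n) * (\<Sum>i<n. c (x i, y (\<sigma> i))) \<le> (\<integral>\<^sup>+ w. c w \<partial>R)" by (rule order_trans[OF le])
  moreover have "ennreal (1 / n) * (\<Sum>i<n. c (x i, y (\<sigma> i))) = cost_n n c x (y \<circ> \<sigma>)"
  proof -
    have "ennreal (1 / n) = inverse (of_nat n)"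
      using n by (simp add: ennreal_of_nat_eq_real_of_nat inverse_ennreal divide_inverse)
    then show ?thesis unfolding cost_n_def by (simp add: divide_ennreal_def mult.commute)
  qed
  ultimately show ?thesis using \<sigma> by auto
qed

text \<open>An optimal coupling exists and costs at least as much as some matching, so the bound
  stays strict in passing from matchings to couplings. Strictness is what separated sets
  require.\<close>

lemma transport_cost_empirical_greater:
  fixes c :: "'a::polish_space \<times> 'b::polish_space \<Rightarrow> ennreal"
  assumes c: "lower_semicontinuous c"
    and gt: "\<And>\<sigma>. \<sigma> permutes {..<n} \<Longrightarrow> a < cost_n n c x (y \<circ> \<sigma>)"
  shows "a < transport_cost c (empirical_measure n x) (empirical_measure n y)"
proof -
  obtain R where "R \<in> couplings (empirical_measure n x) (empirical_measure n y)"
    "(\<integral>\<^sup>+ z. c z \<partial>R) = transport_cost c (empirical_measure n x) (empirical_measure n y)"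
    using transport_cost_attained[OF empirical_measure_prob empirical_measure_prob c] by blast
  with cheap_matching[of R x y c] gt show ?thesis by (metis order.strict_trans2)
qed

lemma continuous_empirical_measure:
  "continuous_map euclidean weak_topology (empirical_measure n :: (nat \<Rightarrow> 'a::polish_space) \<Rightarrow> 'a measure)"
proof (rule continuous_map_weak_topology)
  fix f :: "'a \<Rightarrow> real" assume f: "continuous_on UNIV f" "bounded (range f)"
  have "continuous_on UNIV (\<lambda>x :: nat \<Rightarrow> 'a. (\<Sum>i<n. f (x i)) / n)"
    using n by (intro continuous_intros continuous_on_compose2[OF f(1)] continuous_on_product_coordinates) auto
  then show "continuous_map euclidean euclideanreal (\<lambda>x. integral\<^sup>L (empirical_measure n x) f)"
    using f by (simp add: integral_empirical_measure borel_measurable_continuous_onI)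
qed (rule empirical_measure_prob)

end

section \<open>Level sets and symmetrization of dual potentials\<close>

text \<open>For the indicator of \<open>U\<close> a dual pair can be replaced by a pair of sets.
  After normalization the dual value is at most the integral of \<open>f\<close> minus that of
  \<open>g\<close>, with \<open>f\<close> and \<open>g\<close> taking values in [0, 1] and
  \<open>g y < f x\<close> implying \<open>(x, y) \<in> U\<close>. The layer-cake formula writes
  this difference as an average over levels; at a level at least as good as the average,
  \<open>{f > t}\<close> and \<open>{g \<le> t}\<close> span a rectangle inside \<open>U\<close>.
  Compact subsets of both finish the argument.\<close>

lemma dual_level_sets:
  fixes P :: "'a::polish_space measure" and Q :: "'b::polish_space measure"
  assumes P: "P \<in> prob_measures" and Q: "Q \<in> prob_measures"
    and \<phi>: "\<phi> \<in> bounded_borel" and \<psi>: "\<psi> \<in> bounded_borel"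
    and le: "\<And>x y. \<phi> x + \<psi> y \<le> indicat_real U (x, y)" and e: "0 < e"
  obtains A B where "compact A" "compact B" "A \<times> B \<subseteq> U"
    "integral\<^sup>L P \<phi> + integral\<^sup>L Q \<psi> \<le> measure P A + measure Q B - 1 + e"
proof -
  note P' = prob_measuresD[OF P] and Q' = prob_measuresD[OF Q]
  interpret P: prob_space P by (rule P')
  interpret Q: prob_space Q by (rule Q')
  obtain C where C: "\<And>x. \<bar>\<phi> x\<bar> \<le> C" using bounded_borelD(2)[OF \<phi>] by blast
  define m where "m = (SUP x. \<phi> x)"
  have bdd: "bdd_above (range \<phi>)" using C by (intro bdd_aboveI2[of _ _ C]) (simp add: abs_le_iff)
  have \<phi>_le: "\<phi> x \<le> m" for x unfolding m_def by (intro cSUP_upper bdd) simp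
  have \<psi>_le: "\<psi> y \<le> 1 - m" for y
  proof -
    have "\<phi> x \<le> 1 - \<psi> y" for x using le[of x y] by (cases "(x, y) \<in> U") simp_all
    then have "m \<le> 1 - \<psi> y" unfolding m_def by (intro cSUP_least) auto
    then show ?thesis by simp
  qed
  \<comment> \<open>The supremum \<open>m\<close> is moved from one potential to the other, which
    leaves the dual value unchanged; clipping to [0, 1] can only raise it. If
    \<open>g y < f x\<close>, neither clipping is active at that pair, so
    \<open>\<phi> x + \<psi> y > 0\<close>.\<close>
  define f where "f x = max 0 (\<phi> x - m + 1)" for x
  define g where "g y = min 1 (1 - m - \<psi> y)" for y
  have f: "0 \<le> f x" "f x \<le> 1" for x using \<phi>_le[of x] by (auto simp: f_def)
  have g: "0 \<le> g y" "g y \<le> 1" for y using \<psi>_le[of y] by (auto simp: g_def)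
  have fg: "(x, y) \<in> U" if "g y < f x" for x y
  proof (rule ccontr)
    assume "(x, y) \<notin> U"
    then have "\<phi> x + \<psi> y \<le> 0" using le[of x y] by simp
    then show False using that f[of x] g[of y] by (auto simp: f_def g_def max_def min_def split: if_splits)
  qed
  have [measurable]: "\<phi> \<in> borel_measurable borel" "\<psi> \<in> borel_measurable borel"
    using \<phi> \<psi> bounded_borelD(1) by blast+
  have f_meas: "f \<in> borel_measurable borel" and g_meas: "g \<in> borel_measurable borel"
    unfolding f_def[abs_def] g_def[abs_def] by measurable
  have "\<bar>f x\<bar> \<le> 1" for x using f[of x] by simp
  then have f_bb: "f \<in> bounded_borel" by (rule bounded_borelI[OF f_meas])
  have "\<bar>g y\<bar> \<le> 1" for y using g[of y] by simp
  then have g_bb: "g \<in> bounded_borel" by (rule bounded_borelI[OF g_meas])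
  note int_P = integrable_bounded_borel[OF P'(1,2)] and int_Q = integrable_bounded_borel[OF Q'(1,2)]
  have "integral\<^sup>L P \<phi> \<le> integral\<^sup>L P (\<lambda>x. f x + (m - 1))"
    by (intro integral_mono int_P \<phi> f_bb bounded_borel_add bounded_borel_const) (simp add: f_def)
  moreover have "integral\<^sup>L Q \<psi> \<le> integral\<^sup>L Q (\<lambda>y. (1 - m) - g y)"
    by (intro integral_mono int_Q \<psi> g_bb bounded_borel_diff bounded_borel_const) (simp add: g_def)
  moreover have "integral\<^sup>L P (\<lambda>x. f x + (m - 1)) = integral\<^sup>L P f + (m - 1)"
    using int_P[OF f_bb] by (simp add: P.prob_space)
  moreover have "integral\<^sup>L Q (\<lambda>y. (1 - m) - g y) = (1 - m) - integral\<^sup>L Q g"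
    using int_Q[OF g_bb] by (simp add: Q.prob_space)
  ultimately have dual: "integral\<^sup>L P \<phi> + integral\<^sup>L Q \<psi> \<le> integral\<^sup>L P f - integral\<^sup>L Q g" by simp
  \<comment> \<open>The error \<open>e\<close> is shared in thirds: one for the discretization into
    \<open>N\<close> levels and one for each of the two compact approximations.\<close>
  obtain N :: nat where N: "3 / e < real N" using reals_Archimedean2 by blast
  have "0 < 3 / e" using e by simp
  then have N0: "0 < N" using N by (metis of_nat_0_less_iff order_less_trans)
  have N': "1 / real N \<le> e / 3" using N N0 e by (simp add: field_simps)
  define t where "t i = measure P {x. real i / N < f x} - measure Q {y. real i / N < g y}" for i :: nat
  have f_meas': "f \<in> borel_measurable P" and g_meas': "g \<in> borel_measurable Q"
    using f_meas g_meas measurable_cong_sets[OF P'(2) refl] measurable_cong_sets[OF Q'(2) refl] by blast+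
  have "integral\<^sup>L P f \<le> 1 / N * (\<Sum>i<N. measure P {x. real i / N < f x})"
    using integral_le_layer_sum(1)[OF P'(1) f_meas' f N0] by (simp add: P')
  moreover have "1 / N * (\<Sum>i<N. measure Q {y. real i / N < g y}) \<le> integral\<^sup>L Q g + 1 / N"
    using integral_le_layer_sum(2)[OF Q'(1) g_meas' g N0] by (simp add: Q')
  ultimately have avg: "integral\<^sup>L P f - integral\<^sup>L Q g \<le> 1 / N * (\<Sum>i<N. t i) + 1 / N"
    unfolding t_def by (simp add: sum_subtractf diff_divide_distrib)
  \<comment> \<open>Some term is at least the average.\<close>
  have "\<exists>i<N. 1 / N * (\<Sum>i<N. t i) \<le> t i"
  proof (rule ccontr)
    assume "\<not> ?thesis"
    then have "(\<Sum>i<N. t i) < (\<Sum>i<N. 1 / N * (\<Sum>i<N. t i))"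
      using N0 by (intro sum_strict_mono) (auto simp: not_le lessThan_empty_iff)
    then show False using N0 by simp
  qed
  then obtain i where i: "1 / N * (\<Sum>i<N. t i) \<le> t i" by blast
  define A0 where "A0 = {x. real i / N < f x}"
  define B0 where "B0 = {y. g y \<le> real i / N}"
  have AB0: "A0 \<in> sets borel" "B0 \<in> sets borel"
    unfolding A0_def B0_def using f_meas g_meas by measurable
  obtain A where A: "compact A" "A \<subseteq> A0" "measure P (A0 - A) < e / 3"
    using prob_measure_inner_compact[OF P AB0(1), of "e / 3"] e by auto
  obtain B where B: "compact B" "B \<subseteq> B0" "measure Q (B0 - B) < e / 3"
    using prob_measure_inner_compact[OF Q AB0(2), of "e / 3"] e by auto
  have "measure P (A0 - A) = measure P A0 - measure P A"
    using A AB0 P' by (intro P.finite_measure_Diff) (auto simp: borel_compact)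
  moreover have "measure Q (B0 - B) = measure Q B0 - measure Q B"
    using B AB0 Q' by (intro Q.finite_measure_Diff) (auto simp: borel_compact)
  moreover have "measure Q B0 = 1 - measure Q {y. real i / N < g y}"
  proof -
    have "{y. real i / N < g y} = space Q - B0" by (auto simp: B0_def Q')
    then show ?thesis using Q.prob_compl[of B0] AB0 Q' by simp
  qed
  ultimately have "t i \<le> measure P A + measure Q B - 1 + 2 * e / 3"
    using A B unfolding t_def A0_def[symmetric] by simp
  then have "integral\<^sup>L P \<phi> + integral\<^sup>L Q \<psi> \<le> measure P A + measure Q B - 1 + e"
    using dual avg i N' by (simp add: field_simps)
  moreover have "A \<times> B \<subseteq> U"
  proof safe
    fix x y assume "x \<in> A" "y \<in> B"
    then have "real i / N < f x" "g y \<le> real i / N" using A(2) B(2) unfolding A0_def B0_def by auto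
    then show "(x, y) \<in> U" by (intro fg) simp
  qed
  ultimately show thesis by (intro that[OF A(1) B(1)])
qed

section \<open>Symmetrization over the coordinates\<close>

lemma cost_n_permute:
  assumes "\<sigma> permutes {..<n}"
  shows "cost_n n c (x \<circ> \<sigma>) (y \<circ> \<sigma>) = cost_n n c x y"
  unfolding cost_n_def comp_def using sum.permute[OF assms, of "\<lambda>i. c (x i, y i)"] by (simp add: comp_def)

lemma continuous_reindex: "continuous_on UNIV (\<lambda>x :: nat \<Rightarrow> 'a::topological_space. x \<circ> \<sigma>)"
  by (intro continuous_on_coordinatewise_then_product) (simp add: comp_def continuous_on_product_coordinates)

text \<open>Averaging dual potentials over the permutations of the coordinates keeps their integrals under
  exchangeable laws and sharpens the constraint from \<open>cost_n\<close> to its minimum over all matchings, so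
  no symmetric coupling has to be constructed.\<close>

definition symmetrization :: "nat \<Rightarrow> ((nat \<Rightarrow> 'a) \<Rightarrow> real) \<Rightarrow> (nat \<Rightarrow> 'a) \<Rightarrow> real" where
  "symmetrization n \<phi> x = (\<Sum>\<sigma> | \<sigma> permutes {..<n}. \<phi> (x \<circ> \<sigma>)) / fact n"

lemma symmetrization_dual:
  assumes le: "\<And>x y. \<phi> x + \<psi> y \<le> indicat_real {(x, y). a < cost_n n c x y} (x, y)"
  shows "symmetrization n \<phi> x + symmetrization n \<psi> y
    \<le> indicat_real {(x, y). \<forall>\<sigma>. \<sigma> permutes {..<n} \<longrightarrow> a < cost_n n c x (y \<circ> \<sigma>)} (x, y)"
proof -
  let ?S = "{\<sigma>. \<sigma> permutes {..<n}}"
  have card: "card ?S = fact n" by (simp add: card_permutations)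
  have *: "symmetrization n \<phi> x + symmetrization n \<psi> y \<le> of_bool (a < cost_n n c x (y \<circ> \<sigma>))"
    if \<sigma>: "\<sigma> permutes {..<n}" for \<sigma>
  proof -
    \<comment> \<open>Composition with \<open>\<sigma>\<close> only reorders the average of
      \<open>\<psi>\<close>. It pairs \<open>x \<circ> \<tau>\<close> with
      \<open>y \<circ> \<sigma> \<circ> \<tau>\<close>, whose cost does not depend on
      \<open>\<tau>\<close>, so the constraint holds for every matching
      \<open>\<sigma>\<close>.\<close>
    have "(\<Sum>\<tau>\<in>?S. \<psi> (y \<circ> \<tau>)) = (\<Sum>\<tau>\<in>?S. \<psi> (y \<circ> (\<sigma> \<circ> \<tau>)))"
      by (rule setum_permutations_compose_left[OF \<sigma>])
    then have "(\<Sum>\<tau>\<in>?S. \<phi> (x \<circ> \<tau>)) + (\<Sum>\<tau>\<in>?S. \<psi> (y \<circ> \<tau>))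
        = (\<Sum>\<tau>\<in>?S. \<phi> (x \<circ> \<tau>) + \<psi> ((y \<circ> \<sigma>) \<circ> \<tau>))"
      by (simp add: sum.distrib comp_assoc)
    also have "\<dots> \<le> (\<Sum>\<tau>\<in>?S. of_bool (a < cost_n n c x (y \<circ> \<sigma>)))"
    proof (rule sum_mono)
      fix \<tau> assume "\<tau> \<in> ?S"
      then show "\<phi> (x \<circ> \<tau>) + \<psi> ((y \<circ> \<sigma>) \<circ> \<tau>) \<le> of_bool (a < cost_n n c x (y \<circ> \<sigma>))"
        using le[of "x \<circ> \<tau>" "(y \<circ> \<sigma>) \<circ> \<tau>"] cost_n_permute[of \<tau> n c x "y \<circ> \<sigma>"] by (simp add: indicator_def)
    qed
    also have "\<dots> = fact n * of_bool (a < cost_n n c x (y \<circ> \<sigma>))"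
      using card by simp
    finally show ?thesis unfolding symmetrization_def by (simp add: field_simps)
  qed
  show ?thesis
  proof (cases "\<forall>\<sigma>. \<sigma> permutes {..<n} \<longrightarrow> a < cost_n n c x (y \<circ> \<sigma>)")
    case True
    then have "a < cost_n n c x (y \<circ> id)" using permutes_id by blast
    then show ?thesis using *[OF permutes_id] True by simp
  next
    case False
    then obtain \<sigma> where "\<sigma> permutes {..<n}" "\<not> a < cost_n n c x (y \<circ> \<sigma>)" by blast
    then show ?thesis using *[of \<sigma>] False by (simp add: indicator_def)
  qed
qed

lemma bounded_borel_reindex:
  fixes \<phi> :: "(nat \<Rightarrow> 'a::topological_space) \<Rightarrow> real" and \<sigma> :: "nat \<Rightarrow> nat"
  assumes "\<phi> \<in> bounded_borel"
  shows "(\<lambda>x. \<phi> (x \<circ> \<sigma>)) \<in> bounded_borel"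
proof -
  obtain C where "\<And>x. \<bar>\<phi> x\<bar> \<le> C" using bounded_borelD(2)[OF assms] by blast
  moreover have "(\<lambda>x. \<phi> (x \<circ> \<sigma>)) \<in> borel_measurable borel"
    using measurable_compose[OF borel_measurable_continuous_onI[OF continuous_reindex[of \<sigma>]] bounded_borelD(1)[OF assms]] .
  ultimately show ?thesis by (intro bounded_borelI)
qed

lemma symmetrization_bounded_borel:
  fixes \<phi> :: "(nat \<Rightarrow> 'a::topological_space) \<Rightarrow> real"
  assumes \<phi>: "\<phi> \<in> bounded_borel"
  shows "symmetrization n \<phi> \<in> bounded_borel"
proof -
  have "(\<lambda>x. \<Sum>\<sigma>\<in>S. \<phi> (x \<circ> \<sigma>)) \<in> bounded_borel" if "finite S" for S :: "(nat \<Rightarrow> nat) set"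
    using that
  proof (induction S)
    case (insert \<sigma> S)
    then show ?case using bounded_borel_add[OF bounded_borel_reindex[OF \<phi>, of \<sigma>]] by (simp add: comp_def)
  qed (simp add: bounded_borel_const)
  from bounded_borel_mult_left[OF this[OF finite_permutations], of "{..<n}" "inverse (fact n)"]
  show ?thesis unfolding symmetrization_def[abs_def] by (simp add: field_simps)
qed

lemma integral_symmetrization:
  fixes P :: "(nat \<Rightarrow> 'a::polish_space) measure"
  assumes P: "P \<in> prob_measures" and \<phi>: "\<phi> \<in> bounded_borel"
    and exch: "\<And>\<sigma>. \<sigma> permutes {..<n} \<Longrightarrow> distr P borel (\<lambda>x. x \<circ> \<sigma>) = P"
  shows "integral\<^sup>L P (symmetrization n \<phi>) = integral\<^sup>L P \<phi>"
proof -
  note P' = prob_measuresD[OF P]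
  have "integral\<^sup>L P (\<lambda>x. \<phi> (x \<circ> \<sigma>)) = integral\<^sup>L P \<phi>" if \<sigma>: "\<sigma> permutes {..<n}" for \<sigma>
  proof -
    have "(\<lambda>x. x \<circ> \<sigma>) \<in> measurable P borel"
      unfolding measurable_cong_sets[OF P'(2) refl] by (rule borel_measurable_continuous_onI[OF continuous_reindex])
    then have "integral\<^sup>L (distr P borel (\<lambda>x. x \<circ> \<sigma>)) \<phi> = integral\<^sup>L P (\<lambda>x. \<phi> (x \<circ> \<sigma>))"
      by (rule integral_distr) (rule bounded_borelD(1)[OF \<phi>])
    then show ?thesis using exch[OF \<sigma>] by simp
  qed
  moreover have "integrable P (\<lambda>x. \<phi> (x \<circ> \<sigma>))" for \<sigma>
    by (intro integrable_bounded_borel P' bounded_borel_reindex \<phi>)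
  ultimately have "integral\<^sup>L P (symmetrization n \<phi>) = (\<Sum>\<sigma> | \<sigma> permutes {..<n}. integral\<^sup>L P \<phi>) / fact n"
    unfolding symmetrization_def[abs_def] by (simp add: Bochner_Integration.integral_sum)
  then show ?thesis by (simp add: card_permutations)
qed

text \<open>Finite sums commute with increasing suprema, so \<open>cost_n\<close> is a supremum of
  averages of Lipschitz minorants, each continuous on the space of sequences.\<close>

lemma open_cost_n_greater:
  fixes c :: "'a::polish_space \<times> 'b::polish_space \<Rightarrow> ennreal"
  assumes c: "lower_semicontinuous c" and \<alpha>: "0 \<le> \<alpha>" and n: "1 \<le> n"
  shows "open {(x, y). ennreal \<alpha> < cost_n n c x y}"
proof -
  define h where "h = lipschitz_minorant c"
  define s where "s k z = (\<Sum>i<n. h k (fst z i, snd z i)) / n" for k and z :: "(nat \<Rightarrow> 'a) \<times> (nat \<Rightarrow> 'b)"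
  have c_eq: "c z = (SUP k. ennreal (h k z))" for z unfolding h_def by (simp add: SUP_lipschitz_minorant[OF c])
  have nonneg: "0 \<le> h k z" for k z unfolding h_def by (rule lipschitz_minorant_nonneg)
  have "cost_n n c (fst z) (snd z) = (SUP k. ennreal (s k z))" for z
  proof -
    have "(\<Sum>i<n. c (fst z i, snd z i)) = (SUP k. \<Sum>i<n. ennreal (h k (fst z i, snd z i)))"
      unfolding c_eq
      by (intro ennreal_SUP_sum[symmetric] incseq_SucI ennreal_leI) (simp add: h_def lipschitz_minorant_mono)
    also have "\<dots> = (SUP k. ennreal (\<Sum>i<n. h k (fst z i, snd z i)))" by (simp add: sum_ennreal nonneg)
    finally show ?thesis
      using n unfolding cost_n_def s_def
      by (simp add: SUP_divide_ennreal ennreal_of_nat_eq_real_of_nat divide_ennreal sum_nonneg nonneg)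
  qed
  then have "ennreal \<alpha> < cost_n n c (fst z) (snd z) \<longleftrightarrow> (\<exists>k. \<alpha> < s k z)" for z
    using \<alpha> by (simp add: less_SUP_iff ennreal_less_iff)
  then have "{(x, y). ennreal \<alpha> < cost_n n c x y} = (\<Union>k. {z. \<alpha> < s k z})"
    unfolding case_prod_beta by blast
  moreover have "continuous_on UNIV (s k)" for k
  proof -
    have proj: "continuous_on UNIV (\<lambda>z :: (nat \<Rightarrow> 'a) \<times> (nat \<Rightarrow> 'b). (fst z i, snd z i))" for i
      by (intro continuous_on_Pair
        continuous_on_compose2[OF continuous_on_product_coordinates continuous_on_fst[OF continuous_on_id] subset_UNIV]
        continuous_on_compose2[OF continuous_on_product_coordinates continuous_on_snd[OF continuous_on_id] subset_UNIV])
    have "continuous_on UNIV (\<lambda>z :: (nat \<Rightarrow> 'a) \<times> (nat \<Rightarrow> 'b). h k (fst z i, snd z i))" for i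
      unfolding h_def by (rule continuous_on_compose2[OF continuous_lipschitz_minorant proj subset_UNIV])
    then show ?thesis
      unfolding s_def[abs_def] using n by (intro continuous_on_divide continuous_on_sum continuous_on_const) auto
  qed
  then have "open {z. \<alpha> < s k z}" for k by (intro open_Collect_less continuous_on_const)
  ultimately show ?thesis by (simp add: open_UN)
qed

section \<open>Sample laws and empirical laws\<close>

text \<open>The law of the sample on the Polish space of all sequences, with the junk value
  \<open>undefined\<close> at the indices from \<open>n\<close> on.\<close>

definition sequence_law :: "nat \<Rightarrow> 'a::polish_space measure \<Rightarrow> (nat \<Rightarrow> 'a) measure" where
  "sequence_law n P = distr (prod_n n P) borel (\<lambda>x. x)"

context
  fixes n :: nat and P :: "'a::polish_space measure"
  assumes P: "P \<in> prob_measures"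
begin

lemma prob_space_prod_n: "prob_space (prod_n n P)"
  using prob_measuresD[OF P] by (intro prob_space_PiM)

lemma measurable_prod_n_inclusion: "(\<lambda>x. x) \<in> measurable (prod_n n P) borel"
proof -
  have sP: "sets P = sets borel" using P by (rule prob_measuresD)
  have "(\<lambda>x. x) \<in> measurable (prod_n n P) (Pi\<^sub>M UNIV (\<lambda>_. borel))"
  proof (rule measurable_PiM_single')
    fix i :: nat
    show "(\<lambda>x. x i) \<in> measurable (prod_n n P) borel"
    proof (cases "i < n")
      case True
      then have "(\<lambda>x. x i) \<in> measurable (prod_n n P) P" by (intro measurable_component_singleton) simp
      then show ?thesis using measurable_cong_sets[OF refl sP] by blast
    next
      case False
      have "(\<lambda>x. x i) \<in> measurable (prod_n n P) borel \<longleftrightarrow> (\<lambda>x. undefined) \<in> measurable (prod_n n P) (borel :: 'a measure)"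
        by (rule measurable_cong) (use False in \<open>auto simp: space_PiM PiE_def extensional_def\<close>)
      then show ?thesis by simp
    qed
  qed simp
  then show ?thesis using measurable_cong_sets[OF refl sets_PiM_equal_borel] by blast
qed

lemma measurable_restrict_prod_n: "(\<lambda>x. restrict x {..<n}) \<in> measurable borel (prod_n n P)"
proof (rule measurable_restrict)
  fix i
  have "(\<lambda>x. x i) \<in> measurable borel (borel :: 'a measure)"
    by (intro borel_measurable_continuous_onI continuous_on_product_coordinates)
  then show "(\<lambda>x. x i) \<in> measurable borel P" using measurable_cong_sets[OF refl prob_measuresD(2)[OF P]] by blast
qed

lemma sequence_law_prob: "sequence_law n P \<in> prob_measures"
  unfolding sequence_law_def space_prob_algebra
  by (simp add: prob_space.prob_space_distr[OF prob_space_prod_n measurable_prod_n_inclusion])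

lemma restrict_space_prod_n: "x \<in> space (prod_n n P) \<Longrightarrow> restrict x {..<n} = x"
  by (auto simp: space_PiM PiE_def extensional_restrict)

lemma distr_restrict_sequence_law: "distr (sequence_law n P) (prod_n n P) (\<lambda>x. restrict x {..<n}) = prod_n n P"
proof -
  have "distr (sequence_law n P) (prod_n n P) (\<lambda>x. restrict x {..<n}) = distr (prod_n n P) (prod_n n P) (\<lambda>x. restrict x {..<n})"
    unfolding sequence_law_def
    by (subst distr_distr[OF measurable_restrict_prod_n measurable_prod_n_inclusion]) (simp add: comp_def)
  also have "\<dots> = distr (prod_n n P) (prod_n n P) (\<lambda>x. x)"
    by (intro distr_cong refl restrict_space_prod_n)
  finally show ?thesis by (simp add: distr_id)
qed

lemma sequence_law_exchangeable:
  assumes \<sigma>: "\<sigma> permutes {..<n}"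
  shows "distr (sequence_law n P) borel (\<lambda>x. x \<circ> \<sigma>) = sequence_law n P"
proof -
  have reindex: "(\<lambda>x. x \<circ> \<sigma>) \<in> measurable borel (borel :: (nat \<Rightarrow> 'a) measure)"
    by (rule borel_measurable_continuous_onI[OF continuous_reindex])
  have shuffle: "(\<lambda>x. \<lambda>i\<in>{..<n}. x (\<sigma> i)) \<in> measurable (prod_n n P) (prod_n n P)"
    using permutes_in_image[OF \<sigma>] by (intro measurable_restrict measurable_component_singleton) auto
  have "distr (sequence_law n P) borel (\<lambda>x. x \<circ> \<sigma>) = distr (prod_n n P) borel (\<lambda>x. x \<circ> \<sigma>)"
    unfolding sequence_law_def
    by (subst distr_distr[OF reindex measurable_prod_n_inclusion]) (simp add: comp_def)
  \<comment> \<open>\<open>\<sigma>\<close> fixes the indices from \<open>n\<close> on, where both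
    sides have the value \<open>undefined\<close>.\<close>
  also have "\<dots> = distr (prod_n n P) borel (\<lambda>x. \<lambda>i\<in>{..<n}. x (\<sigma> i))"
  proof (intro distr_cong refl ext)
    fix x i assume "x \<in> space (prod_n n P)"
    then show "(x \<circ> \<sigma>) i = (\<lambda>i\<in>{..<n}. x (\<sigma> i)) i"
      using permutes_not_in[OF \<sigma>, of i] by (auto simp: space_PiM PiE_def extensional_def)
  qed
  also have "\<dots> = distr (distr (prod_n n P) (prod_n n P) (\<lambda>x. \<lambda>i\<in>{..<n}. x (\<sigma> i))) borel (\<lambda>x. x)"
    by (subst distr_distr[OF measurable_prod_n_inclusion shuffle]) (simp add: comp_def)
  also have "distr (prod_n n P) (prod_n n P) (\<lambda>x. \<lambda>i\<in>{..<n}. x (\<sigma> i)) = prod_n n P"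
    using prob_measuresD(1)[OF P] permutes_in_image[OF \<sigma>] permutes_inj_on[OF \<sigma>]
    by (intro distr_PiM_reindex[of "{..<n}" "\<lambda>_. P" \<sigma> "{..<n}"]) auto
  finally show ?thesis unfolding sequence_law_def .
qed

lemma measurable_empirical_measure:
  assumes n: "1 \<le> n"
  shows "empirical_measure n \<in> measurable (prod_n n P) (borel_of weak_topology)"
  using measurable_compose[OF measurable_prod_n_inclusion measurable_borel_of[OF refl continuous_empirical_measure[OF n]]]
  by simp

lemma prob_space_empirical_law: "1 \<le> n \<Longrightarrow> prob_space (empirical_law n P)"
  unfolding empirical_law_def by (intro prob_space.prob_space_distr prob_space_prod_n measurable_empirical_measure)

text \<open>Empirical measures forget the order of the sample, so the preimage of the image may
  exceed \<open>A\<close>; this accounts for the inequality. Compactness of \<open>A\<close> makes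
  the image an event.\<close>

lemma empirical_law_image_compact:
  assumes n: "1 \<le> n" and A: "compact A"
  shows "compactin weak_topology (empirical_measure n ` A)"
    and "closedin weak_topology (empirical_measure n ` A)"
    and "measure (sequence_law n P) A \<le> measure (empirical_law n P) (empirical_measure n ` A)"
proof -
  show comp: "compactin weak_topology (empirical_measure n ` A)"
    using A by (intro image_compactin[OF _ continuous_empirical_measure[OF n]]) simp
  show clos: "closedin weak_topology (empirical_measure n ` A)"
    by (rule compactin_imp_closedin[OF Hausdorff_weak_topology comp])
  interpret prob_space "prod_n n P" by (rule prob_space_prod_n)
  have T: "empirical_measure n ` A \<in> sets (borel_of weak_topology)" by (rule closedin_in_borel_of[OF clos])
  have "measure (sequence_law n P) A = measure (prod_n n P) (A \<inter> space (prod_n n P))"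
    unfolding sequence_law_def using A measurable_prod_n_inclusion
    by (subst measure_distr) (auto simp: borel_compact)
  also have "\<dots> \<le> measure (prod_n n P) (empirical_measure n -` empirical_measure n ` A \<inter> space (prod_n n P))"
    by (intro finite_measure_mono measurable_sets[OF measurable_empirical_measure[OF n] T]) auto
  also have "\<dots> = measure (empirical_law n P) (empirical_measure n ` A)"
    unfolding empirical_law_def by (rule measure_distr[OF measurable_empirical_measure[OF n] T, symmetric])
  finally show "measure (sequence_law n P) A \<le> measure (empirical_law n P) (empirical_measure n ` A)" .
qed

end

lemma coupling_rectangle_bound:
  assumes R: "R \<in> couplings M N" and A: "A \<in> sets M" and B: "B \<in> sets N"
    and S: "S \<in> sets R" "A \<times> B \<subseteq> S"
  shows "measure M A + measure N B - 1 \<le> measure R S"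
proof -
  interpret R: prob_space R by (rule couplingsD[OF R])
  have spR: "space R = space M \<times> space N"
    using sets_eq_imp_space_eq[OF couplingsD(2)[OF R]] by (simp add: space_pair_measure)
  let ?A = "fst -` A \<inter> space R" and ?B = "snd -` B \<inter> space R"
  have sets: "?A \<in> sets R" "?B \<in> sets R"
    using measurable_sets[OF couplingsD(5)[OF R] A] measurable_sets[OF couplingsD(6)[OF R] B] by simp_all
  have "measure M A = measure R ?A" "measure N B = measure R ?B" using coupling_marginals[OF R] A B by simp_all
  moreover have "measure R ?A \<le> measure R (S \<union> (space R - ?B))"
    using S(2) by (intro R.finite_measure_mono sets.Un S(1) sets.Diff sets.top sets) (auto simp: spR)
  moreover have "measure R (S \<union> (space R - ?B)) \<le> measure R S + measure R (space R - ?B)"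
    using sets S by (intro measure_Un_le) auto
  moreover have "measure R (space R - ?B) = 1 - measure R ?B" using sets by (intro R.prob_compl)
  ultimately show ?thesis by simp
qed

text \<open>Compactness on both sides makes these pairs admissible for both suprema of the theorem:
  they are closed pairs, and \<open>B\<close> avoids the transport neighbourhood of the compact set
  \<open>A\<close>. Their supremum \<open>separation\<close> is thus a lower bound for
  either.\<close>

definition separated_compacts ::
  "('a::topological_space \<times> 'b::topological_space \<Rightarrow> ennreal) \<Rightarrow> real \<Rightarrow> ('a measure set \<times> 'b measure set) set" where
  "separated_compacts c \<alpha> = {(A, B). compactin weak_topology A \<and> compactin weak_topology B \<and>
     (\<forall>QX\<in>A. \<forall>QY\<in>B. ennreal \<alpha> < transport_cost c QX QY)}"

definition separation ::
  "nat \<Rightarrow> 'a::topological_space measure \<Rightarrow> 'b::topological_space measure \<Rightarrow> ('a \<times> 'b \<Rightarrow> ennreal) \<Rightarrow> real \<Rightarrow> real" where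
  "separation n PX PY c \<alpha> = (SUP (A, B)\<in>separated_compacts c \<alpha>.
     measure (empirical_law n PX) A + measure (empirical_law n PY) B - 1)"

section \<open>Excess probability against separated sets\<close>

context
  fixes n :: nat and PX :: "'a::polish_space measure" and PY :: "'b::polish_space measure"
    and c :: "'a \<times> 'b \<Rightarrow> ennreal" and \<alpha> :: real
  assumes PX: "PX \<in> prob_measures" and PY: "PY \<in> prob_measures" and c: "lower_semicontinuous c"
    and \<alpha>: "0 \<le> \<alpha>" and n: "1 \<le> n"
begin

lemma transport_excess_event:
  assumes \<pi>: "\<pi> \<in> couplings (empirical_law n PX) (empirical_law n PY)"
  shows "{(QX, QY) \<in> space \<pi>. ennreal \<alpha> < transport_cost c QX QY} \<in> sets \<pi>"
    and "space \<pi> = prob_measures \<times> prob_measures"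
proof -
  have "sets \<pi> = sets (empirical_law n PX \<Otimes>\<^sub>M empirical_law n PY)" using \<pi> unfolding couplings_def by simp
  also have "\<dots> = sets (borel_of weak_topology \<Otimes>\<^sub>M borel_of weak_topology)"
    by (rule sets_pair_measure_cong) (simp_all add: empirical_law_def)
  finally have s: "sets \<pi> = sets (borel_of weak_topology \<Otimes>\<^sub>M borel_of weak_topology)" .
  note sp = sets_eq_imp_space_eq[OF s]
  show "{(QX, QY) \<in> space \<pi>. ennreal \<alpha> < transport_cost c QX QY} \<in> sets \<pi>"
    unfolding s sp by (rule measurable_transport_cost_greater[OF c \<alpha>])
  show "space \<pi> = prob_measures \<times> prob_measures"
    unfolding sp by (simp add: space_pair_measure space_borel_of topspace_weak_topology)
qed

text \<open>Weak duality for the excess probability. Measurable sets are allowed because, besides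
  closed pairs, it is applied to the complement of a transport neighbourhood, which is open.\<close>

lemma separated_le_transport_excess:
  assumes \<pi>: "\<pi> \<in> couplings (empirical_law n PX) (empirical_law n PY)"
    and A: "A \<in> sets (borel_of weak_topology)" and B: "B \<in> sets (borel_of weak_topology)"
    and sep: "\<And>QX QY. QX \<in> A \<Longrightarrow> QY \<in> B \<Longrightarrow> ennreal \<alpha> < transport_cost c QX QY"
  shows "measure (empirical_law n PX) A + measure (empirical_law n PY) B - 1 \<le> transport_excess_prob c \<alpha> \<pi>"
  unfolding transport_excess_prob_def
proof (rule coupling_rectangle_bound[OF \<pi>])
  show "A \<in> sets (empirical_law n PX)" "B \<in> sets (empirical_law n PY)" using A B by (simp_all add: empirical_law_def)
  show "{(QX, QY) \<in> space \<pi>. ennreal \<alpha> < transport_cost c QX QY} \<in> sets \<pi>" by (rule transport_excess_event[OF \<pi>])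
  show "A \<times> B \<subseteq> {(QX, QY) \<in> space \<pi>. ennreal \<alpha> < transport_cost c QX QY}"
    using sep sets.sets_into_space[OF A] sets.sets_into_space[OF B] transport_excess_event(2)[OF \<pi>]
    by (auto simp: space_borel_of topspace_weak_topology)
qed

lemma measurable_cost_n:
  "(\<lambda>z. cost_n n c (fst z) (snd z)) \<in> borel_measurable (prod_n n PX \<Otimes>\<^sub>M prod_n n PY)"
proof -
  have "(\<lambda>z. c (fst z i, snd z i)) \<in> borel_measurable (prod_n n PX \<Otimes>\<^sub>M prod_n n PY)" if i: "i < n" for i
  proof -
    have [measurable]: "(\<lambda>z. fst z i) \<in> measurable (prod_n n PX \<Otimes>\<^sub>M prod_n n PY) PX"
      "(\<lambda>z. snd z i) \<in> measurable (prod_n n PX \<Otimes>\<^sub>M prod_n n PY) PY"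
      using i by (auto intro!: measurable_compose[OF measurable_fst measurable_component_singleton]
        measurable_compose[OF measurable_snd measurable_component_singleton])
    have "(\<lambda>z. (fst z i, snd z i)) \<in> measurable (prod_n n PX \<Otimes>\<^sub>M prod_n n PY) (PX \<Otimes>\<^sub>M PY)" by measurable
    moreover have "c \<in> borel_measurable (PX \<Otimes>\<^sub>M PY)"
      unfolding measurable_cong_sets[OF sets_pair_borel[OF prob_measuresD(2)[OF PX] prob_measuresD(2)[OF PY]] refl]
      by (rule borel_measurable_lower_semicontinuous[OF c])
    ultimately show ?thesis by (rule measurable_compose)
  qed
  then show ?thesis unfolding cost_n_def by (intro borel_measurable_divide_ennreal borel_measurable_sum measurable_const) auto
qed

lemma excess_event:
  assumes R: "R \<in> couplings (prod_n n PX) (prod_n n PY)"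
  shows "{(x, y) \<in> space R. ennreal \<alpha> < cost_n n c x y} \<in> sets R"
proof -
  have s: "sets R = sets (prod_n n PX \<Otimes>\<^sub>M prod_n n PY)" using R unfolding couplings_def by simp
  have "{z \<in> space R. ennreal \<alpha> < cost_n n c (fst z) (snd z)} \<in> sets R"
    using measurable_cost_n[unfolded measurable_cong_sets[OF s[symmetric] refl]] by measurable
  moreover have "{(x, y) \<in> space R. ennreal \<alpha> < cost_n n c x y} = {z \<in> space R. ennreal \<alpha> < cost_n n c (fst z) (snd z)}"
    by auto
  ultimately show ?thesis by simp
qed

lemma empirical_coupling:
  assumes R: "R \<in> couplings (prod_n n PX) (prod_n n PY)"
  defines "\<pi> \<equiv> distr R (borel_of weak_topology \<Otimes>\<^sub>M borel_of weak_topology)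
    (\<lambda>z. (empirical_measure n (fst z), empirical_measure n (snd z)))"
  shows "\<pi> \<in> couplings (empirical_law n PX) (empirical_law n PY)"
    and "transport_excess_prob c \<alpha> \<pi> \<le> excess_prob n c \<alpha> R"
proof -
  let ?W = "borel_of weak_topology :: 'a measure measure" and ?V = "borel_of weak_topology :: 'b measure measure"
  let ?T = "\<lambda>z. (empirical_measure n (fst z), empirical_measure n (snd z))"
  interpret R: prob_space R by (rule couplingsD[OF R])
  note push = distr_coupling[OF R measurable_empirical_measure[OF PX n] measurable_empirical_measure[OF PY n]]
  note T = push(1)
  show \<pi>: "\<pi> \<in> couplings (empirical_law n PX) (empirical_law n PY)"
    unfolding \<pi>_def empirical_law_def by (rule push(2))
  let ?E = "{(QX, QY) \<in> space \<pi>. ennreal \<alpha> < transport_cost c QX QY}"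
  have "?E \<in> sets (?W \<Otimes>\<^sub>M ?V)" using transport_excess_event(1)[OF \<pi>] by (simp add: \<pi>_def)
  from measure_distr[OF T this] have "transport_excess_prob c \<alpha> \<pi> = measure R (?T -` ?E \<inter> space R)"
    unfolding transport_excess_prob_def \<pi>_def .
  also have "\<dots> \<le> excess_prob n c \<alpha> R"
    unfolding excess_prob_def
    using transport_cost_empirical_le[OF n c]
    by (intro R.finite_measure_mono excess_event[OF R]) (auto intro: order.strict_trans2)
  finally show "transport_excess_prob c \<alpha> \<pi> \<le> excess_prob n c \<alpha> R" .
qed

lemma le_separation:
  "(A, B) \<in> separated_compacts c \<alpha> \<Longrightarrow> measure (empirical_law n PX) A + measure (empirical_law n PY) B - 1 \<le> separation n PX PY c \<alpha>"
proof -
  assume AB: "(A, B) \<in> separated_compacts c \<alpha>"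
  interpret X: prob_space "empirical_law n PX" by (rule prob_space_empirical_law[OF PX n])
  interpret Y: prob_space "empirical_law n PY" by (rule prob_space_empirical_law[OF PY n])
  have "X.prob A + Y.prob B - 1 \<le> 1" for A B using X.prob_le_1[of A] Y.prob_le_1[of B] by linarith
  then have "bdd_above ((\<lambda>(A, B). X.prob A + Y.prob B - 1) ` separated_compacts c \<alpha>)"
    by (intro bdd_aboveI2[where M = 1]) (simp add: case_prod_beta)
  from cSUP_upper[OF AB this] show ?thesis unfolding separation_def by simp
qed

text \<open>The strong half of the duality. Symmetrized potentials keep their integrals because the
  sample laws are exchangeable, and their level sets map to a separated pair of compact sets. So
  \<open>separation\<close> bounds every dual value, and some coupling attains that bound.\<close>

lemma exists_coupling_le_separation:
  obtains R where "R \<in> couplings (prod_n n PX) (prod_n n PY)" "excess_prob n c \<alpha> R \<le> separation n PX PY c \<alpha>"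
proof -
  let ?P = "sequence_law n PX" and ?Q = "sequence_law n PY"
  let ?U = "{(x, y). ennreal \<alpha> < cost_n n c x y}"
  note P = sequence_law_prob[OF PX, of n] and Q = sequence_law_prob[OF PY, of n]
  note P' = prob_measuresD[OF P] and Q' = prob_measuresD[OF Q]
  have U: "open ?U" by (rule open_cost_n_greater[OF c \<alpha> n])
  have dual: "integral\<^sup>L ?P \<phi> + integral\<^sup>L ?Q \<psi> \<le> separation n PX PY c \<alpha>"
    if \<phi>: "\<phi> \<in> bounded_borel" and \<psi>: "\<psi> \<in> bounded_borel"
      and le: "\<And>x y. \<phi> x + \<psi> y \<le> indicat_real ?U (x, y)" for \<phi> \<psi>
  proof (rule field_le_epsilon)
    fix e :: real assume e: "0 < e"
    obtain A B where AB: "compact A" "compact B"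
      "A \<times> B \<subseteq> {(x, y). \<forall>\<sigma>. \<sigma> permutes {..<n} \<longrightarrow> ennreal \<alpha> < cost_n n c x (y \<circ> \<sigma>)}"
      "integral\<^sup>L ?P (symmetrization n \<phi>) + integral\<^sup>L ?Q (symmetrization n \<psi>) \<le> measure ?P A + measure ?Q B - 1 + e"
      using dual_level_sets[OF P Q symmetrization_bounded_borel[OF \<phi>] symmetrization_bounded_borel[OF \<psi>]
          symmetrization_dual[OF le] e] by blast
    have "(empirical_measure n ` A, empirical_measure n ` B) \<in> separated_compacts c \<alpha>"
      unfolding separated_compacts_def
      using AB empirical_law_image_compact(1)[OF PX n] empirical_law_image_compact(1)[OF PY n]
      by (auto intro!: transport_cost_empirical_greater[OF n c])
    from le_separation[OF this]
    have "measure ?P A + measure ?Q B - 1 \<le> separation n PX PY c \<alpha>"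
      using empirical_law_image_compact(3)[OF PX n AB(1)] empirical_law_image_compact(3)[OF PY n AB(2)] by simp
    then show "integral\<^sup>L ?P \<phi> + integral\<^sup>L ?Q \<psi> \<le> separation n PX PY c \<alpha> + e"
      using AB(4) integral_symmetrization[OF P \<phi> sequence_law_exchangeable[OF PX]]
        integral_symmetrization[OF Q \<psi> sequence_law_exchangeable[OF PY]] by simp
  qed
  \<comment> \<open>The cost is already bounded, so a constant sequence suffices.\<close>
  obtain R where R: "R \<in> couplings ?P ?Q" "(\<integral>\<^sup>+ z. ennreal (indicat_real ?U z) \<partial>R) \<le> ennreal (separation n PX PY c \<alpha>)"
  proof (rule coupling_of_dual_bound[OF P Q, of "\<lambda>_. indicat_real ?U" "separation n PX PY c \<alpha>"])
    show "\<exists>B. \<forall>z. indicat_real ?U z \<le> B" by (rule exI[of _ 1]) (simp add: indicator_def)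
    show "open {z. t < indicat_real ?U z}" for t
    proof -
      have "{z. t < indicat_real ?U z} = (if t < 0 then UNIV else if t < 1 then ?U else {})"
        by (auto simp: indicator_def split: if_splits)
      then show ?thesis using U by simp
    qed
  qed (use dual in auto)
  \<comment> \<open>Restriction returns from sequences to functions extensional on
    \<open>{..<n}\<close>. \<open>cost_n\<close> sees only the indices below \<open>n\<close>, so
    the excess event is unchanged.\<close>
  let ?r = "\<lambda>z. (restrict (fst z) {..<n}, restrict (snd z) {..<n})"
  let ?M = "prod_n n PX \<Otimes>\<^sub>M prod_n n PY"
  have sR: "sets R = sets borel" using couplingsD(2)[OF R(1)] sets_pair_borel[OF P'(2) Q'(2)] by simp
  interpret R: prob_space R by (rule couplingsD[OF R(1)])
  have spR: "space R = UNIV" using sets_eq_imp_space_eq[OF sR] by simp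
  have rX: "(\<lambda>x. restrict x {..<n}) \<in> measurable ?P (prod_n n PX)"
    unfolding measurable_cong_sets[OF P'(2) refl] by (rule measurable_restrict_prod_n[OF PX])
  have rY: "(\<lambda>x. restrict x {..<n}) \<in> measurable ?Q (prod_n n PY)"
    unfolding measurable_cong_sets[OF Q'(2) refl] by (rule measurable_restrict_prod_n[OF PY])
  note push = distr_coupling[OF R(1) rX rY]
  note r = push(1)
  define R' where "R' = distr R ?M ?r"
  have R': "R' \<in> couplings (prod_n n PX) (prod_n n PY)"
    using push(2) unfolding R'_def distr_restrict_sequence_law[OF PX] distr_restrict_sequence_law[OF PY] .
  have "{(x, y) \<in> space R'. ennreal \<alpha> < cost_n n c x y} \<in> sets ?M" using excess_event[OF R'] by (simp add: R'_def)
  from measure_distr[OF r this]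
  have "excess_prob n c \<alpha> R' = measure R (?r -` {(x, y) \<in> space R'. ennreal \<alpha> < cost_n n c x y} \<inter> space R)"
    unfolding excess_prob_def R'_def .
  also have "?r -` {(x, y) \<in> space R'. ennreal \<alpha> < cost_n n c x y} \<inter> space R = ?U"
    using measurable_space[OF r] by (auto simp: R'_def spR cost_n_def)
  finally have "ennreal (excess_prob n c \<alpha> R') = (\<integral>\<^sup>+ z. ennreal (indicat_real ?U z) \<partial>R)"
    using U sR by (simp add: ennreal_indicator R.emeasure_eq_measure)
  with R(2) have le: "ennreal (excess_prob n c \<alpha> R') \<le> ennreal (separation n PX PY c \<alpha>)" by simp
  \<comment> \<open>A bound in \<open>ennreal\<close> would hide a negative value of
    \<open>separation\<close>; the zero potentials exclude it.\<close>
  have "0 \<le> separation n PX PY c \<alpha>" using dual[of "\<lambda>_. 0" "\<lambda>_. 0"] by (simp add: bounded_borel_const)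
  then have "excess_prob n c \<alpha> R' \<le> separation n PX PY c \<alpha>" using le by (simp add: ennreal_le_iff)
  with R' show thesis by (rule that)
qed

end

theorem theorem3:
  fixes PX :: "'a::polish_space measure"
    and PY :: "'b::polish_space measure"
    and c :: "'a \<times> 'b \<Rightarrow> ennreal"
    and \<alpha> :: real
    and n :: nat
  assumes "PX \<in> prob_measures"
    and "PY \<in> prob_measures"
    and "lower_semicontinuous c"
    and "\<alpha> \<ge> 0"
    and "{(x, y). c (x, y) > ennreal \<alpha>} \<noteq> {}"
    and "n \<ge> 1"
  shows
    "(\<forall>QX\<in>prob_measures. \<forall>QY\<in>prob_measures.
        \<exists>R\<in>couplings QX QY. (\<integral>\<^sup>+ z. c z \<partial>R) = transport_cost c QX QY) \<and>
     (\<exists>R\<in>couplings (prod_n n PX) (prod_n n PY).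
        excess_prob n c \<alpha> R = optimal_excess_prob n c \<alpha> PX PY) \<and>
     (\<exists>\<pi>\<in>couplings (empirical_law n PX) (empirical_law n PY).
        transport_excess_prob c \<alpha> \<pi> =
          (INF \<pi>\<in>couplings (empirical_law n PX) (empirical_law n PY). transport_excess_prob c \<alpha> \<pi>)) \<and>
     (optimal_excess_prob n c \<alpha> PX PY =
        (INF \<pi>\<in>couplings (empirical_law n PX) (empirical_law n PY). transport_excess_prob c \<alpha> \<pi>)) \<and>
     (optimal_excess_prob n c \<alpha> PX PY =
        (SUP (A, B)\<in>{(A, B). closedin weak_topology A \<and> closedin weak_topology B \<and>
                           (\<forall>QX\<in>A. \<forall>QY\<in>B. transport_cost c QX QY > ennreal \<alpha>)}.
           measure (empirical_law n PX) A + measure (empirical_law n PY) B - 1)) \<and>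
     (optimal_excess_prob n c \<alpha> PX PY =
        (SUP A\<in>{A. compactin weak_topology A}.
           measure (empirical_law n PX) A - measure (empirical_law n PY) (transport_nbhd c \<alpha> A)))"
proof -
  note PX = assms(1) and PY = assms(2) and c = assms(3) and \<alpha> = assms(4) and n = assms(6)
  let ?\<mu> = "empirical_law n PX" and ?\<nu> = "empirical_law n PY"
  let ?M = "prod_n n PX" and ?N = "prod_n n PY"
  let ?te = "transport_excess_prob c \<alpha>" and ?ex = "excess_prob n c \<alpha>"
  let ?closed = "{(A, B). closedin weak_topology A \<and> closedin weak_topology B \<and>
    (\<forall>QX\<in>A. \<forall>QY\<in>B. transport_cost c QX QY > ennreal \<alpha>)}"
  define S where "S = separation n PX PY c \<alpha>"
  interpret X: prob_space ?\<mu> by (rule prob_space_empirical_law[OF PX n])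
  interpret Y: prob_space ?\<nu> by (rule prob_space_empirical_law[OF PY n])
  have space_\<nu>: "space ?\<nu> = prob_measures" and sets_\<nu>: "sets ?\<nu> = sets (borel_of weak_topology)"
    by (simp_all add: empirical_law_def space_borel_of topspace_weak_topology)
  \<comment> \<open>\<open>S\<close> is a lower bound for both excess probabilities. The coupling
    \<open>R\<close> reaches it from above, and its image \<open>\<pi>\<close> does no worse, so
    both minima are attained with value \<open>S\<close>.\<close>
  obtain R where R: "R \<in> couplings ?M ?N" "?ex R \<le> S"
    using exists_coupling_le_separation[OF PX PY c \<alpha> n] unfolding S_def by blast
  obtain \<pi> where \<pi>: "\<pi> \<in> couplings ?\<mu> ?\<nu>" "?te \<pi> \<le> ?ex R"
    using empirical_coupling[OF PX PY c \<alpha> n R(1)] by blast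
  have closed_le: "X.prob A + Y.prob B - 1 \<le> ?te \<pi>" if "(A, B) \<in> ?closed" "\<pi> \<in> couplings ?\<mu> ?\<nu>" for A B \<pi>
    using that by (intro separated_le_transport_excess[OF PX PY c \<alpha> n] closedin_in_borel_of) auto
  have compact_closed: "separated_compacts c \<alpha> \<subseteq> ?closed"
    by (auto simp: separated_compacts_def intro: compactin_imp_closedin[OF Hausdorff_weak_topology])
  have ne: "separated_compacts c \<alpha> \<noteq> {}"
    unfolding separated_compacts_def by (auto intro: exI[of _ "{}"])
  have S_le: "S \<le> ?te \<pi>" if "\<pi> \<in> couplings ?\<mu> ?\<nu>" for \<pi>
    unfolding S_def separation_def
    using closed_le[OF _ that] compact_closed by (intro cSUP_least ne) auto
  have S_le_ex: "S \<le> ?ex R" if "R \<in> couplings ?M ?N" for R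
    using empirical_coupling[OF PX PY c \<alpha> n that] S_le by (meson order_trans)
  have ex_R: "?ex R = S" using R S_le_ex by (meson antisym)
  have te_\<pi>: "?te \<pi> = S" using \<pi> R S_le[OF \<pi>(1)] by simp
  have G: "optimal_excess_prob n c \<alpha> PX PY = S"
    unfolding optimal_excess_prob_def using R(1) ex_R S_le_ex
    by (intro cInf_eq_minimum) auto
  have I: "(INF \<pi>\<in>couplings ?\<mu> ?\<nu>. ?te \<pi>) = S"
    using \<pi>(1) te_\<pi> S_le by (intro cInf_eq_minimum) auto
  have "(SUP (A, B)\<in>?closed. X.prob A + Y.prob B - 1) = S"
  proof (rule antisym)
    show "(SUP (A, B)\<in>?closed. X.prob A + Y.prob B - 1) \<le> S"
    proof (rule cSUP_least)
      obtain z where z: "z \<in> separated_compacts c \<alpha>" using ne by blast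
      show "?closed \<noteq> {}" using subsetD[OF compact_closed z] by (metis empty_iff)
      fix z assume "z \<in> ?closed"
      then show "(case z of (A, B) \<Rightarrow> X.prob A + Y.prob B - 1) \<le> S"
        using closed_le[OF _ \<pi>(1), of "fst z" "snd z"] te_\<pi> by (simp add: case_prod_beta)
    qed
    show "S \<le> (SUP (A, B)\<in>?closed. X.prob A + Y.prob B - 1)"
      unfolding S_def separation_def
      using closed_le[OF _ \<pi>(1)] by (intro cSUP_subset_mono ne compact_closed bdd_aboveI2[where M = "?te \<pi>"]) auto
  qed
  moreover have "(SUP A\<in>{A. compactin weak_topology A}. X.prob A - Y.prob (transport_nbhd c \<alpha> A)) = S"
  proof (rule antisym)
    have nbhd: "transport_nbhd c \<alpha> A \<in> sets ?\<nu>" if "compactin weak_topology A" for A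
      unfolding sets_\<nu> by (intro closedin_in_borel_of closedin_transport_nbhd[OF c \<alpha> that])
    have le: "X.prob A - Y.prob (transport_nbhd c \<alpha> A) \<le> S" if A: "compactin weak_topology A" for A
    proof -
      \<comment> \<open>For given \<open>A\<close> this is the largest set separated from it; with
        it, \<open>\<mu>\<^sub>n A + \<nu>\<^sub>n B - 1\<close> becomes the difference in the last
        formula.\<close>
      let ?B = "prob_measures - transport_nbhd c \<alpha> A"
      have "Y.prob ?B = 1 - Y.prob (transport_nbhd c \<alpha> A)" using Y.prob_compl[OF nbhd[OF A]] by (simp add: space_\<nu>)
      moreover have "?B \<in> sets (borel_of weak_topology)"
        using sets.compl_sets[OF nbhd[OF A]] by (simp add: space_\<nu> sets_\<nu>)
      moreover have "A \<in> sets (borel_of weak_topology)"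
        by (rule closedin_in_borel_of[OF compactin_imp_closedin[OF Hausdorff_weak_topology A]])
      moreover have "ennreal \<alpha> < transport_cost c QX QY" if "QX \<in> A" "QY \<in> ?B" for QX QY
        using that unfolding transport_nbhd_def by (auto simp: not_le)
      ultimately show ?thesis
        using separated_le_transport_excess[OF PX PY c \<alpha> n \<pi>(1), of A ?B] te_\<pi> by simp
    qed
    have ne': "{A. compactin (weak_topology :: 'a measure topology) A} \<noteq> {}" using compactin_empty by blast
    show "(SUP A\<in>{A. compactin weak_topology A}. X.prob A - Y.prob (transport_nbhd c \<alpha> A)) \<le> S"
      using le ne' by (intro cSUP_least) auto
    show "S \<le> (SUP A\<in>{A. compactin weak_topology A}. X.prob A - Y.prob (transport_nbhd c \<alpha> A))"
      unfolding S_def separation_def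
    proof (rule cSUP_least[OF ne], clarify)
      fix A B assume AB: "(A, B) \<in> separated_compacts c \<alpha>"
      then have A: "compactin weak_topology A" and B: "closedin weak_topology B"
        and sep: "\<And>QX QY. QX \<in> A \<Longrightarrow> QY \<in> B \<Longrightarrow> ennreal \<alpha> < transport_cost c QX QY"
        using compact_closed unfolding separated_compacts_def by auto
      \<comment> \<open>Conversely, any \<open>B\<close> separated from \<open>A\<close> lies
        outside the neighbourhood, so passing to the neighbourhood of \<open>A\<close> can only
        increase the value.\<close>
      have "transport_nbhd c \<alpha> A \<subseteq> space ?\<nu> - B"
        using sep unfolding transport_nbhd_def space_\<nu> by (auto simp: not_less[symmetric])
      moreover have "B \<in> sets ?\<nu>" unfolding sets_\<nu> by (rule closedin_in_borel_of[OF B])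
      ultimately have "Y.prob (transport_nbhd c \<alpha> A) \<le> 1 - Y.prob B"
        using Y.finite_measure_mono[of "transport_nbhd c \<alpha> A" "space ?\<nu> - B"] Y.prob_compl[of B] by auto
      then have "X.prob A + Y.prob B - 1 \<le> X.prob A - Y.prob (transport_nbhd c \<alpha> A)" by simp
      also have "\<dots> \<le> (SUP A\<in>{A. compactin weak_topology A}. X.prob A - Y.prob (transport_nbhd c \<alpha> A))"
        using A le by (intro cSUP_upper bdd_aboveI2[where M = S]) auto
      finally show "X.prob A + Y.prob B - 1 \<le> (SUP A\<in>{A. compactin weak_topology A}. X.prob A - Y.prob (transport_nbhd c \<alpha> A))" .
    qed
  qed
  moreover have "\<forall>QX\<in>prob_measures. \<forall>QY\<in>prob_measures. \<exists>R\<in>couplings QX QY. (\<integral>\<^sup>+ z. c z \<partial>R) = transport_cost c QX QY"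
    using transport_cost_attained[OF _ _ c] by blast
  ultimately show ?thesis using R(1) ex_R \<pi>(1) te_\<pi> G I by auto
qed

end
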